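(* Let $q\in L_1[0,1]$ be complex-valued with $q(x+1)=q(x)$ and $q_n=0$ for all $n=0,-1,-2,\dots$. For $N\in\mathbb N$ put $$D_N(q)=q_N+\sum_{p=1}^{N-1}\frac{q_{N-p}}{4\pi^2p(N-p)}\left(q_p+\sum_{j=1}^{p-1}\ \sum_{n_1,\dots,n_j}\frac{q_{n_1}q_{n_2}\cdots q_{n_j}\,q_{p-n(j)}}{\prod_{s=1}^{j}4\pi^2\,(p-n(s))(N-p+n(s))}\right),$$ where $n(s)=n_1+n_2+\dots+n_s$ and the innermost sum is over all $n_1,\dots,n_j\in\mathbb N$ with $p-n(j)\in\mathbb N$. Then, for $n\in\mathbb N$, the geometric multiplicity of the eigenvalue $(2\pi n)^2$ of the operator $L_0(q)$ is two if and only if $D_{2n}(q)=0$. Similarly, for $n\in\{0,1,2,\dots\}$, the geometric multiplicity of the eigenvalue $(2\pi n+\pi)^2$ of the operator $L_\pi(q)$ is two if and only if $D_{2n+1}(q)=0$.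
   Context: $q_n=\int_0^1q(x)e^{-i2\pi nx}dx$, $\mathbb N=\{1,2,\dots\}$, empty sums are zero. For $t\in\{0,\pi\}$, $L_t(q)$ is the operator generated in $L_2[0,1]$ by $-y''+qy$ and the boundary conditions $y(1)=e^{it}y(0)$, $y'(1)=e^{it}y'(0)$. Under the stated conditions on $q$, it is known that $(2\pi n)^2$, $n\in\mathbb N$, are eigenvalues of $L_0(q)$ and $(2\pi n+\pi)^2$, $n=0,1,2,\dots$, are eigenvalues of $L_\pi(q)$. *)

theory Defs
  imports "HOL-Analysis.Analysis" "HOL-Library.Function_Algebras"
begin

text \<open>Complex-valued functions on the line as a complex vector space (the pointwise addition
  is the one of \<^theory>\<open>HOL-Library.Function_Algebras\<close>); this provides \<open>cfun.dim\<close>.\<close>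

definition cfun_scale :: "complex \<Rightarrow> (real \<Rightarrow> complex) \<Rightarrow> real \<Rightarrow> complex"
  where "cfun_scale c f = (\<lambda>x. c * f x)"

interpretation cfun: vector_space cfun_scale
  by standard (auto simp: cfun_scale_def fun_eq_iff algebra_simps)

definition fourier_coeff :: "(real \<Rightarrow> complex) \<Rightarrow> int \<Rightarrow> complex"
  where "fourier_coeff q n =
    (LINT x:{0..1}|lebesgue. q x * exp (- (\<i> * of_real (2 * pi * of_int n * x))))"

definition abs_cont_on :: "real \<Rightarrow> real \<Rightarrow> (real \<Rightarrow> complex) \<Rightarrow> bool"
  where "abs_cont_on a b f \<longleftrightarrow>
    (\<forall>\<epsilon>>0. \<exists>\<delta>>0. \<forall>I.
       finite I \<and> (\<forall>(u, v)\<in>I. a \<le> u \<and> u \<le> v \<and> v \<le> b) \<and>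
       pairwise (\<lambda>(u, v) (u', v'). disjnt {u<..<v} {u'<..<v'}) I \<and>
       (\<Sum>(u, v)\<in>I. v - u) < \<delta>
       \<longrightarrow> (\<Sum>(u, v)\<in>I. norm (f v - f u)) < \<epsilon>)"

definition in_L2 :: "(real \<Rightarrow> complex) \<Rightarrow> bool"
  where "in_L2 f \<longleftrightarrow>
    f \<in> borel_measurable (lebesgue_on {0..1}) \<and>
    integrable (lebesgue_on {0..1}) (\<lambda>x. (norm (f x))\<^sup>2)"

text \<open>Derivative on $[0,1]$, one-sided at the endpoints.\<close>

definition D01 :: "(real \<Rightarrow> complex) \<Rightarrow> real \<Rightarrow> complex"
  where "D01 f x = vector_derivative f (at x within {0..1})"

text \<open>The operator generated in $L_2[0,1]$ by $-y''+qy$ and the quasi-periodic boundary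
  conditions. Every class in its domain has exactly one continuous representative on $[0,1]$;
  it is taken as a function on the line that is zero off $[0,1]$, so that dimensions of
  function spaces agree with dimensions in $L_2[0,1]$. The second derivative exists
  almost everywhere, so the operator's values are only meaningful up to null sets.\<close>

definition L_expr :: "(real \<Rightarrow> complex) \<Rightarrow> (real \<Rightarrow> complex) \<Rightarrow> real \<Rightarrow> complex"
  where "L_expr q y x = - D01 (D01 y) x + q x * y x"

definition L_domain :: "real \<Rightarrow> (real \<Rightarrow> complex) \<Rightarrow> (real \<Rightarrow> complex) set"
  where "L_domain t q =
    {y. (\<forall>x. x \<notin> {0..1} \<longrightarrow> y x = 0) \<and>
        y differentiable_on {0..1} \<and>
        abs_cont_on 0 1 (D01 y) \<and>
        in_L2 (L_expr q y) \<and>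
        y 1 = exp (\<i> * of_real t) * y 0 \<and>
        D01 y 1 = exp (\<i> * of_real t) * D01 y 0}"

definition L_eigenspace :: "real \<Rightarrow> (real \<Rightarrow> complex) \<Rightarrow> complex \<Rightarrow> (real \<Rightarrow> complex) set"
  where "L_eigenspace t q \<mu> =
    {y \<in> L_domain t q. AE x in lebesgue_on {0..1}. L_expr q y x = \<mu> * y x}"

definition geometric_multiplicity :: "real \<Rightarrow> (real \<Rightarrow> complex) \<Rightarrow> complex \<Rightarrow> nat"
  where "geometric_multiplicity t q \<mu> = cfun.dim (L_eigenspace t q \<mu>)"

text \<open>Tuples $(n_1,\dots,n_j)$ of positive integers with $n_1+\dots+n_j<p$, as lists;
  for such a list \<open>ns\<close> the partial sum $n(s)$ is \<open>sum_list (take s ns)\<close>.\<close>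

definition tuples :: "nat \<Rightarrow> nat \<Rightarrow> nat list set"
  where "tuples p j = {ns. length ns = j \<and> (\<forall>m\<in>set ns. 1 \<le> m) \<and> sum_list ns < p}"

definition D :: "(real \<Rightarrow> complex) \<Rightarrow> nat \<Rightarrow> complex"
  where "D q N =
    fourier_coeff q (int N) +
    (\<Sum>p = 1..N - 1.
       fourier_coeff q (int N - int p) / of_real (4 * pi\<^sup>2 * real p * (real N - real p)) *
       (fourier_coeff q (int p) +
        (\<Sum>j = 1..p - 1. \<Sum>ns\<in>tuples p j.
           (\<Prod>i<j. fourier_coeff q (int (ns ! i))) *
           fourier_coeff q (int p - int (sum_list ns)) /
           of_real (\<Prod>s = 1..j. 4 * pi\<^sup>2 * (real p - real (sum_list (take s ns))) *
                                (real N - real p + real (sum_list (take s ns)))))))"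

end

theory Submission imports Defs begin

text \<open>Put $\mu=(\pi N)^2$ and expand a function with $y(1)=e^{i\pi N}y(0)$ in the waves
$e^{i\pi(2k-N)x}$, $k\in\mathbb Z$, with coefficients $c_k$. Since
$\mu-(\pi(2k-N))^2=4\pi^2k(N-k)$ and $q$ has only positive frequencies, the equation $-y''+qy=\mu y$ becomes
$$4\pi^2k(N-k)\,c_k=\sum_{j<k}q_{k-j}c_j\qquad(k\in\mathbb Z).$$
Far to the left the factor on the left is so large that the equation is a contraction, whence $c_k=0$ for
very negative $k$, and then for all $k<0$ by forward recursion (\<open>mode_eqs_negative_zero\<close>). From there on the
equation determines every $c_k$ except $c_0$ and $c_N$, where the factor vanishes. The equation for $k=0$
is void, and the one for $k=N$ reads $c_0R=0$, where $R$ is the sum on its right for the solution with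
$c_0=1$. Solving the recursion up to $N$ by iteration writes $R$ as a sum over compositions, and that sum is
$D_N(q)$ (\<open>D_eq_resonance\<close>). So there are two free parameters if $D_N(q)=0$ and at most one otherwise.

The passage between eigenfunctions and coefficients takes more work because $q$ is merely integrable. An
eigenfunction $y$ has an absolutely continuous derivative, and the equation holds only almost
everywhere. Absolutely continuous functions are differentiable almost everywhere
(\<open>abs_cont_differentiable_AE\<close>, by Vitali coverings) and are recovered from their derivatives
(\<open>abs_cont_fundamental_theorem\<close>); integration by parts follows from this for products with the
waves, and gives the equations above together with $c_k=O(k^{-2})$, so that $y$ is its Fourier series
(\<open>eigenfunction_Fourier\<close>). Conversely, solutions of the recursion are absolutely summable. Their series $s$
is only known to be continuous, but integrating $(q-\mu)s$ twice, with the right constants, produces a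
function with the same coefficients, which equals $s$ by uniqueness of Fourier coefficients; almost
everywhere differentiability of integrals makes it an eigenfunction (\<open>synth_eigenfunction\<close>).\<close>

section \<open>Families of intervals and Vitali coverings\<close>

text \<open>The condition on families of intervals in the definition of absolute continuity: the closed intervals may
share endpoints.\<close>

abbreviation nonoverlapping :: "(real \<times> real) set \<Rightarrow> bool"
  where "nonoverlapping \<equiv> pairwise (\<lambda>(u, v) (u', v'). disjnt {u<..<v} {u'<..<v'})"

abbreviation interval_family :: "real \<Rightarrow> real \<Rightarrow> (real \<times> real) set \<Rightarrow> bool"
  where "interval_family a b I \<equiv> finite I \<and> (\<forall>(u, v)\<in>I. a \<le> u \<and> u \<le> v \<and> v \<le> b) \<and> nonoverlapping I"

lemma abs_cont_onE:
  assumes "abs_cont_on a b f" "\<epsilon> > 0"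
  obtains \<delta> where "\<delta> > 0"
    "\<And>I. interval_family a b I \<Longrightarrow> (\<Sum>(u, v)\<in>I. v - u) < \<delta> \<Longrightarrow> (\<Sum>(u, v)\<in>I. norm (f v - f u)) < \<epsilon>"
  using assms unfolding abs_cont_on_def by meson

lemma abs_cont_onI:
  assumes "\<And>\<epsilon>. \<epsilon> > 0 \<Longrightarrow> \<exists>\<delta>>0. \<forall>I. interval_family a b I \<longrightarrow> (\<Sum>(u, v)\<in>I. v - u) < \<delta> \<longrightarrow> (\<Sum>(u, v)\<in>I. norm (f v - f u)) < \<epsilon>"
  shows "abs_cont_on a b f"
  unfolding abs_cont_on_def imp_conjL by (intro allI impI) (rule assms[unfolded imp_conjL])

lemma disjnt_Ioo_iff:
  fixes u v u' v' :: real
  assumes "u < v" "u' < v'"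
  shows "disjnt {u<..<v} {u'<..<v'} \<longleftrightarrow> v \<le> u' \<or> v' \<le> u"
proof
  assume d: "disjnt {u<..<v} {u'<..<v'}"
  show "v \<le> u' \<or> v' \<le> u"
  proof (rule ccontr)
    assume "\<not> ?thesis"
    then have "(max u u' + min v v') / 2 \<in> {u<..<v} \<inter> {u'<..<v'}"
      using assms by (auto simp: max_def min_def)
    with d show False by (auto simp: disjnt_def)
  qed
qed (auto simp: disjnt_def)

text \<open>The gaps that a family leaves in an interval. One choice of gaps serves all \<open>\<phi>\<close>: the identity yields
their total length, and another \<open>\<phi>\<close> is then compared over them. The induction splits off the rightmost interval.\<close>

lemma complementary_intervals:
  fixes F :: "(real \<times> real) set"
  assumes "finite F" "\<And>u v. (u, v) \<in> F \<Longrightarrow> s \<le> u \<and> u < v \<and> v \<le> t" "nonoverlapping F" "s \<le> t"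
  obtains G where "finite G" "\<And>u v. (u, v) \<in> G \<Longrightarrow> s \<le> u \<and> u < v \<and> v \<le> t" "nonoverlapping G"
    "\<And>\<phi>::real \<Rightarrow> real. (\<Sum>(u, v)\<in>F. \<phi> v - \<phi> u) + (\<Sum>(u, v)\<in>G. \<phi> v - \<phi> u) = \<phi> t - \<phi> s"
proof -
  have "\<exists>G. finite G \<and> (\<forall>u v. (u, v) \<in> G \<longrightarrow> s \<le> u \<and> u < v \<and> v \<le> t) \<and> nonoverlapping G \<and>
    (\<forall>\<phi>::real \<Rightarrow> real. (\<Sum>(u, v)\<in>F. \<phi> v - \<phi> u) + (\<Sum>(u, v)\<in>G. \<phi> v - \<phi> u) = \<phi> t - \<phi> s)"
    using assms
  proof (induction "card F" arbitrary: F t)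
    case 0
    then have F: "F = {}" by auto
    define G where "G = (if s < t then {(s, t)} else {})"
    show ?case
      by (rule exI[of _ G]) (use 0 F in \<open>auto simp: G_def pairwise_def\<close>)
  next
    case (Suc n)
    then have ne: "F \<noteq> {}" by auto
    define v where "v = Max (snd ` F)"
    have "v \<in> snd ` F" unfolding v_def using Suc.prems ne by (intro Max_in) auto
    then obtain u where uv: "(u, v) \<in> F" by auto
    have vmax: "v' \<le> v" if "(u', v') \<in> F" for u' v'
      unfolding v_def using that Suc.prems(1) by (force intro: Max_ge)
    have left: "v' \<le> u" if "(u', v') \<in> F - {(u, v)}" for u' v'
    proof -
      have "disjnt {u<..<v} {u'<..<v'}"
        using Suc.prems(3) uv that by (force simp: pairwise_def)
      moreover have "u < v" "u' < v'" "v' \<le> v" using Suc.prems(2) uv that vmax by auto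
      ultimately show ?thesis using disjnt_Ioo_iff[of u v u' v'] by linarith
    qed
    have su: "s \<le> u" "u < v" "v \<le> t" using Suc.prems(2) uv by auto
    have "\<exists>G. finite G \<and> (\<forall>u' v'. (u', v') \<in> G \<longrightarrow> s \<le> u' \<and> u' < v' \<and> v' \<le> u) \<and> nonoverlapping G \<and>
      (\<forall>\<phi>::real \<Rightarrow> real. (\<Sum>(u', v')\<in>F - {(u, v)}. \<phi> v' - \<phi> u') + (\<Sum>(u', v')\<in>G. \<phi> v' - \<phi> u') = \<phi> u - \<phi> s)"
    proof (rule Suc.hyps(1))
      show "n = card (F - {(u, v)})" using Suc.hyps(2) uv Suc.prems(1) by simp
      show "s \<le> u' \<and> u' < v' \<and> v' \<le> u" if "(u', v') \<in> F - {(u, v)}" for u' v'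
        using that left Suc.prems(2)[of u' v'] by blast
      show "nonoverlapping (F - {(u, v)})" using Suc.prems(3) by (rule pairwise_subset) auto
    qed (use su Suc.prems in auto)
    then obtain G where G: "finite G" "\<And>u' v'. (u', v') \<in> G \<Longrightarrow> s \<le> u' \<and> u' < v' \<and> v' \<le> u"
      "nonoverlapping G"
      "\<And>\<phi>::real \<Rightarrow> real. (\<Sum>(u', v')\<in>F - {(u, v)}. \<phi> v' - \<phi> u') + (\<Sum>(u', v')\<in>G. \<phi> v' - \<phi> u') = \<phi> u - \<phi> s"
      by blast
    define H where "H = (if v < t then insert (v, t) G else G)"
    have notin: "(v, t) \<notin> G" using G(2) su by force
    have sumH: "(\<Sum>(u', v')\<in>H. \<phi> v' - \<phi> u') = \<phi> t - \<phi> v + (\<Sum>(u', v')\<in>G. \<phi> v' - \<phi> u')" for \<phi> :: "real \<Rightarrow> real"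
      using notin G(1) su by (auto simp: H_def)
    have sumF: "(\<Sum>(u', v')\<in>F. \<phi> v' - \<phi> u') = \<phi> v - \<phi> u + (\<Sum>(u', v')\<in>F - {(u, v)}. \<phi> v' - \<phi> u')" for \<phi> :: "real \<Rightarrow> real"
      using sum.remove[OF Suc.prems(1) uv, of "\<lambda>(u', v'). \<phi> v' - \<phi> u'"] by simp
    have "nonoverlapping H"
    proof -
      have "nonoverlapping (insert (v, t) G)"
        unfolding pairwise_insert using G(2,3) su by (fastforce simp: disjnt_def)
      then show ?thesis using G(3) by (auto simp: H_def)
    qed
    moreover have "\<forall>u' v'. (u', v') \<in> H \<longrightarrow> s \<le> u' \<and> u' < v' \<and> v' \<le> t"
      using G(2) su by (auto simp: H_def split: if_splits; force)
    moreover have "finite H" using G(1) by (simp add: H_def)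
    moreover have "(\<Sum>(u, v)\<in>F. \<phi> v - \<phi> u) + (\<Sum>(u, v)\<in>H. \<phi> v - \<phi> u) = \<phi> t - \<phi> s" for \<phi> :: "real \<Rightarrow> real"
      unfolding sumH sumF using G(4)[of \<phi>] by (simp add: algebra_simps)
    ultimately show ?case by (intro exI[of _ H] conjI) auto
  qed
  then show ?thesis using that by blast
qed

lemma measure_nonoverlapping:
  assumes "finite F" "\<And>u v. (u, v) \<in> F \<Longrightarrow> u \<le> v" "nonoverlapping F"
  shows "measure lebesgue (\<Union>(u, v)\<in>F. {u<..<v}) = (\<Sum>(u, v)\<in>F. v - u)"
proof -
  have "measure lebesgue (\<Union>p\<in>F. {fst p<..<snd p}) = (\<Sum>p\<in>F. measure lebesgue {fst p<..<snd p})"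
  proof (rule measure_UNION')
    show "pairwise (\<lambda>p p'. disjnt {fst p<..<snd p} {fst p'<..<snd p'}) F"
      using assms(3) by (simp add: case_prod_unfold)
  qed (use assms(1) in auto)
  then show ?thesis using assms(2) by (auto simp: case_prod_unfold intro!: sum.cong)
qed

lemma measure_intervals_le:
  fixes F :: "(real \<times> real) set"
  assumes "finite F" "\<And>u v. (u, v) \<in> F \<Longrightarrow> u \<le> v"
  shows "(\<Union>(u, v)\<in>F. {u..v}) \<in> lmeasurable"
    and "measure lebesgue (\<Union>(u, v)\<in>F. {u..v}) \<le> (\<Sum>(u, v)\<in>F. v - u)"
proof -
  show "(\<Union>(u, v)\<in>F. {u..v}) \<in> lmeasurable"
    using assms(1) by (auto simp: case_prod_unfold intro!: fmeasurable.finite_UN)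
  have "measure lebesgue (\<Union>(u, v)\<in>F. {u..v}) \<le> (\<Sum>p\<in>F. measure lebesgue {fst p..snd p})"
    unfolding case_prod_unfold by (rule measure_UNION_le) (use assms(1) in auto)
  also have "\<dots> = (\<Sum>(u, v)\<in>F. v - u)" using assms(2) by (auto intro!: sum.cong)
  finally show "measure lebesgue (\<Union>(u, v)\<in>F. {u..v}) \<le> (\<Sum>(u, v)\<in>F. v - u)" .
qed

text \<open>Vitali's covering theorem reduced to finitely many intervals: they are disjoint subsets of a set of finite
measure, so that all but finitely many of them have small total measure. These form \<open>T\<close>, together with the
null set that the covering misses.\<close>

lemma Vitali_intervals:
  fixes S W :: "real set" and P :: "real \<Rightarrow> real \<Rightarrow> bool"
  assumes W: "open W" "W \<in> lmeasurable" "S \<subseteq> W" and "\<eta> > 0"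
    and P: "\<And>x d. x \<in> S \<Longrightarrow> d > 0 \<Longrightarrow> \<exists>u v. u \<le> x \<and> x \<le> v \<and> u < v \<and> v - u < d \<and> P u v"
  obtains F T where "finite F" "\<And>u v. (u, v) \<in> F \<Longrightarrow> u < v \<and> {u..v} \<subseteq> W \<and> P u v"
    "nonoverlapping F" "S - (\<Union>(u, v)\<in>F. {u..v}) \<subseteq> T" "T \<in> lmeasurable" "measure lebesgue T < \<eta>"
    "(\<Sum>(u, v)\<in>F. v - u) \<le> measure lebesgue W"
proof -
  define K where "K = {(u, v). u < v \<and> {u..v} \<subseteq> W \<and> P u v}"
  have cb: "cball ((fst i + snd i) / 2) ((snd i - fst i) / 2) = {fst i..snd i}" for i :: "real \<times> real"
    by (simp add: cball_eq_atLeastAtMost field_simps)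
  obtain C where C: "countable C" "C \<subseteq> K"
     "pairwise (\<lambda>i j. disjnt {fst i..snd i} {fst j..snd j}) C"
     "negligible (S - (\<Union>i \<in> C. {fst i..snd i}))"
  proof (rule Vitali_covering_theorem_cballs[of K "\<lambda>i. (snd i - fst i) / 2" S "\<lambda>i. (fst i + snd i) / 2", unfolded cb])
    show "0 < (snd i - fst i) / 2" if "i \<in> K" for i using that by (auto simp: K_def)
    fix x d :: real assume x: "x \<in> S" and d: "0 < d"
    obtain e where e: "e > 0" "cball x e \<subseteq> W" using W x open_contains_cball by blast
    obtain u v where uv: "u \<le> x" "x \<le> v" "u < v" "v - u < min d e" "P u v"
      using P[OF x, of "min d e"] d e by auto
    have "{u..v} \<subseteq> cball x e" using uv by (auto simp: dist_real_def)
    then show "\<exists>i. i \<in> K \<and> x \<in> {fst i..snd i} \<and> (snd i - fst i) / 2 < d"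
      using uv e by (intro exI[of _ "(u, v)"]) (auto simp: K_def)
  qed blast
  let ?B = "\<lambda>i::real\<times>real. {fst i..snd i}"
  let ?U = "\<Union>i\<in>C. ?B i"
  have "?B i \<subseteq> W" if "i \<in> C" for i
  proof -
    have "i \<in> K" using that C(2) by blast
    then show ?thesis by (cases i) (simp add: K_def)
  qed
  then have sub: "?U \<subseteq> W" by blast
  have Um: "?U \<in> lmeasurable"
  proof (rule fmeasurableI2[OF W(2) sub])
    show "?U \<in> sets lebesgue" using C(1) by (intro sets.countable_UN') auto
  qed
  have pos: "fst i < snd i" if "i \<in> C" for i using that C(2) by (auto simp: K_def)
  \<comment> \<open>The lengths are summable, so all but finitely many intervals have small total measure.\<close>
  have "\<exists>F. finite F \<and> F \<subseteq> C \<and> measure lebesgue (\<Union>i\<in>C - F. ?B i) < \<eta>"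
  proof (cases "finite C")
    case True
    then show ?thesis using \<open>\<eta> > 0\<close> by (intro exI[of _ C]) auto
  next
    case False
    define e where "e = from_nat_into C"
    have bij: "bij_betw e UNIV C" unfolding e_def using C(1) False by (rule bij_betw_from_nat_into)
    then have eC: "e n \<in> C" for n by (auto simp: bij_betw_def)
    have inj: "inj e" using bij by (simp add: bij_betw_def)
    have ran: "range e = C" using bij by (simp add: bij_betw_def)
    have lim: "(\<lambda>n. measure lebesgue (?U - (\<Union>i<n. ?B (e i)))) \<longlonglongrightarrow> measure lebesgue (\<Inter>n. ?U - (\<Union>i<n. ?B (e i)))"
    proof (rule Lim_measure_decseq)
      show "range (\<lambda>n. ?U - (\<Union>i<n. ?B (e i))) \<subseteq> sets lebesgue"
        using Um by auto
      show "decseq (\<lambda>n. ?U - (\<Union>i<n. ?B (e i)))" by (auto simp: decseq_def)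
      show "emeasure lebesgue (?U - (\<Union>i<n. ?B (e i))) \<noteq> \<infinity>" for n
      proof -
        have "?U - (\<Union>i<n. ?B (e i)) \<in> lmeasurable" using Um by (intro fmeasurable_Diff) auto
        then show ?thesis by (auto simp: fmeasurable_def)
      qed
    qed
    have emp: "(\<Inter>n. ?U - (\<Union>i<n. ?B (e i))) = {}"
    proof -
      { fix x i assume "i \<in> C" "x \<in> ?B i"
        then obtain k where "e k = i" using ran by auto
        then have "x \<in> (\<Union>i<Suc k. ?B (e i))" using \<open>x \<in> ?B i\<close> by auto
        then have "\<exists>n. x \<in> (\<Union>i<n. ?B (e i))" by blast }
      then show ?thesis by blast
    qed
    have "\<forall>\<^sub>F n in sequentially. measure lebesgue (?U - (\<Union>i<n. ?B (e i))) < \<eta>"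
      using lim \<open>\<eta> > 0\<close> unfolding emp by (intro order_tendstoD(2)) auto
    then obtain n where n: "measure lebesgue (?U - (\<Union>i<n. ?B (e i))) < \<eta>"
      by (auto simp: eventually_sequentially)
    have eq: "(\<Union>i\<in>C - e ` {..<n}. ?B i) = ?U - (\<Union>i<n. ?B (e i))"
    proof (intro equalityI subsetI)
      fix x assume "x \<in> (\<Union>i\<in>C - e ` {..<n}. ?B i)"
      then obtain i where i: "i \<in> C" "i \<notin> e ` {..<n}" "x \<in> ?B i" by blast
      have "x \<notin> ?B (e k)" if "k < n" for k
      proof -
        have "e k \<noteq> i" using i(2) that by blast
        then have "disjnt (?B i) (?B (e k))" using pairwiseD[OF C(3) i(1) eC[of k]] by blast
        then show ?thesis using i(3) by (meson disjnt_iff)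
      qed
      then show "x \<in> ?U - (\<Union>i<n. ?B (e i))" using i(1,3) by blast
    next
      fix x assume x: "x \<in> ?U - (\<Union>i<n. ?B (e i))"
      then obtain i where "i \<in> C" "x \<in> ?B i" by blast
      moreover have "i \<notin> e ` {..<n}" using x \<open>x \<in> ?B i\<close> by blast
      ultimately show "x \<in> (\<Union>i\<in>C - e ` {..<n}. ?B i)" by blast
    qed
    show ?thesis
      by (rule exI[of _ "e ` {..<n}"]) (use n eC in \<open>auto simp: eq\<close>)
  qed
  then obtain F where F: "finite F" "F \<subseteq> C" "measure lebesgue (\<Union>i\<in>C - F. ?B i) < \<eta>" by blast
  define T where "T = (\<Union>i\<in>C - F. ?B i) \<union> (S - ?U)"
  have nT: "S - ?U \<in> null_sets lebesgue" using C(4) by (simp add: negligible_iff_null_sets)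
  have CFm: "(\<Union>i\<in>C - F. ?B i) \<in> lmeasurable"
  proof (rule fmeasurableI2[OF Um])
    show "(\<Union>i\<in>C - F. ?B i) \<in> sets lebesgue" using C(1) by (intro sets.countable_UN') auto
  qed auto
  have nF: "nonoverlapping F"
  proof (rule pairwise_mono[OF C(3) _ F(2)])
    fix i j :: "real \<times> real" assume d: "disjnt (?B i) (?B j)"
    have "disjnt {fst i<..<snd i} {fst j<..<snd j}"
      by (rule disjnt_subset1[OF disjnt_subset2[OF d]]) auto
    then show "(\<lambda>(u, v) (u', v'). disjnt {u<..<v} {u'<..<v'}) i j" by (simp add: case_prod_unfold)
  qed
  show ?thesis
  proof (rule that[of F T])
    show "finite F" by fact
    show "u < v \<and> {u..v} \<subseteq> W \<and> P u v" if "(u, v) \<in> F" for u v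
      using that F C by (auto simp: K_def)
    show "nonoverlapping F" by fact
    show "S - (\<Union>(u, v)\<in>F. {u..v}) \<subseteq> T" by (auto simp: T_def)
    show "T \<in> lmeasurable" unfolding T_def using CFm nT
      by (meson fmeasurable.Un negligible_imp_measurable negligible_iff_null_sets)
    show "measure lebesgue T < \<eta>" unfolding T_def
      using measure_Un_null_set[OF _ nT] CFm F(3) by auto
    have "(\<Sum>(u, v)\<in>F. v - u) = measure lebesgue (\<Union>(u, v)\<in>F. {u<..<v})"
    proof (rule measure_nonoverlapping[symmetric])
      show "u \<le> v" if "(u, v) \<in> F" for u v using pos[of "(u, v)"] F(2) that by auto
    qed (use F(1) nF in auto)
    also have "\<dots> \<le> measure lebesgue W"
    proof (rule measure_mono_fmeasurable[OF _ _ W(2)])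
      have "{fst p<..<snd p} \<subseteq> ?B p" for p :: "real \<times> real" by auto
      then have "(\<Union>p\<in>F. {fst p<..<snd p}) \<subseteq> ?U" using F(2) by blast
      then show "(\<Union>(u, v)\<in>F. {u<..<v}) \<subseteq> W" using sub unfolding case_prod_unfold by blast
    qed (use F(1) in \<open>auto simp: case_prod_unfold intro!: sets.finite_UN\<close>)
    finally show "(\<Sum>(u, v)\<in>F. v - u) \<le> measure lebesgue W" .
  qed
qed

section \<open>Absolutely continuous functions\<close>

text \<open>All closure properties of absolute continuity below come from comparing increments.\<close>

lemma abs_cont_on_dominated:
  assumes f: "abs_cont_on a b f" and h: "abs_cont_on a b h" and "C \<ge> 0"
    and dom: "\<And>u v. a \<le> u \<Longrightarrow> u \<le> v \<Longrightarrow> v \<le> b \<Longrightarrow> norm (g v - g u) \<le> C * (norm (f v - f u) + norm (h v - h u))"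
  shows "abs_cont_on a b g"
proof (rule abs_cont_onI)
  fix \<epsilon> :: real assume "\<epsilon> > 0"
  define \<epsilon>' where "\<epsilon>' = \<epsilon> / (2 * (C + 1))"
  have \<epsilon>'_eq: "\<epsilon>' * (2 * (C + 1)) = \<epsilon>" using \<open>C \<ge> 0\<close> by (simp add: \<epsilon>'_def)
  have \<epsilon>': "\<epsilon>' > 0" using \<open>\<epsilon> > 0\<close> \<open>C \<ge> 0\<close> by (simp add: \<epsilon>'_def)
  obtain \<delta>1 where \<delta>1: "\<delta>1 > 0" "\<And>I. interval_family a b I \<Longrightarrow> (\<Sum>(u, v)\<in>I. v - u) < \<delta>1 \<Longrightarrow> (\<Sum>(u, v)\<in>I. norm (f v - f u)) < \<epsilon>'"
    by (rule abs_cont_onE[OF f \<epsilon>']) (rule that)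
  obtain \<delta>2 where \<delta>2: "\<delta>2 > 0" "\<And>I. interval_family a b I \<Longrightarrow> (\<Sum>(u, v)\<in>I. v - u) < \<delta>2 \<Longrightarrow> (\<Sum>(u, v)\<in>I. norm (h v - h u)) < \<epsilon>'"
    by (rule abs_cont_onE[OF h \<epsilon>']) (rule that)
  show "\<exists>\<delta>>0. \<forall>I. interval_family a b I \<longrightarrow> (\<Sum>(u, v)\<in>I. v - u) < \<delta> \<longrightarrow> (\<Sum>(u, v)\<in>I. norm (g v - g u)) < \<epsilon>"
  proof (rule exI[of _ "min \<delta>1 \<delta>2"], intro conjI allI impI)
    show "min \<delta>1 \<delta>2 > 0" using \<delta>1 \<delta>2 by simp
    fix I assume I: "interval_family a b I" "(\<Sum>(u, v)\<in>I. v - u) < min \<delta>1 \<delta>2"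
    have "(\<Sum>(u, v)\<in>I. norm (g v - g u)) \<le> (\<Sum>(u, v)\<in>I. C * (norm (f v - f u) + norm (h v - h u)))"
      using I dom by (intro sum_mono) auto
    also have "\<dots> = C * ((\<Sum>(u, v)\<in>I. norm (f v - f u)) + (\<Sum>(u, v)\<in>I. norm (h v - h u)))"
      by (simp add: case_prod_unfold flip: sum_distrib_left sum.distrib)
    also have "\<dots> \<le> C * (\<epsilon>' + \<epsilon>')"
      using \<delta>1(2)[of I] \<delta>2(2)[of I] I \<open>C \<ge> 0\<close> by (intro mult_left_mono add_mono) (simp_all add: less_imp_le)
    also have "\<dots> < (C + 1) * (\<epsilon>' + \<epsilon>')" using \<epsilon>' by (intro mult_strict_right_mono) auto
    also have "\<dots> = \<epsilon>" using \<epsilon>'_eq by (simp add: algebra_simps)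
    finally show "(\<Sum>(u, v)\<in>I. norm (g v - g u)) < \<epsilon>" .
  qed
qed

lemma abs_cont_on_of_real: "abs_cont_on a b of_real"
proof (rule abs_cont_onI)
  fix \<epsilon> :: real assume "\<epsilon> > 0"
  have "(\<Sum>(u, v)\<in>I. norm (complex_of_real v - of_real u)) = (\<Sum>(u, v)\<in>I. v - u)"
    if "\<forall>(u, v)\<in>I. a \<le> u \<and> u \<le> v \<and> v \<le> b" for I
    using that by (intro sum.cong) (auto simp: of_real_diff[symmetric] simp del: of_real_diff)
  then show "\<exists>\<delta>>0. \<forall>I. interval_family a b I \<longrightarrow> (\<Sum>(u, v)\<in>I. v - u) < \<delta> \<longrightarrow> (\<Sum>(u, v)\<in>I. norm (complex_of_real v - of_real u)) < \<epsilon>"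
    using \<open>\<epsilon> > 0\<close> by auto
qed

lemma Lipschitz_imp_abs_cont_on:
  assumes "C \<ge> 0" "\<And>u v. a \<le> u \<Longrightarrow> u \<le> v \<Longrightarrow> v \<le> b \<Longrightarrow> norm (g v - g u) \<le> C * (v - u)"
  shows "abs_cont_on a b g"
proof (rule abs_cont_on_dominated[OF abs_cont_on_of_real abs_cont_on_of_real \<open>C \<ge> 0\<close>])
  fix u v :: real assume uv: "a \<le> u" "u \<le> v" "v \<le> b"
  have "norm (g v - g u) \<le> C * (v - u)" using assms uv by blast
  also have "\<dots> \<le> C * ((v - u) + (v - u))" using uv \<open>C \<ge> 0\<close> by (intro mult_left_mono) auto
  finally show "norm (g v - g u) \<le> C * (norm (complex_of_real v - of_real u) + norm (complex_of_real v - of_real u))"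
    using uv by (simp add: of_real_diff[symmetric] del: of_real_diff)
qed

lemma abs_cont_on_imp_continuous_on:
  assumes "abs_cont_on a b f"
  shows "continuous_on {a..b} f"
  unfolding continuous_on_iff
proof (intro ballI allI impI)
  fix x e :: real assume x: "x \<in> {a..b}" and "e > 0"
  obtain \<delta> where \<delta>: "\<delta> > 0" "\<And>I. interval_family a b I \<Longrightarrow> (\<Sum>(u, v)\<in>I. v - u) < \<delta> \<Longrightarrow> (\<Sum>(u, v)\<in>I. norm (f v - f u)) < e"
    by (rule abs_cont_onE[OF assms \<open>e > 0\<close>]) (rule that)
  have "dist (f y) (f x) < e" if "y \<in> {a..b}" "dist y x < \<delta>" for y
  proof (cases "y \<le> x")
    case True
    then show ?thesis using \<delta>(2)[of "{(y, x)}"] x that by (simp add: dist_norm norm_minus_commute)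
  next
    case False
    then show ?thesis using \<delta>(2)[of "{(x, y)}"] x that by (simp add: dist_norm norm_minus_commute)
  qed
  then show "\<exists>d>0. \<forall>x'\<in>{a..b}. dist x' x < d \<longrightarrow> dist (f x') (f x) < e" using \<delta>(1) by blast
qed

lemma abs_cont_on_mult:
  assumes f: "abs_cont_on a b f" and g: "abs_cont_on a b g"
  shows "abs_cont_on a b (\<lambda>x. f x * g x)"
proof -
  have "bounded (f ` {a..b})" "bounded (g ` {a..b})"
    by (intro compact_imp_bounded compact_continuous_image abs_cont_on_imp_continuous_on f g compact_Icc)+
  then obtain B1 B2 where B: "\<And>x. x \<in> {a..b} \<Longrightarrow> norm (f x) \<le> B1" "\<And>x. x \<in> {a..b} \<Longrightarrow> norm (g x) \<le> B2"
    unfolding bounded_iff by (metis imageI)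
  define C where "C = max 0 (max B1 B2)"
  have C: "C \<ge> 0" "\<And>x. x \<in> {a..b} \<Longrightarrow> norm (f x) \<le> C" "\<And>x. x \<in> {a..b} \<Longrightarrow> norm (g x) \<le> C"
    using B unfolding C_def by (simp, simp add: le_max_iff_disj, simp add: le_max_iff_disj)
  show ?thesis
  proof (rule abs_cont_on_dominated[OF f g C(1)])
    fix u v assume uv: "a \<le> u" "u \<le> v" "v \<le> b"
    have "f v * g v - f u * g u = (f v - f u) * g v + f u * (g v - g u)" by (simp add: algebra_simps)
    then have "norm (f v * g v - f u * g u) \<le> norm (f v - f u) * norm (g v) + norm (f u) * norm (g v - g u)"
      by (metis norm_mult norm_triangle_ineq)
    also have "\<dots> \<le> norm (f v - f u) * C + C * norm (g v - g u)"
      using C uv by (intro add_mono mult_mono) auto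
    finally show "norm (f v * g v - f u * g u) \<le> C * (norm (f v - f u) + norm (g v - g u))"
      by (simp add: algebra_simps)
  qed
qed

section \<open>Differentiability of absolutely continuous functions\<close>

text \<open>The core of almost everywhere differentiability: arbitrarily short intervals around each point of \<open>S\<close> have
slope at most \<open>a\<close>, and others slope at least \<open>b > a\<close>. Cover \<open>S\<close>, up to small measure and inside an open set
that is hardly larger than \<open>S\<close>, by intervals of the first kind, and then again, inside these, by intervals of the
second kind. Both families have nearly the outer measure \<open>m\<close> of \<open>S\<close> as total length, so the gaps between
them are short, and by absolute continuity the increments of \<open>f\<close> over the two families nearly agree. But they are
at most about \<open>a * m\<close> and at least about \<open>b * m\<close>, hence \<open>m = 0\<close>. As \<open>S\<close> is not known to be measurable, the argument
uses outer measure throughout.\<close>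

lemma negligible_slopes_between:
  fixes f :: "real \<Rightarrow> real"
  assumes ac: "abs_cont_on \<alpha> \<beta> (\<lambda>x. of_real (f x))" and "a < b" and S: "S \<subseteq> {\<alpha><..<\<beta>}"
    and lo: "\<And>x d. x \<in> S \<Longrightarrow> d > 0 \<Longrightarrow> \<exists>u v. u \<le> x \<and> x \<le> v \<and> u < v \<and> v - u < d \<and> f v - f u \<le> a * (v - u)"
    and hi: "\<And>x d. x \<in> S \<Longrightarrow> d > 0 \<Longrightarrow> \<exists>u v. u \<le> x \<and> x \<le> v \<and> u < v \<and> v - u < d \<and> f v - f u \<ge> b * (v - u)"
  shows "negligible S"
proof (rule ccontr)
  assume "\<not> negligible S"
  then obtain e0 where e0: "e0 > 0" "\<And>T. S \<subseteq> T \<Longrightarrow> T \<in> lmeasurable \<Longrightarrow> measure lebesgue T > e0"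
    unfolding negligible_outer_le by (auto simp: not_le)
  define m where "m = Inf (measure lebesgue ` {T. S \<subseteq> T \<and> T \<in> lmeasurable})"
  have cands: "{\<alpha><..<\<beta>} \<in> {T. S \<subseteq> T \<and> T \<in> lmeasurable}" using S by auto
  have m_le: "m \<le> measure lebesgue T" if "S \<subseteq> T" "T \<in> lmeasurable" for T
    unfolding m_def using that by (intro cINF_lower bdd_belowI2[of _ 0]) auto
  have "e0 \<le> m" unfolding m_def
    by (rule cINF_greatest) (use cands e0(2) in \<open>auto intro: less_imp_le\<close>)
  then have "m > 0" using e0 by linarith
  define \<epsilon> where "\<epsilon> = (b - a) * m / 4"
  have "\<epsilon> > 0" using \<open>a < b\<close> \<open>m > 0\<close> by (simp add: \<epsilon>_def)
  obtain \<delta> where \<delta>: "\<delta> > 0" "\<And>I. interval_family \<alpha> \<beta> I \<Longrightarrow> (\<Sum>(u, v)\<in>I. v - u) < \<delta> \<Longrightarrow> (\<Sum>(u, v)\<in>I. norm (complex_of_real (f v) - of_real (f u))) < \<epsilon>"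
    by (rule abs_cont_onE[OF ac \<open>\<epsilon> > 0\<close>]) (rule that)
  \<comment> \<open>the gaps will have total length below \<open>3 * \<eta>\<close>; the second bound makes the error terms other than \<open>\<epsilon>\<close> at most \<open>(b - a) * m / 2\<close>\<close>
  define \<eta> where "\<eta> = min (\<delta> / 4) ((b - a) * m / (6 * (b - a + \<bar>a\<bar>)))"
  have "\<eta> > 0" using \<delta>(1) \<open>a < b\<close> \<open>m > 0\<close> by (simp add: \<eta>_def)
  have \<eta>1: "3 * \<eta> < \<delta>" using \<delta>(1) by (simp add: \<eta>_def)
  have \<eta>2: "3 * \<eta> * (b - a + \<bar>a\<bar>) \<le> (b - a) * m / 2"
  proof -
    have "\<eta> * (6 * (b - a + \<bar>a\<bar>)) \<le> (b - a) * m"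
      using \<open>a < b\<close> by (subst pos_le_divide_eq[symmetric]) (auto simp: \<eta>_def)
    then show ?thesis by (simp add: algebra_simps)
  qed
  obtain T0 where T0: "S \<subseteq> T0" "T0 \<in> lmeasurable" "measure lebesgue T0 < m + \<eta> / 2"
    using cInf_lessD[of "measure lebesgue ` {T. S \<subseteq> T \<and> T \<in> lmeasurable}" "m + \<eta> / 2"] cands \<open>\<eta> > 0\<close>
    unfolding m_def[symmetric] by auto
  obtain W0 where W0: "open W0" "T0 \<subseteq> W0" "W0 - T0 \<in> lmeasurable" "emeasure lebesgue (W0 - T0) < ennreal (\<eta> / 2)"
    using sets_lebesgue_outer_open[of T0 "\<eta> / 2"] T0(2) \<open>\<eta> > 0\<close> by (auto simp: fmeasurable_def)
  have W0T0: "measure lebesgue (W0 - T0) < \<eta> / 2"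
    using W0(3,4) \<open>\<eta> > 0\<close> by (simp add: emeasure_eq_measure2 ennreal_less_iff)
  have W0m: "W0 \<in> lmeasurable" using fmeasurable.Un[OF W0(3) T0(2)] W0(2) by (simp add: Un_absorb2)
  have W0meas: "measure lebesgue W0 < m + \<eta>"
  proof -
    have "measure lebesgue W0 \<le> measure lebesgue (W0 - T0) + measure lebesgue T0"
      using measure_Un_le[of "W0 - T0" lebesgue T0] W0(2,3) T0(2) by (simp add: Un_absorb2)
    then show ?thesis using W0T0 T0(3) by linarith
  qed
  define W where "W = W0 \<inter> {\<alpha><..<\<beta>}"
  have W: "open W" "W \<in> lmeasurable" "S \<subseteq> W" "W \<subseteq> {\<alpha><..<\<beta>}"
    using W0 W0m T0 S by (auto simp: W_def)
  have Wmeas: "measure lebesgue W < m + \<eta>"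
    using measure_mono_fmeasurable[of W W0 lebesgue] W0m W(2) W0meas by (auto simp: W_def fmeasurable_def)
  obtain F1 T1 where F1: "finite F1" "\<And>u v. (u, v) \<in> F1 \<Longrightarrow> u < v \<and> {u..v} \<subseteq> W \<and> f v - f u \<le> a * (v - u)"
    "nonoverlapping F1" "S - (\<Union>(u, v)\<in>F1. {u..v}) \<subseteq> T1" "T1 \<in> lmeasurable" "measure lebesgue T1 < \<eta>"
    "(\<Sum>(u, v)\<in>F1. v - u) \<le> measure lebesgue W"
    by (rule Vitali_intervals[OF W(1-3) \<open>\<eta> > 0\<close>, of "\<lambda>u v. f v - f u \<le> a * (v - u)"]) (use lo in blast)+
  define U1 where "U1 = (\<Union>(u, v)\<in>F1. {u<..<v})"
  have U1: "open U1" "U1 \<in> lmeasurable"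
    using F1(1) by (auto simp: U1_def case_prod_unfold intro!: fmeasurable.finite_UN)
  \<comment> \<open>each interval of the second family is required to lie in a single interval of the first\<close>
  define P2 where "P2 = (\<lambda>u v. f v - f u \<ge> b * (v - u) \<and> (\<exists>(s, t)\<in>F1. s < u \<and> v < t))"
  have P2: "\<exists>u v. u \<le> x \<and> x \<le> v \<and> u < v \<and> v - u < d \<and> P2 u v" if x: "x \<in> S \<inter> U1" and "d > 0" for x d
  proof -
    obtain s t where st: "(s, t) \<in> F1" "s < x" "x < t" using x by (auto simp: U1_def)
    define d' where "d' = Min {d, x - s, t - x}"
    have d': "d' > 0" "d' \<le> d" "d' \<le> x - s" "d' \<le> t - x" using \<open>d > 0\<close> st by (auto simp: d'_def)
    obtain u v where "u \<le> x" "x \<le> v" "u < v" "v - u < d'" "f v - f u \<ge> b * (v - u)"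
      using hi[of x d'] x d'(1) by blast
    then show ?thesis using d' st by (intro exI[of _ u] exI[of _ v]) (auto simp: P2_def intro!: bexI[of _ "(s, t)"])
  qed
  obtain F2 T2 where F2: "finite F2" "\<And>u v. (u, v) \<in> F2 \<Longrightarrow> u < v \<and> {u..v} \<subseteq> U1 \<and> P2 u v"
    "nonoverlapping F2" "S \<inter> U1 - (\<Union>(u, v)\<in>F2. {u..v}) \<subseteq> T2" "T2 \<in> lmeasurable" "measure lebesgue T2 < \<eta>"
    using Vitali_intervals[OF U1, of "S \<inter> U1" \<eta> P2] P2 \<open>\<eta> > 0\<close> by (metis Int_lower2)
  define A where "A = (\<Sum>(u, v)\<in>F1. v - u)"
  define B where "B = (\<Sum>(u, v)\<in>F2. v - u)"
  have B: "B > m - 2 * \<eta>"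
  proof -
    define E where "E = fst ` F1 \<union> snd ` F1"
    have E: "E \<in> lmeasurable" "measure lebesgue E = 0"
      using F1(1) by (auto simp: E_def negligible_imp_measurable negligible_imp_measure0 negligible_finite)
    define V where "V = (\<Union>(u, v)\<in>F2. {u..v})"
    have F2le: "u \<le> v" if "(u, v) \<in> F2" for u v using F2(2)[OF that] by simp
    have V: "V \<in> lmeasurable" and VB: "measure lebesgue V \<le> B"
      unfolding V_def B_def by (rule measure_intervals_le, rule F2(1), erule F2le)+
    have "S \<subseteq> (T1 \<union> T2) \<union> (V \<union> E)"
    proof
      fix x assume x: "x \<in> S"
      show "x \<in> (T1 \<union> T2) \<union> (V \<union> E)"
      proof (cases "x \<in> (\<Union>(u, v)\<in>F1. {u..v})")
        case True
        then obtain u v where uv: "(u, v) \<in> F1" "u \<le> x" "x \<le> v" by auto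
        show ?thesis
        proof (cases "x = u \<or> x = v")
          case True
          then show ?thesis using uv by (force simp: E_def)
        next
          case False
          then have "x \<in> S \<inter> U1" using uv x by (auto simp: U1_def intro!: bexI[of _ "(u, v)"])
          then show ?thesis using F2(4) by (auto simp: V_def)
        qed
      qed (use F1(4) x in blast)
    qed
    then have "m \<le> measure lebesgue ((T1 \<union> T2) \<union> (V \<union> E))"
      using F1(5) F2(5) V E by (intro m_le) auto
    also have "\<dots> \<le> measure lebesgue (T1 \<union> T2) + measure lebesgue (V \<union> E)"
      using F1(5) F2(5) V E by (intro measure_Un_le) auto
    also have "\<dots> \<le> (measure lebesgue T1 + measure lebesgue T2) + (measure lebesgue V + measure lebesgue E)"
      using F1(5) F2(5) V E by (intro add_mono measure_Un_le) auto
    finally show ?thesis using F1(6) F2(6) VB E by linarith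
  qed
  \<comment> \<open>The gaps left in the first family by the second one.\<close>
  define J where "J = (\<lambda>p. {q \<in> F2. fst p < fst q \<and> snd q < snd p})"
  let ?gaps = "\<lambda>p G. finite G \<and> (\<forall>u v. (u, v) \<in> G \<longrightarrow> fst p \<le> u \<and> u < v \<and> v \<le> snd p) \<and> nonoverlapping G \<and>
    (\<forall>\<phi>::real \<Rightarrow> real. (\<Sum>(u, v)\<in>J p. \<phi> v - \<phi> u) + (\<Sum>(u, v)\<in>G. \<phi> v - \<phi> u) = \<phi> (snd p) - \<phi> (fst p))"
  have "\<forall>p\<in>F1. \<exists>G. ?gaps p G"
  proof
    fix p assume p: "p \<in> F1"
    have n: "nonoverlapping (J p)" using F2(3) by (rule pairwise_subset) (auto simp: J_def)
    show "\<exists>G. ?gaps p G"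
    proof (rule complementary_intervals[of "J p" "fst p" "snd p"])
      show "fst p \<le> snd p" using F1(2)[of "fst p" "snd p"] p by simp
      show "fst p \<le> u \<and> u < v \<and> v \<le> snd p" if "(u, v) \<in> J p" for u v
        using that F2(2)[of u v] by (simp add: J_def)
    qed (use n F2(1) in \<open>auto simp: J_def\<close>)
  qed
  then obtain G where G: "\<And>p. p \<in> F1 \<Longrightarrow> finite (G p)"
    "\<And>p u v. p \<in> F1 \<Longrightarrow> (u, v) \<in> G p \<Longrightarrow> fst p \<le> u \<and> u < v \<and> v \<le> snd p"
    "\<And>p. p \<in> F1 \<Longrightarrow> nonoverlapping (G p)"
    "\<And>p (\<phi>::real \<Rightarrow> real). p \<in> F1 \<Longrightarrow> (\<Sum>(u, v)\<in>J p. \<phi> v - \<phi> u) + (\<Sum>(u, v)\<in>G p. \<phi> v - \<phi> u) = \<phi> (snd p) - \<phi> (fst p)"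
    by metis
  have sep: "snd p \<le> fst p' \<or> snd p' \<le> fst p" if "p \<in> F1" "p' \<in> F1" "p \<noteq> p'" for p p'
  proof -
    have "disjnt {fst p<..<snd p} {fst p'<..<snd p'}"
      using pairwiseD[OF F1(3) that] by (simp only: case_prod_unfold)
    then show ?thesis
      using that F1(2)[of "fst p" "snd p"] F1(2)[of "fst p'" "snd p'"]
        disjnt_Ioo_iff[of "fst p" "snd p" "fst p'" "snd p'"] by simp
  qed
  define H where "H = (\<Union>p\<in>F1. G p)"
  have Hsum: "(\<Sum>q\<in>H. \<psi> q) = (\<Sum>p\<in>F1. \<Sum>q\<in>G p. \<psi> q)" for \<psi> :: "real \<times> real \<Rightarrow> real"
    unfolding H_def
  proof (rule sum.UNION_disjoint)
    have "G p \<inter> G p' = {}" if "p \<in> F1" "p' \<in> F1" "p \<noteq> p'" for p p'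
    proof -
      have False if "(u, v) \<in> G p" "(u, v) \<in> G p'" for u v
        using sep[OF \<open>p \<in> F1\<close> \<open>p' \<in> F1\<close> \<open>p \<noteq> p'\<close>] G(2)[OF \<open>p \<in> F1\<close> that(1)] G(2)[OF \<open>p' \<in> F1\<close> that(2)]
        by linarith
      then show ?thesis by auto
    qed
    then show "\<forall>p\<in>F1. \<forall>p'\<in>F1. p \<noteq> p' \<longrightarrow> G p \<inter> G p' = {}" by blast
  qed (use F1(1) G(1) in auto)
  have F2U: "F2 = (\<Union>p\<in>F1. J p)"
  proof (intro equalityI subsetI)
    fix q assume q: "q \<in> F2"
    obtain u v where [simp]: "q = (u, v)" by (cases q)
    have "P2 u v" using F2(2)[of u v] q by simp
    then obtain p where p: "p \<in> F1" "fst p < u" "v < snd p" unfolding P2_def by auto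
    then have "q \<in> J p" using q by (simp add: J_def)
    then show "q \<in> (\<Union>p\<in>F1. J p)" using p(1) by blast
  qed (auto simp: J_def)
  have F2sum: "(\<Sum>q\<in>F2. \<psi> q) = (\<Sum>p\<in>F1. \<Sum>q\<in>J p. \<psi> q)" for \<psi> :: "real \<times> real \<Rightarrow> real"
  proof -
    have "(\<Sum>q\<in>(\<Union>p\<in>F1. J p). \<psi> q) = (\<Sum>p\<in>F1. \<Sum>q\<in>J p. \<psi> q)"
    proof (rule sum.UNION_disjoint)
      have "J p \<inter> J p' = {}" if "p \<in> F1" "p' \<in> F1" "p \<noteq> p'" for p p'
      proof -
        have False if "(u, v) \<in> J p" "(u, v) \<in> J p'" for u v
        proof -
          have "fst p < u" "v < snd p" "fst p' < u" "v < snd p'" "u < v"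
            using that F2(2)[of u v] by (simp_all add: J_def)
          then show False
            using sep[OF \<open>p \<in> F1\<close> \<open>p' \<in> F1\<close> \<open>p \<noteq> p'\<close>] by linarith
        qed
        then show ?thesis by auto
      qed
      then show "\<forall>p\<in>F1. \<forall>p'\<in>F1. p \<noteq> p' \<longrightarrow> J p \<inter> J p' = {}" by blast
    qed (use F1(1) F2(1) in \<open>auto simp: J_def\<close>)
    then show ?thesis using F2U by simp
  qed
  have total: "(\<Sum>(u, v)\<in>F2. \<phi> v - \<phi> u) + (\<Sum>(u, v)\<in>H. \<phi> v - \<phi> u) = (\<Sum>(u, v)\<in>F1. \<phi> v - \<phi> u)" for \<phi> :: "real \<Rightarrow> real"
    unfolding F2sum Hsum sum.distrib[symmetric] by (rule sum.cong) (use G(4) in auto)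
  have Hlen: "(\<Sum>(u, v)\<in>H. v - u) = A - B" using total[of "\<lambda>x. x"] by (simp add: A_def B_def)
  have AW: "A < m + \<eta>" using F1(7) Wmeas by (simp add: A_def)
  have finH: "finite H" using F1(1) G(1) by (auto simp: H_def)
  have nH: "nonoverlapping H"
  proof -
    have "disjnt {u<..<v} {u'<..<v'}" if q: "(u, v) \<in> H" "(u', v') \<in> H" and ne: "(u, v) \<noteq> (u', v')" for u v u' v'
    proof -
      obtain p p' where p: "p \<in> F1" "(u, v) \<in> G p" "p' \<in> F1" "(u', v') \<in> G p'" using q by (auto simp: H_def)
      show "disjnt {u<..<v} {u'<..<v'}"
      proof (cases "p = p'")
        case True
        from pairwiseD[OF G(3)[OF p(1)] p(2) p(4)[folded True] ne] show ?thesis by simp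
      next
        case False
        note uv = G(2)[OF p(1,2)] and uv' = G(2)[OF p(3,4)]
        have "v \<le> u' \<or> v' \<le> u"
          using sep[OF p(1,3) False]
        proof
          assume "snd p \<le> fst p'"
          then have "v \<le> u'" using uv uv' by (meson order_trans)
          then show ?thesis ..
        next
          assume "snd p' \<le> fst p"
          then have "v' \<le> u" using uv uv' by (meson order_trans)
          then show ?thesis ..
        qed
        then show ?thesis using disjnt_Ioo_iff[of u v u' v'] uv uv' by simp
      qed
    qed
    then show ?thesis unfolding pairwise_def by blast
  qed
  have Hin: "\<alpha> \<le> u \<and> u \<le> v \<and> v \<le> \<beta>" if uvH: "(u, v) \<in> H" for u v
  proof -
    obtain p where p: "p \<in> F1" "(u, v) \<in> G p" using uvH unfolding H_def by blast
    have "fst p < snd p" "{fst p..snd p} \<subseteq> W" using F1(2)[of "fst p" "snd p"] p by simp_all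
    moreover from this(1) have "fst p \<in> {fst p..snd p}" "snd p \<in> {fst p..snd p}" by simp_all
    ultimately have "fst p \<in> W" "snd p \<in> W" by blast+
    then have "\<alpha> < fst p" "snd p < \<beta>" using W(4) by auto
    then show ?thesis using G(2)[OF p] by auto
  qed
  have small: "(\<Sum>(u, v)\<in>H. norm (complex_of_real (f v) - of_real (f u))) < \<epsilon>"
    proof (rule \<delta>(2))
    show "interval_family \<alpha> \<beta> H" using finH nH Hin by blast
    show "(\<Sum>(u, v)\<in>H. v - u) < \<delta>" using Hlen AW B \<eta>1 by linarith
  qed
  have "- (\<Sum>(u, v)\<in>H. f v - f u) \<le> (\<Sum>(u, v)\<in>H. norm (complex_of_real (f v) - of_real (f u)))"
    unfolding sum_negf[symmetric] by (rule sum_mono) (auto simp: of_real_diff[symmetric] simp del: of_real_diff)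
  then have incr: "(\<Sum>(u, v)\<in>F2. f v - f u) \<le> (\<Sum>(u, v)\<in>F1. f v - f u) + \<epsilon>"
    using total[of f] small by linarith
  have "b * B \<le> (\<Sum>(u, v)\<in>F2. f v - f u)"
    unfolding B_def sum_distrib_left using F2(2) by (intro sum_mono) (auto simp: P2_def)
  moreover have "(\<Sum>(u, v)\<in>F1. f v - f u) \<le> a * A"
    unfolding A_def sum_distrib_left using F1(2) by (intro sum_mono) auto
  ultimately have "b * B \<le> a * A + \<epsilon>" using incr by linarith
  then have "(b - a) * B \<le> a * (A - B) + \<epsilon>" by (simp add: algebra_simps)
  moreover have "a * (A - B) \<le> \<bar>a\<bar> * (3 * \<eta>)"
  proof -
    have "0 \<le> A - B" unfolding Hlen[symmetric] by (rule sum_nonneg) (use Hin in auto)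
    then have "a * (A - B) \<le> \<bar>a\<bar> * (A - B)" by (intro mult_right_mono) auto
    also have "\<dots> \<le> \<bar>a\<bar> * (3 * \<eta>)" using AW B by (intro mult_left_mono) auto
    finally show ?thesis .
  qed
  moreover have "(b - a) * (m - 2 * \<eta>) \<le> (b - a) * B" using B \<open>a < b\<close> by (intro mult_left_mono) auto
  ultimately have "(b - a) * m \<le> 2 * \<eta> * (b - a) + 3 * \<eta> * \<bar>a\<bar> + \<epsilon>" by (simp add: algebra_simps)
  also have "\<dots> \<le> 3 * \<eta> * (b - a + \<bar>a\<bar>) + \<epsilon>" using \<open>\<eta> > 0\<close> \<open>a < b\<close> by (simp add: algebra_simps)
  also have "\<dots> \<le> (b - a) * m / 2 + \<epsilon>" using \<eta>2 by linarith
  finally have "(b - a) * m \<le> 0" unfolding \<epsilon>_def by linarith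
  then show False using \<open>a < b\<close> \<open>m > 0\<close> by (simp add: mult_le_0_iff)
qed

text \<open>On an interval shorter than the \<open>\<delta>\<close> that belongs to \<open>\<epsilon> = 1\<close>, disjoint intervals have increments of sum less
than 1, so those of slope at least \<open>M\<close> have total length at most \<open>1 / M\<close>. Countably many such short intervals
cover the line.\<close>

lemma negligible_unbounded_slopes:
  assumes ac: "abs_cont_on \<alpha> \<beta> f" and S: "S \<subseteq> {\<alpha><..<\<beta>}"
    and slopes: "\<And>x M d. x \<in> S \<Longrightarrow> d > 0 \<Longrightarrow> \<exists>u v. u \<le> x \<and> x \<le> v \<and> u < v \<and> v - u < d \<and> norm (f v - f u) \<ge> M * (v - u)"
  shows "negligible S"
proof -
  obtain \<delta> where \<delta>: "\<delta> > 0" "\<And>I. interval_family \<alpha> \<beta> I \<Longrightarrow> (\<Sum>(u, v)\<in>I. v - u) < \<delta> \<Longrightarrow> (\<Sum>(u, v)\<in>I. norm (f v - f u)) < 1"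
    by (rule abs_cont_onE[OF ac zero_less_one]) (rule that)
  let ?P = "\<lambda>c. S \<inter> {c - \<delta> / 4<..<c + \<delta> / 4}"
  have piece: "negligible (?P c)" for c
    unfolding negligible_outer_le
  proof (intro allI impI)
    fix e :: real assume "e > 0"
    define W where "W = {\<alpha><..<\<beta>} \<inter> {c - \<delta> / 4<..<c + \<delta> / 4}"
    have W: "open W" "W \<in> lmeasurable" "?P c \<subseteq> W" "W \<subseteq> {\<alpha><..<\<beta>}"
      using S by (auto simp: W_def)
    have "measure lebesgue W \<le> measure lebesgue {c - \<delta> / 4<..<c + \<delta> / 4}"
      by (rule measure_mono_fmeasurable) (auto simp: W_def)
    then have Wm: "measure lebesgue W < \<delta>" using \<delta>(1) by simp
    obtain F T where F: "finite F" "\<And>u v. (u, v) \<in> F \<Longrightarrow> u < v \<and> {u..v} \<subseteq> W \<and> norm (f v - f u) \<ge> (2 / e) * (v - u)"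
      "nonoverlapping F" "?P c - (\<Union>(u, v)\<in>F. {u..v}) \<subseteq> T" "T \<in> lmeasurable" "measure lebesgue T < e / 2"
      "(\<Sum>(u, v)\<in>F. v - u) \<le> measure lebesgue W"
      by (rule Vitali_intervals[OF W(1-3), of "e / 2" "\<lambda>u v. norm (f v - f u) \<ge> (2 / e) * (v - u)"])
        (use slopes[of _ _ "2 / e"] \<open>e > 0\<close> in \<open>simp | blast\<close>)+
    have in_ab: "\<alpha> \<le> u \<and> u \<le> v \<and> v \<le> \<beta>" if "(u, v) \<in> F" for u v
    proof -
      have "u < v" "{u..v} \<subseteq> W" using F(2)[OF that] by auto
      moreover from this(1) have "u \<in> {u..v}" "v \<in> {u..v}" by auto
      ultimately have "u \<in> {\<alpha><..<\<beta>}" "v \<in> {\<alpha><..<\<beta>}" using W(4) by blast+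
      then show ?thesis using \<open>u < v\<close> by auto
    qed
    have "(2 / e) * (\<Sum>(u, v)\<in>F. v - u) \<le> (\<Sum>(u, v)\<in>F. norm (f v - f u))"
      unfolding sum_distrib_left using F(2) by (intro sum_mono) auto
    also have "\<dots> < 1"
    proof (rule \<delta>(2))
      show "interval_family \<alpha> \<beta> F" using F(1,3) in_ab by blast
    qed (use F(7) Wm in linarith)
    finally have len: "(\<Sum>(u, v)\<in>F. v - u) \<le> e / 2" using \<open>e > 0\<close> by (simp add: field_simps)
    define V where "V = (\<Union>(u, v)\<in>F. {u..v})"
    have Fle: "u \<le> v" if "(u, v) \<in> F" for u v using F(2)[OF that] by simp
    have V: "V \<in> lmeasurable" and VF: "measure lebesgue V \<le> (\<Sum>(u, v)\<in>F. v - u)"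
      unfolding V_def by (rule measure_intervals_le, rule F(1), erule Fle)+
    have "measure lebesgue V \<le> e / 2" using VF len by linarith
    moreover have "measure lebesgue (V \<union> T) \<le> measure lebesgue V + measure lebesgue T"
      using V F(5) by (intro measure_Un_le) auto
    ultimately have "measure lebesgue (V \<union> T) \<le> e" using F(6) by linarith
    moreover have "?P c \<subseteq> V \<union> T" using F(4) by (auto simp: V_def)
    ultimately show "\<exists>T. ?P c \<subseteq> T \<and> T \<in> lmeasurable \<and> measure lebesgue T \<le> e"
      using V F(5) by blast
  qed
  have "negligible (\<Union>r::rat. ?P (of_rat r))"
  proof -
    have "countable (range (\<lambda>r::rat. ?P (of_rat r)))" by simp
    then show ?thesis using negligible_countable_Union piece by blast
  qed
  moreover have "S \<subseteq> (\<Union>r::rat. ?P (of_rat r))"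
  proof
    fix x assume "x \<in> S"
    obtain r :: rat where "x - \<delta> / 4 < of_rat r" "of_rat r < x" using of_rat_dense[of "x - \<delta> / 4" x] \<delta>(1) by auto
    then show "x \<in> (\<Union>r::rat. ?P (of_rat r))" using \<open>x \<in> S\<close> by (auto intro!: exI[of _ r])
  qed
  ultimately show ?thesis using negligible_subset by blast
qed

lemma frequently_slope:
  fixes f :: "real \<Rightarrow> 'a::real_normed_vector"
  assumes "\<exists>\<^sub>F y in at x. P ((f y - f x) /\<^sub>R (y - x))" "d > 0"
  shows "\<exists>u v. u \<le> x \<and> x \<le> v \<and> u < v \<and> v - u < d \<and> P ((f v - f u) /\<^sub>R (v - u))"
proof -
  have "\<exists>y. y \<noteq> x \<and> dist y x < d \<and> P ((f y - f x) /\<^sub>R (y - x))"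
    using assms by (auto simp: frequently_def eventually_at)
  then obtain y where y: "y \<noteq> x" "\<bar>y - x\<bar> < d" "P ((f y - f x) /\<^sub>R (y - x))" by (auto simp: dist_real_def)
  have eq: "(f x - f y) /\<^sub>R (x - y) = (f y - f x) /\<^sub>R (y - x)"
    by (metis minus_diff_eq inverse_minus_eq scaleR_minus_left scaleR_minus_right minus_minus)
  show ?thesis
  proof (cases "y < x")
    case True
    have "P ((f x - f y) /\<^sub>R (x - y))" by (subst eq) (rule y(3))
    then show ?thesis using True y(2) by (intro exI[of _ y] exI[of _ x]) simp
  next
    case False
    then show ?thesis using y by (intro exI[of _ x] exI[of _ y]) simp
  qed
qed

text \<open>Where the difference quotient has no finite limit, either its lower and upper limits are separated by two
rationals, or it is unbounded. Each of these countably many sets is null.\<close>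

lemma real_abs_cont_differentiable_AE:
  fixes f :: "real \<Rightarrow> real"
  assumes ac: "abs_cont_on \<alpha> \<beta> (\<lambda>x. of_real (f x))"
  obtains N where "negligible N" "\<And>x. x \<in> {\<alpha><..<\<beta>} - N \<Longrightarrow> \<exists>D. (f has_vector_derivative D) (at x)"
proof -
  let ?s = "\<lambda>x y. (f y - f x) /\<^sub>R (y - x)"
  define A where "A = (\<lambda>(a, b). {x\<in>{\<alpha><..<\<beta>}. (\<exists>\<^sub>F y in at x. ?s x y < of_rat a) \<and> (\<exists>\<^sub>F y in at x. ?s x y > of_rat b)})"
  define U where "U = {x\<in>{\<alpha><..<\<beta>}. \<forall>M. \<exists>\<^sub>F y in at x. \<bar>?s x y\<bar> > M}"
  \<comment> \<open>rationals suffice to separate the lower from the upper limit, and keep the union countable\<close>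
  have negA: "negligible (A (a, b))" if "a < b" for a b :: rat
  proof (rule negligible_slopes_between[OF ac, of "of_rat a" "of_rat b"])
    show "(of_rat a :: real) < of_rat b" using that by (simp add: of_rat_less)
    fix x d :: real assume x: "x \<in> A (a, b)" and "d > 0"
    obtain u v where uv: "u \<le> x" "x \<le> v" "u < v" "v - u < d" "(f v - f u) /\<^sub>R (v - u) < of_rat a"
      using frequently_slope[where x = x and P = "\<lambda>s. s < of_rat a" and f = f and d = d] x \<open>d > 0\<close> by (auto simp: A_def)
    then have "f v - f u \<le> of_rat a * (v - u)" by (simp add: divide_simps split: if_splits)
    then show "\<exists>u v. u \<le> x \<and> x \<le> v \<and> u < v \<and> v - u < d \<and> f v - f u \<le> of_rat a * (v - u)" using uv by blast
    obtain u v where uv: "u \<le> x" "x \<le> v" "u < v" "v - u < d" "(f v - f u) /\<^sub>R (v - u) > of_rat b"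
      using frequently_slope[where x = x and P = "\<lambda>s. s > of_rat b" and f = f and d = d] x \<open>d > 0\<close> by (auto simp: A_def)
    then have "f v - f u \<ge> of_rat b * (v - u)" by (simp add: divide_simps split: if_splits)
    then show "\<exists>u v. u \<le> x \<and> x \<le> v \<and> u < v \<and> v - u < d \<and> f v - f u \<ge> of_rat b * (v - u)" using uv by blast
  qed (auto simp: A_def)
  have negU: "negligible U"
  proof (rule negligible_unbounded_slopes[OF ac])
    fix x M d :: real assume x: "x \<in> U" and "d > 0"
    obtain u v where uv: "u \<le> x" "x \<le> v" "u < v" "v - u < d" "\<bar>(f v - f u) /\<^sub>R (v - u)\<bar> > M"
      using frequently_slope[where x = x and P = "\<lambda>s. \<bar>s\<bar> > M" and f = f and d = d] x \<open>d > 0\<close> by (auto simp: U_def)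
    then have "\<bar>f v - f u\<bar> \<ge> M * (v - u)" by (simp add: abs_mult abs_of_pos field_simps)
    then show "\<exists>u v. u \<le> x \<and> x \<le> v \<and> u < v \<and> v - u < d \<and> norm (complex_of_real (f v) - of_real (f u)) \<ge> M * (v - u)"
      using uv by (intro exI[of _ u] exI[of _ v]) (auto simp: of_real_diff[symmetric] simp del: of_real_diff)
  qed (auto simp: U_def)
  define N where "N = (\<Union>p\<in>{(a, b). a < b}. A p) \<union> U"
  have "negligible N"
  proof -
    have "negligible (\<Union>(A ` {(a, b). a < b}))"
      by (rule negligible_countable_Union) (use negA in auto)
    then show ?thesis unfolding N_def using negU by (rule negligible_Un)
  qed
  moreover have "\<exists>D. (f has_vector_derivative D) (at x)" if x: "x \<in> {\<alpha><..<\<beta>} - N" for x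
  proof -
    let ?S = "\<lambda>y. ereal (?s x y)"
    have "Liminf (at x) ?S = Limsup (at x) ?S"
    proof (rule ccontr)
      assume "Liminf (at x) ?S \<noteq> Limsup (at x) ?S"
      then have "Liminf (at x) ?S < Limsup (at x) ?S"
        using Liminf_le_Limsup[of "at x" ?S] by (simp add: order.strict_iff_order)
      then obtain c where c: "Liminf (at x) ?S < ereal c" "ereal c < Limsup (at x) ?S"
        using ereal_dense2 by blast
      obtain d where d: "Liminf (at x) ?S < ereal d" "ereal d < ereal c" using ereal_dense2 c(1) by blast
      obtain b where b: "ereal c < ereal b" "ereal b < Limsup (at x) ?S" using ereal_dense2 c(2) by blast
      obtain q where q: "d < of_rat q" "of_rat q < c" using of_rat_dense[of d c] d(2) by auto
      obtain r where r: "c < of_rat r" "of_rat r < b" using of_rat_dense[of c b] b(1) by auto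
      have "\<exists>\<^sub>F y in at x. ?s x y < of_rat q"
      proof (rule ccontr)
        assume "\<not> ?thesis"
        then have "\<forall>\<^sub>F y in at x. \<not> ?s x y < of_rat q" by (simp only: not_frequently simp_thms)
        then have "\<forall>\<^sub>F y in at x. ereal (of_rat q) \<le> ?S y" by (rule eventually_mono) (simp only: not_less ereal_less_eq)
        then have "ereal (of_rat q) \<le> Liminf (at x) ?S" by (rule Liminf_bounded)
        also have "\<dots> < ereal d" by (rule d(1))
        finally show False using q(1) by simp
      qed
      moreover have "\<exists>\<^sub>F y in at x. ?s x y > of_rat r"
      proof (rule ccontr)
        assume "\<not> ?thesis"
        then have "\<forall>\<^sub>F y in at x. \<not> ?s x y > of_rat r" by (simp only: not_frequently simp_thms)
        then have "\<forall>\<^sub>F y in at x. ?S y \<le> ereal (of_rat r)" by (rule eventually_mono) (simp only: not_less ereal_less_eq)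
        then have "Limsup (at x) ?S \<le> ereal (of_rat r)" by (rule Limsup_bounded)
        with b(2) have "ereal b < ereal (of_rat r)" by (rule less_le_trans)
        then show False using r(2) by simp
      qed
      ultimately have "x \<in> A (q, r)" using x by (simp add: A_def)
      moreover have "q < r" using q r by (metis less_trans of_rat_less)
      ultimately show False using x unfolding N_def by blast
    qed
    then have lim: "(?S \<longlongrightarrow> Limsup (at x) ?S) (at x)" by (intro Liminf_eq_Limsup) auto
    have "x \<notin> U" using x by (simp add: N_def)
    then obtain M where M: "\<forall>\<^sub>F y in at x. \<bar>?s x y\<bar> \<le> M" using x by (auto simp: U_def not_frequently not_less)
    have up: "\<forall>\<^sub>F y in at x. ?S y \<le> ereal M" using M by eventually_elim simp
    have low: "\<forall>\<^sub>F y in at x. ereal (- M) \<le> ?S y" using M by eventually_elim simp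
    have "Limsup (at x) ?S \<noteq> \<infinity>" "Limsup (at x) ?S \<noteq> - \<infinity>"
      using Limsup_bounded[OF up] order_trans[OF Liminf_bounded[OF low] Liminf_le_Limsup] by auto
    then obtain D where "Limsup (at x) ?S = ereal D" by (cases "Limsup (at x) ?S") simp_all
    then have "(?s x \<longlongrightarrow> D) (at x)" using lim by simp
    then have "(f has_real_derivative D) (at x)"
      by (simp add: has_field_derivative_iff divide_inverse mult.commute)
    then show ?thesis by (auto simp: has_real_derivative_iff_has_vector_derivative)
  qed
  ultimately show thesis using that by blast
qed

theorem abs_cont_differentiable_AE:
  assumes ac: "abs_cont_on \<alpha> \<beta> f"
  obtains N where "negligible N" "\<And>x. x \<in> {\<alpha><..<\<beta>} - N \<Longrightarrow> \<exists>D. (f has_vector_derivative D) (at x)"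
proof -
  have "abs_cont_on \<alpha> \<beta> (\<lambda>x. of_real (Re (f x)))"
  proof (rule abs_cont_on_dominated[OF ac ac, of 1])
    fix u v
    show "norm (complex_of_real (Re (f v)) - of_real (Re (f u))) \<le> 1 * (norm (f v - f u) + norm (f v - f u))"
      using abs_Re_le_cmod[of "f v - f u"] by (simp add: of_real_diff[symmetric] del: of_real_diff)
  qed simp
  then obtain N1 where N1: "negligible N1" "\<And>x. x \<in> {\<alpha><..<\<beta>} - N1 \<Longrightarrow> \<exists>D. ((\<lambda>x. Re (f x)) has_vector_derivative D) (at x)"
    by (rule real_abs_cont_differentiable_AE) blast
  have "abs_cont_on \<alpha> \<beta> (\<lambda>x. of_real (Im (f x)))"
  proof (rule abs_cont_on_dominated[OF ac ac, of 1])
    fix u v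
    show "norm (complex_of_real (Im (f v)) - of_real (Im (f u))) \<le> 1 * (norm (f v - f u) + norm (f v - f u))"
      using abs_Im_le_cmod[of "f v - f u"] by (simp add: of_real_diff[symmetric] del: of_real_diff)
  qed simp
  then obtain N2 where N2: "negligible N2" "\<And>x. x \<in> {\<alpha><..<\<beta>} - N2 \<Longrightarrow> \<exists>D. ((\<lambda>x. Im (f x)) has_vector_derivative D) (at x)"
    by (rule real_abs_cont_differentiable_AE) blast
  show thesis
  proof (rule that[of "N1 \<union> N2"])
    show "negligible (N1 \<union> N2)" using N1 N2 by (rule_tac negligible_Un)
    fix x assume "x \<in> {\<alpha><..<\<beta>} - (N1 \<union> N2)"
    then obtain D1 D2 where "((\<lambda>x. Re (f x)) has_vector_derivative D1) (at x)" "((\<lambda>x. Im (f x)) has_vector_derivative D2) (at x)"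
      using N1(2)[of x] N2(2)[of x] by blast
    then show "\<exists>D. (f has_vector_derivative D) (at x)"
      by (intro exI[of _ "Complex D1 D2"])
        (simp add: has_vector_derivative_complex_iff has_real_derivative_iff_has_vector_derivative)
  qed
qed

section \<open>The fundamental theorem of calculus\<close>

text \<open>A gauge argument. Around points of differentiability the gauge makes the increment close to the derivative times
the length. Points of the exceptional null set get an open set of small measure as their gauge, and absolute continuity
bounds the sum of the increments over the intervals tagged there.\<close>

lemma abs_cont_fundamental_theorem:
  assumes ac: "abs_cont_on a b f" and "a \<le> b" and N: "negligible N"
    and deriv: "\<And>x. x \<in> {a<..<b} - N \<Longrightarrow> (f has_vector_derivative g x) (at x)"
  shows "(g has_integral (f b - f a)) {a..b}"
proof -
  define N' where "N' = N \<union> {a, b}"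
  have N': "negligible N'" using N by (simp add: N'_def)
  have "((\<lambda>x. if x \<in> N' then 0 else g x) has_integral (f b - f a)) (cbox a b)"
    unfolding has_integral
  proof (intro allI impI)
    fix e :: real assume "e > 0"
    obtain \<delta> where \<delta>: "\<delta> > 0" "\<And>I. interval_family a b I \<Longrightarrow> (\<Sum>(u, v)\<in>I. v - u) < \<delta> \<Longrightarrow> (\<Sum>(u, v)\<in>I. norm (f v - f u)) < e / 2"
      by (rule abs_cont_onE[OF ac half_gt_zero[OF \<open>e > 0\<close>]]) (rule that)
    obtain O' where O': "open O'" "N' \<subseteq> O'" "O' - N' \<in> lmeasurable" "emeasure lebesgue (O' - N') < ennreal \<delta>"
      using sets_lebesgue_outer_open[OF negligible_imp_sets[OF N'] \<delta>(1)] by blast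
    have N'm: "N' \<in> null_sets lebesgue" using N' by (simp add: negligible_iff_null_sets)
    have O'm: "O' \<in> lmeasurable"
      using fmeasurable.Un[OF O'(3) negligible_imp_measurable[OF N']] O'(2) by (simp add: Un_absorb2)
    have "measure lebesgue O' = measure lebesgue (O' - N')"
      using measure_Diff_null_set[OF fmeasurableD[OF O'm] N'm] by simp
    then have O'meas: "measure lebesgue O' < \<delta>"
      using O'(3,4) \<delta>(1) by (simp add: emeasure_eq_measure2 ennreal_less_iff)
    define e' where "e' = e / (2 * (b - a + 1))"
    have e': "e' > 0" using \<open>e > 0\<close> \<open>a \<le> b\<close> by (simp add: e'_def)
    have "2 * (b - a + 1) > 0" using \<open>a \<le> b\<close> by simp
    then have nz: "2 * (b - a + 1) \<noteq> 0" by (rule less_imp_neq[symmetric])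
    have e'_eq: "e' * (2 * (b - a + 1)) = e" using e'_def nonzero_eq_divide_eq[OF nz] by metis
    have "\<exists>d>0. \<forall>y. \<bar>y - x\<bar> < d \<longrightarrow> norm (f y - f x - (y - x) *\<^sub>R g x) \<le> e' * \<bar>y - x\<bar>"
      if "x \<in> {a<..<b} - N" for x
      using deriv[OF that] e' unfolding has_vector_derivative_def has_derivative_at_alt by auto
    then obtain d where d: "\<And>x. x \<in> {a<..<b} - N \<Longrightarrow> d x > 0"
      "\<And>x y. x \<in> {a<..<b} - N \<Longrightarrow> \<bar>y - x\<bar> < d x \<Longrightarrow> norm (f y - f x - (y - x) *\<^sub>R g x) \<le> e' * \<bar>y - x\<bar>"
      by metis
    define \<gamma> where "\<gamma> = (\<lambda>x. if x \<in> N' then O' else if x \<in> {a..b} then ball x (d x) else ball x 1)"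
    have good: "x \<in> {a<..<b} - N" if "x \<in> {a..b}" "x \<notin> N'" for x
      using that by (auto simp: N'_def)
    have gauge: "gauge \<gamma>" unfolding gauge_def \<gamma>_def using O'(1,2) d(1) good by auto
    have bound: "norm ((\<Sum>(x, K)\<in>p. measure lborel K *\<^sub>R (if x \<in> N' then 0 else g x)) - (f b - f a)) < e"
      if p: "p tagged_division_of cbox a b" and fine: "\<gamma> fine p" for p
    proof -
      have fin: "finite p" using p by (rule tagged_division_of_finite)
      have K: "x \<in> K" "K \<subseteq> {a..b}" "K = {Inf K..Sup K}" "Inf K \<le> Sup K" "measure lborel K = Sup K - Inf K" "K \<subseteq> \<gamma> x"
        "a \<le> Inf K" "Sup K \<le> b" "Inf K \<le> x" "x \<le> Sup K"
        if xK: "(x, K) \<in> p" for x K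
      proof -
        obtain u v where uv: "K = cbox u v" using tagged_division_ofD(4)[OF p xK] by blast
        show x: "x \<in> K" and sub: "K \<subseteq> {a..b}"
          using tagged_division_ofD(2,3)[OF p xK] by auto
        then have "u \<le> v" using uv by auto
        then show *: "K = {Inf K..Sup K}" "Inf K \<le> Sup K" "measure lborel K = Sup K - Inf K" using uv by auto
        show "K \<subseteq> \<gamma> x" using fine xK by (auto simp: fine_def)
        have "Inf K \<in> K" "Sup K \<in> K" using \<open>u \<le> v\<close> uv by auto
        then show "a \<le> Inf K" "Sup K \<le> b" using sub by auto
        show "Inf K \<le> x" "x \<le> Sup K" using x uv \<open>u \<le> v\<close> by auto
      qed
      have tel: "(\<Sum>(x, K)\<in>p. f (Sup K) - f (Inf K)) = f b - f a"
        using additive_tagged_division_1[OF \<open>a \<le> b\<close>, of p f] p by simp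
      define P where "P = {(x, K) \<in> p. x \<in> N'}"
      have P: "P \<subseteq> p" "finite P" using fin by (auto simp: P_def intro: finite_subset)
      define T where "T = (\<lambda>(x, K). measure lborel K *\<^sub>R (if x \<in> N' then 0 else g x) - (f (Sup K) - f (Inf K)))"
      have split: "(\<Sum>(x, K)\<in>p. measure lborel K *\<^sub>R (if x \<in> N' then 0 else g x)) - (f b - f a) = sum T (p - P) + sum T P"
        unfolding tel[symmetric] sum_subtractf[symmetric] sum.subset_diff[OF P(1) fin, symmetric]
        by (rule sum.cong) (auto simp: T_def)
      have "norm (sum T (p - P)) \<le> e / 2"
      proof -
        have "norm (sum T (p - P)) \<le> (\<Sum>(x, K)\<in>p - P. e' * measure lborel K)"
        proof (rule sum_norm_le, clarify)
          fix x K assume xK: "(x, K) \<in> p" "(x, K) \<notin> P"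
          then have "x \<notin> N'" by (auto simp: P_def)
          note KK = K[OF xK(1)]
          have x: "x \<in> {a<..<b} - N" using good[of x] \<open>x \<notin> N'\<close> KK(1,2) by blast
          have "K \<subseteq> ball x (d x)" using KK(1,2,6) \<open>x \<notin> N'\<close> by (auto simp: \<gamma>_def split: if_splits)
          moreover have "Inf K \<in> K" "Sup K \<in> K" using KK(3,4) by (metis atLeastAtMost_iff order_refl)+
          ultimately have "\<bar>Inf K - x\<bar> < d x" "\<bar>Sup K - x\<bar> < d x" by (auto simp: dist_real_def)
          then have 1: "norm (f (Inf K) - f x - (Inf K - x) *\<^sub>R g x) \<le> e' * (x - Inf K)"
            and 2: "norm (f (Sup K) - f x - (Sup K - x) *\<^sub>R g x) \<le> e' * (Sup K - x)"
            using d(2)[OF x, of "Inf K"] d(2)[OF x, of "Sup K"] KK(9,10) by (auto simp: abs_if split: if_splits)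
          have "T (x, K) = (f (Inf K) - f x - (Inf K - x) *\<^sub>R g x) - (f (Sup K) - f x - (Sup K - x) *\<^sub>R g x)"
          proof -
            have "T (x, K) = measure lborel K *\<^sub>R g x - (f (Sup K) - f (Inf K))"
              using \<open>x \<notin> N'\<close> by (simp add: T_def)
            then show ?thesis unfolding KK(5) by (simp add: algebra_simps)
          qed
          then have "norm (T (x, K)) \<le> norm (f (Inf K) - f x - (Inf K - x) *\<^sub>R g x) + norm (f (Sup K) - f x - (Sup K - x) *\<^sub>R g x)"
            by (simp only: norm_triangle_ineq4)
          also have "\<dots> \<le> e' * (x - Inf K) + e' * (Sup K - x)" by (rule add_mono[OF 1 2])
          also have "\<dots> = e' * measure lborel K" unfolding KK(5) by (simp add: algebra_simps)
          finally show "norm (T (x, K)) \<le> e' * measure lborel K" .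
        qed
        also have "\<dots> \<le> (\<Sum>(x, K)\<in>p. e' * measure lborel K)"
          using fin e' K(4,5) by (intro sum_mono2) auto
        also have "\<dots> = e' * (\<Sum>(x, K)\<in>p. measure lborel K)" by (simp add: sum_distrib_left case_prod_unfold)
        also have "\<dots> = e' * (b - a)" using additive_content_tagged_division[OF p] \<open>a \<le> b\<close> by simp
        also have "\<dots> \<le> e' * (b - a + 1)" using e' by simp
        also have "\<dots> = e / 2" using e'_eq by (simp add: algebra_simps)
        finally show ?thesis .
      qed
      moreover have "norm (sum T P) < e / 2"
      proof -
        define P' where "P' = {(x, K) \<in> P. Inf K < Sup K}"
        define \<iota> where "\<iota> = (\<lambda>(x::real, K::real set). (Inf K, Sup K))"
        have P': "P' \<subseteq> P" "finite P'" using P(2) by (auto simp: P'_def intro: finite_subset)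
        have dis: "disjnt {Inf K<..<Sup K} {Inf K'<..<Sup K'}" if "(x, K) \<in> P'" "(x', K') \<in> P'" "(x, K) \<noteq> (x', K')" for x K x' K'
        proof -
          have pp: "(x, K) \<in> p" "(x', K') \<in> p" using that P(1) P'(1) by blast+
          have "interior K \<inter> interior K' = {}" by (rule tagged_division_ofD(5)[OF p pp that(3)])
          then show ?thesis using K(3)[OF pp(1)] K(3)[OF pp(2)] by (metis disjnt_def interior_atLeastAtMost_real)
        qed
        have inj: "inj_on \<iota> P'"
        proof (rule inj_onI, clarify)
          fix x K x' K' assume a: "(x, K) \<in> P'" "(x', K') \<in> P'" "\<iota> (x, K) = \<iota> (x', K')"
          show "x = x' \<and> K = K'"
          proof (rule ccontr)
            assume "\<not> ?thesis"
            then have "disjnt {Inf K<..<Sup K} {Inf K'<..<Sup K'}" using dis[OF a(1,2)] by blast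
            moreover have "Inf K = Inf K'" "Sup K = Sup K'" "Inf K < Sup K" using a by (auto simp: \<iota>_def P'_def)
            ultimately show False by (simp add: disjnt_def)
          qed
        qed
        have nI: "nonoverlapping (\<iota> ` P')"
        proof (rule pairwiseI)
          fix q q' assume a: "q \<in> \<iota> ` P'" "q' \<in> \<iota> ` P'" "q \<noteq> q'"
          obtain x K where 1: "(x, K) \<in> P'" "q = (Inf K, Sup K)" using a(1) by (auto simp: \<iota>_def)
          obtain x' K' where 2: "(x', K') \<in> P'" "q' = (Inf K', Sup K')" using a(2) by (auto simp: \<iota>_def)
          have "(x, K) \<noteq> (x', K')" using a(3) 1 2 by blast
          from dis[OF 1(1) 2(1) this] show "(\<lambda>(u, v) (u', v'). disjnt {u<..<v} {u'<..<v'}) q q'"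
            by (simp add: 1 2)
        qed
        have inI: "a \<le> u \<and> u < v \<and> v \<le> b \<and> {u<..<v} \<subseteq> O'" if uv: "(u, v) \<in> \<iota> ` P'" for u v
        proof -
          obtain x K where xK: "(x, K) \<in> P'" "u = Inf K" "v = Sup K" using uv by (auto simp: \<iota>_def)
          then have "(x, K) \<in> p" "x \<in> N'" "Inf K < Sup K" by (auto simp: P'_def P_def)
          moreover from this have "K \<subseteq> O'" using K(6)[of x K] by (simp add: \<gamma>_def)
          moreover have "{u<..<v} \<subseteq> K" using K(3)[OF \<open>(x, K) \<in> p\<close>] xK(2,3) by (metis greaterThanLessThan_subseteq_atLeastAtMost_iff order_refl)
          ultimately show ?thesis using xK K(7,8) by blast
        qed
        have "(\<Sum>(u, v)\<in>\<iota> ` P'. v - u) = measure lebesgue (\<Union>(u, v)\<in>\<iota> ` P'. {u<..<v})"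
        proof (rule measure_nonoverlapping[symmetric, OF _ _ nI])
          show "u \<le> v" if "(u, v) \<in> \<iota> ` P'" for u v using inI[OF that] by simp
        qed (use P'(2) in simp)
        also have "\<dots> \<le> measure lebesgue O'"
        proof (rule measure_mono_fmeasurable[OF _ _ O'm])
          have "{fst q<..<snd q} \<subseteq> O'" if "q \<in> \<iota> ` P'" for q
            using inI[of "fst q" "snd q"] that by simp
          then show "(\<Union>(u, v)\<in>\<iota> ` P'. {u<..<v}) \<subseteq> O'" unfolding case_prod_unfold by blast
          have "open (\<Union>q\<in>\<iota> ` P'. {fst q<..<snd q})" by auto
          then show "(\<Union>(u, v)\<in>\<iota> ` P'. {u<..<v}) \<in> sets lebesgue" by (simp add: case_prod_unfold)
        qed
        finally have len: "(\<Sum>(u, v)\<in>\<iota> ` P'. v - u) < \<delta>" using O'meas by linarith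
        have PP': "sum T P = sum T P'"
        proof (rule sum.mono_neutral_right[OF P(2) P'(1)], clarify)
          fix x K assume "(x, K) \<in> P" "(x, K) \<notin> P'"
          then have xp: "(x, K) \<in> p" and xN: "x \<in> N'" and "\<not> Inf K < Sup K" by (auto simp: P_def P'_def)
          then have "Inf K = Sup K" using K(4)[OF xp] by linarith
          then show "T (x, K) = 0" using xN by (simp add: T_def)
        qed
        have "norm (sum T P') \<le> (\<Sum>(x, K)\<in>P'. norm (f (Sup K) - f (Inf K)))"
          by (rule sum_norm_le) (auto simp: T_def P'_def P_def norm_minus_commute)
        also have "\<dots> = (\<Sum>(u, v)\<in>\<iota> ` P'. norm (f v - f u))"
          by (subst sum.reindex[OF inj]) (auto simp: \<iota>_def intro!: sum.cong)
        also have "\<dots> < e / 2"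
        proof (rule \<delta>(2)[OF _ len], intro conjI nI)
          show "\<forall>(u, v)\<in>\<iota> ` P'. a \<le> u \<and> u \<le> v \<and> v \<le> b"
          proof
            fix q assume q: "q \<in> \<iota> ` P'"
            obtain u v where [simp]: "q = (u, v)" by (cases q)
            have "a \<le> u \<and> u < v \<and> v \<le> b \<and> {u<..<v} \<subseteq> O'" using q by (intro inI) simp
            then show "case q of (u, v) \<Rightarrow> a \<le> u \<and> u \<le> v \<and> v \<le> b" by simp
          qed
          show "finite (\<iota> ` P')" using P'(2) by (rule finite_imageI)
        qed
        finally show ?thesis by (simp only: PP')
      qed
      ultimately have "norm (sum T (p - P)) + norm (sum T P) < e" by linarith
      with norm_triangle_ineq have "norm (sum T (p - P) + sum T P) < e" by (rule le_less_trans)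
      then show ?thesis by (simp only: split)
    qed
    show "\<exists>\<gamma>. gauge \<gamma> \<and> (\<forall>p. p tagged_division_of cbox a b \<and> \<gamma> fine p \<longrightarrow>
        norm ((\<Sum>(x, K)\<in>p. measure lborel K *\<^sub>R (if x \<in> N' then 0 else g x)) - (f b - f a)) < e)"
      by (intro exI[of _ \<gamma>] conjI allI impI gauge, elim conjE) (rule bound)
  qed
  then have "((\<lambda>x. if x \<in> N' then 0 else g x) has_integral (f b - f a)) {a..b}" by simp
  then show ?thesis by (rule has_integral_spike[OF N', rotated]) simp
qed

text \<open>Lebesgue's differentiation theorem on the line. By Henstock's lemma the errors
\<open>h x * (v - u) - (H v - H u)\<close>, \<open>H\<close> being the indefinite integral, are summably small over fine tagged families;
a Vitali covering of the set where such errors exceed \<open>\<epsilon> * (v - u)\<close> consists of such families, so its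
total length is small.\<close>

lemma integral_has_vector_derivative_AE:
  fixes h :: "real \<Rightarrow> complex"
  assumes h: "h integrable_on {a..b}"
  obtains N where "negligible N"
    "\<And>x. x \<in> {a<..<b} - N \<Longrightarrow> ((\<lambda>x. integral {a..x} h) has_vector_derivative h x) (at x)"
proof -
  let ?H = "\<lambda>x. integral {a..x} h"
  have sub: "integral {u..v} h = ?H v - ?H u" if "a \<le> u" "u \<le> v" "v \<le> b" for u v
    using Henstock_Kurzweil_Integration.integral_combine[where a = a and c = u and b = v and f = h] integrable_on_subinterval[OF h, of a v] that by (simp add: algebra_simps)
  define E where "E = (\<lambda>\<epsilon>. {x\<in>{a<..<b}. \<forall>d>0. \<exists>u v. u \<le> x \<and> x \<le> v \<and> u < v \<and> v - u < d \<and>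
     norm ((v - u) *\<^sub>R h x - (?H v - ?H u)) \<ge> \<epsilon> * (v - u)})"
  have negE: "negligible (E \<epsilon>)" if "\<epsilon> > 0" for \<epsilon>
    unfolding negligible_outer_le
  proof (intro allI impI)
    fix e :: real assume "e > 0"
    have e\<epsilon>: "e * \<epsilon> / 2 > 0" using \<open>e > 0\<close> \<open>\<epsilon> > 0\<close> by simp
    have hc: "h integrable_on cbox a b" using h by simp
    obtain \<gamma> where \<gamma>: "gauge \<gamma>" "\<And>p. \<lbrakk>p tagged_partial_division_of cbox a b; \<gamma> fine p\<rbrakk> \<Longrightarrow>
        (\<Sum>(x, K)\<in>p. norm (measure lborel K *\<^sub>R h x - integral K h)) < e * \<epsilon> / 2"
      by (rule Henstock_lemma[OF hc e\<epsilon>]) blast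
    define P where "P = (\<lambda>u v. \<exists>x. u \<le> x \<and> x \<le> v \<and> {u..v} \<subseteq> \<gamma> x \<and> norm ((v - u) *\<^sub>R h x - (?H v - ?H u)) \<ge> \<epsilon> * (v - u))"
    have P: "\<exists>u v. u \<le> x \<and> x \<le> v \<and> u < v \<and> v - u < d \<and> P u v" if x: "x \<in> E \<epsilon>" and "d > 0" for x d
    proof -
      have "open (\<gamma> x)" "x \<in> \<gamma> x" using \<gamma>(1) by (auto simp: gauge_def)
      then obtain r where r: "r > 0" "ball x r \<subseteq> \<gamma> x" by (meson open_contains_ball)
      have "min r d > 0" using r \<open>d > 0\<close> by simp
      then obtain u v where uv: "u \<le> x" "x \<le> v" "u < v" "v - u < min r d" "norm ((v - u) *\<^sub>R h x - (?H v - ?H u)) \<ge> \<epsilon> * (v - u)"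
        using x unfolding E_def by blast
      have "{u..v} \<subseteq> ball x r" using uv by (auto simp: dist_real_def)
      then have "P u v" unfolding P_def using uv r by blast
      then show ?thesis using uv by (intro exI[of _ u] exI[of _ v]) simp
    qed
    have "E \<epsilon> \<subseteq> {a<..<b}" by (auto simp: E_def)
    then obtain F T where F: "finite F" "\<And>u v. (u, v) \<in> F \<Longrightarrow> u < v \<and> {u..v} \<subseteq> {a<..<b} \<and> P u v"
      "nonoverlapping F" "E \<epsilon> - (\<Union>(u, v)\<in>F. {u..v}) \<subseteq> T" "T \<in> lmeasurable" "measure lebesgue T < e / 2"
      using Vitali_intervals[of "{a<..<b}" "E \<epsilon>" "e / 2" P] P \<open>e > 0\<close>
      by (metis half_gt_zero lmeasurable_box open_greaterThanLessThan box_real(1))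
    obtain t where t: "\<And>u v. (u, v) \<in> F \<Longrightarrow> u \<le> t (u, v) \<and> t (u, v) \<le> v \<and> {u..v} \<subseteq> \<gamma> (t (u, v)) \<and>
        norm ((v - u) *\<^sub>R h (t (u, v)) - (?H v - ?H u)) \<ge> \<epsilon> * (v - u)"
    proof -
      have "\<forall>q\<in>F. \<exists>x. fst q \<le> x \<and> x \<le> snd q \<and> {fst q..snd q} \<subseteq> \<gamma> x \<and> norm ((snd q - fst q) *\<^sub>R h x - (?H (snd q) - ?H (fst q))) \<ge> \<epsilon> * (snd q - fst q)"
        using F(2) unfolding P_def by (metis prod.collapse)
      then obtain t where "\<forall>q\<in>F. fst q \<le> t q \<and> t q \<le> snd q \<and> {fst q..snd q} \<subseteq> \<gamma> (t q) \<and> norm ((snd q - fst q) *\<^sub>R h (t q) - (?H (snd q) - ?H (fst q))) \<ge> \<epsilon> * (snd q - fst q)"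
        by metis
      then show thesis by (intro that[of t]) fastforce
    qed
    define p where "p = (\<lambda>q. (t q, {fst q..snd q})) ` F"
    have inj: "inj_on (\<lambda>q. (t q, {fst q..snd q})) F"
    proof (rule inj_onI)
      fix q q' assume "q \<in> F" "q' \<in> F" "(t q, {fst q..snd q}) = (t q', {fst q'..snd q'})"
      then show "q = q'" using F(2)[of "fst q" "snd q"] F(2)[of "fst q'" "snd q'"] by (simp add: prod_eq_iff Icc_eq_Icc)
    qed
    have ptag: "p tagged_partial_division_of cbox a b"
      unfolding tagged_partial_division_of_def
    proof (intro conjI allI impI)
      show "finite p" using F(1) by (simp add: p_def)
      fix x K assume "(x, K) \<in> p"
      then obtain u v where uv: "(u, v) \<in> F" "x = t (u, v)" "K = {u..v}" by (auto simp: p_def)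
      show "x \<in> K" using t[OF uv(1)] uv by simp
      have "{a<..<b} \<subseteq> cbox a b" by auto
      then show "K \<subseteq> cbox a b" using F(2)[OF uv(1)] uv(3) by blast
      show "\<exists>a b. K = cbox a b" using uv by auto
    next
      fix x K x' K' assume x': "(x, K) \<in> p \<and> (x', K') \<in> p \<and> (x, K) \<noteq> (x', K')"
      from x' have "(x, K) \<in> p" ..
      then obtain u v where uv: "(u, v) \<in> F" "x = t (u, v)" "K = {u..v}" by (auto simp: p_def)
      from x' have "(x', K') \<in> p" by blast
      then obtain u' v' where uv': "(u', v') \<in> F" "x' = t (u', v')" "K' = {u'..v'}" by (auto simp: p_def)
      have "(u, v) \<noteq> (u', v')" using uv(2,3) uv'(2,3) x' by blast
      from pairwiseD[OF F(3) uv(1) uv'(1) this] show "interior K \<inter> interior K' = {}"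
        using uv uv' by (simp add: disjnt_def)
    qed
    have "\<gamma> fine p" using t by (fastforce simp: fine_def p_def)
    have "\<epsilon> * (\<Sum>(u, v)\<in>F. v - u) \<le> (\<Sum>q\<in>F. norm (measure lborel {fst q..snd q} *\<^sub>R h (t q) - integral {fst q..snd q} h))"
      unfolding sum_distrib_left
    proof (rule sum_mono)
      fix q assume q: "q \<in> F"
      obtain u v where uv: "q = (u, v)" by (cases q)
      have "(u, v) \<in> F" using q uv by simp
      note Fuv = F(2)[OF this] and tuv = t[OF this]
      have "u \<in> {u..v}" "v \<in> {u..v}" using Fuv by auto
      then have "u \<in> {a<..<b}" "v \<in> {a<..<b}" using Fuv by blast+
      then have "integral {u..v} h = ?H v - ?H u" using sub[of u v] Fuv by auto
      then show "\<epsilon> * (case q of (u, v) \<Rightarrow> v - u) \<le> norm (measure lborel {fst q..snd q} *\<^sub>R h (t q) - integral {fst q..snd q} h)"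
        using tuv Fuv by (simp add: uv)
    qed
    also have "\<dots> = (\<Sum>(x, K)\<in>p. norm (measure lborel K *\<^sub>R h x - integral K h))"
      unfolding p_def by (subst sum.reindex[OF inj]) simp
    also have "\<dots> < e * \<epsilon> / 2" by (rule \<gamma>(2)[OF ptag \<open>\<gamma> fine p\<close>])
    finally have len: "(\<Sum>(u, v)\<in>F. v - u) \<le> e / 2" using \<open>\<epsilon> > 0\<close> by (simp add: field_simps)
    define V where "V = (\<Union>(u, v)\<in>F. {u..v})"
    have Fle: "u \<le> v" if "(u, v) \<in> F" for u v using F(2)[OF that] by simp
    have V: "V \<in> lmeasurable" and VF: "measure lebesgue V \<le> (\<Sum>(u, v)\<in>F. v - u)"
      unfolding V_def by (rule measure_intervals_le, rule F(1), erule Fle)+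
    have "measure lebesgue V \<le> e / 2" using VF len by linarith
    moreover have "measure lebesgue (V \<union> T) \<le> measure lebesgue V + measure lebesgue T"
      using V F(5) by (intro measure_Un_le) auto
    ultimately have "measure lebesgue (V \<union> T) \<le> e" using F(6) by linarith
    moreover have "E \<epsilon> \<subseteq> V \<union> T" using F(4) by (auto simp: V_def)
    ultimately show "\<exists>T. E \<epsilon> \<subseteq> T \<and> T \<in> lmeasurable \<and> measure lebesgue T \<le> e"
      using V F(5) by blast
  qed
  define N where "N = (\<Union>n. E (1 / real (Suc n)))"
  have "negligible N" unfolding N_def by (rule negligible_countable_Union) (use negE in auto)
  moreover have "(?H has_vector_derivative h x) (at x)" if x: "x \<in> {a<..<b} - N" for x
    unfolding has_vector_derivative_def has_derivative_at_alt
  proof (intro conjI allI impI)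
    show "bounded_linear (\<lambda>y. y *\<^sub>R h x)" by (rule bounded_linear_scaleR_left)
    fix e :: real assume "e > 0"
    then obtain n where n: "1 / real (Suc n) < e" using nat_approx_posE by metis
    have "x \<notin> E (1 / real (Suc n))" using x by (auto simp: N_def)
    then have "\<not> (\<forall>d>0. \<exists>u v. u \<le> x \<and> x \<le> v \<and> u < v \<and> v - u < d \<and>
       norm ((v - u) *\<^sub>R h x - (?H v - ?H u)) \<ge> 1 / real (Suc n) * (v - u))"
      using x unfolding E_def by blast
    then obtain d where d: "d > 0" "\<And>u v. u \<le> x \<Longrightarrow> x \<le> v \<Longrightarrow> u < v \<Longrightarrow> v - u < d \<Longrightarrow>
       norm ((v - u) *\<^sub>R h x - (?H v - ?H u)) < 1 / real (Suc n) * (v - u)"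
      unfolding not_le[symmetric] by blast
    have "norm (?H y - ?H x - (y - x) *\<^sub>R h x) \<le> e * norm (y - x)" if "norm (y - x) < d" for y
    proof (cases y x rule: linorder_cases)
      case less
      have "norm (?H y - ?H x - (y - x) *\<^sub>R h x) = norm ((x - y) *\<^sub>R h x - (?H x - ?H y))"
        by (simp add: algebra_simps)
      also have "\<dots> \<le> 1 / real (Suc n) * (x - y)" using d(2)[of y x] less that by (simp add: abs_if)
      also have "\<dots> \<le> e * (x - y)" using n less by (intro mult_right_mono) auto
      finally show ?thesis using less by simp
    next
      case greater
      have "norm (?H y - ?H x - (y - x) *\<^sub>R h x) = norm ((y - x) *\<^sub>R h x - (?H y - ?H x))"
        by (simp add: norm_minus_commute)
      also have "\<dots> \<le> 1 / real (Suc n) * (y - x)" using d(2)[of x y] greater that by (simp add: abs_if)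
      also have "\<dots> \<le> e * (y - x)" using n greater by (intro mult_right_mono) auto
      finally show ?thesis using greater by simp
    qed simp
    then show "\<exists>d>0. \<forall>y. norm (y - x) < d \<longrightarrow> norm (?H y - ?H x - (y - x) *\<^sub>R h x) \<le> e * norm (y - x)"
      using d(1) by blast
  qed
  ultimately show thesis using that by blast
qed

text \<open>Cut the integrand off at height \<open>k\<close>: the part above has a small integral on the whole interval, and the part
below contributes at most \<open>k\<close> times the length.\<close>

lemma abs_cont_on_integral:
  fixes h :: "real \<Rightarrow> complex"
  assumes h: "h absolutely_integrable_on {a..b}"
  shows "abs_cont_on a b (\<lambda>x. integral {a..x} h)"
proof (cases "a \<le> b")
  case False
  have "(\<Sum>(u, v)\<in>I. norm (integral {a..v} h - integral {a..u} h)) = 0"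
    if I: "\<forall>(u, v)\<in>I. a \<le> u \<and> u \<le> v \<and> v \<le> b" for I
  proof (rule sum.neutral, rule ballI)
    fix q assume "q \<in> I"
    with I have "case q of (u, v) \<Rightarrow> a \<le> u \<and> u \<le> v \<and> v \<le> b" by (rule bspec)
    then show "(case q of (u, v) \<Rightarrow> norm (integral {a..v} h - integral {a..u} h)) = 0"
      using False by (cases q) simp
  qed
  then show ?thesis by (intro abs_cont_onI exI[of _ 1]) simp
next
  case True
  let ?g = "\<lambda>x. norm (h x)"
  have g: "?g absolutely_integrable_on {a..b}" using h by (rule absolutely_integrable_norm[unfolded comp_def])
  have gi: "?g integrable_on {a..b}" using g by (rule set_lebesgue_integral_eq_integral(1))
  have hi: "h integrable_on {a..b}" using h by (rule set_lebesgue_integral_eq_integral(1))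
  have mini: "(\<lambda>x. min (?g x) M) integrable_on {a..b}" for M
    using absolutely_integrable_min_1[OF g, of "\<lambda>x. M"] by (simp add: set_lebesgue_integral_eq_integral(1))
  have lim: "(\<lambda>k. integral {a..b} (\<lambda>x. ?g x - min (?g x) (real k))) \<longlonglongrightarrow> integral {a..b} (\<lambda>x. 0)"
  proof (rule dominated_convergence(2)[OF _ gi])
    show "(\<lambda>x. ?g x - min (?g x) (real k)) integrable_on {a..b}" for k
      by (intro integrable_diff gi mini)
    show "norm (?g x - min (?g x) (real k)) \<le> ?g x" for k x by (simp add: min_def)
    fix x
    obtain m where m: "?g x \<le> real m" using real_arch_simple by blast
    have "\<forall>\<^sub>F k in sequentially. ?g x - min (?g x) (real k) = 0"
      using eventually_ge_at_top[of m] by eventually_elim (use m in auto)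
    then show "(\<lambda>k. ?g x - min (?g x) (real k)) \<longlonglongrightarrow> 0" by (rule tendsto_eventually)
  qed
  show ?thesis
  proof (rule abs_cont_onI)
    fix \<epsilon> :: real assume "\<epsilon> > 0"
    have "\<forall>\<^sub>F k in sequentially. integral {a..b} (\<lambda>x. ?g x - min (?g x) (real k)) < \<epsilon> / 2"
      using order_tendstoD(2)[OF lim, of "\<epsilon> / 2"] \<open>\<epsilon> > 0\<close> by simp
    then obtain k where k: "integral {a..b} (\<lambda>x. ?g x - min (?g x) (real k)) < \<epsilon> / 2"
      by (auto simp: eventually_sequentially)
    define r where "r = (\<lambda>x. ?g x - min (?g x) (real k))"
    have ri: "r integrable_on {a..b}" unfolding r_def by (intro integrable_diff gi mini)
    have r0: "r x \<ge> 0" for x by (simp add: r_def)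
    define \<Phi> where "\<Phi> = (\<lambda>x. integral {a..x} r)"
    have \<Phi>: "integral {u..v} r = \<Phi> v - \<Phi> u" if "a \<le> u" "u \<le> v" "v \<le> b" for u v
      using Henstock_Kurzweil_Integration.integral_combine[where a = a and c = u and b = v and f = r] integrable_on_subinterval[OF ri, of a v] that by (simp add: algebra_simps \<Phi>_def)
    have mono: "\<Phi> u \<le> \<Phi> v" if "a \<le> u" "u \<le> v" "v \<le> b" for u v
    proof -
      have "0 \<le> integral {u..v} r"
        by (rule integral_nonneg) (use integrable_on_subinterval[OF ri, of u v] that r0 in auto)
      then show ?thesis using \<Phi>[OF that] by simp
    qed
    define \<delta> where "\<delta> = \<epsilon> / (2 * (real k + 1))"
    have \<delta>: "\<delta> > 0" "real k * \<delta> \<le> \<epsilon> / 2" using \<open>\<epsilon> > 0\<close> by (auto simp: \<delta>_def field_simps)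
    have single: "norm (integral {a..v} h - integral {a..u} h) \<le> (\<Phi> v - \<Phi> u) + real k * (v - u)"
      if uv: "a \<le> u" "u \<le> v" "v \<le> b" for u v
    proof -
      have hi': "h integrable_on {u..v}" and ri': "r integrable_on {u..v}"
        using integrable_on_subinterval[OF hi, of u v] integrable_on_subinterval[OF ri, of u v] uv by auto
      have "integral {a..v} h - integral {a..u} h = integral {u..v} h"
        using Henstock_Kurzweil_Integration.integral_combine[where a = a and c = u and b = v and f = h] integrable_on_subinterval[OF hi, of a v] uv by (simp add: algebra_simps)
      also have "norm \<dots> \<le> integral {u..v} (\<lambda>x. r x + real k)"
        by (rule integral_norm_bound_integral[OF hi']) (use ri' in \<open>auto simp: r_def intro!: integrable_add\<close>)
      also have "\<dots> = integral {u..v} r + real k * (v - u)" using ri' uv by (subst integral_add) auto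
      finally show ?thesis using \<Phi>[OF uv] by simp
    qed
    have "(\<Sum>(u, v)\<in>I. norm (integral {a..v} h - integral {a..u} h)) < \<epsilon>"
      if I: "finite I" "\<forall>(u, v)\<in>I. a \<le> u \<and> u \<le> v \<and> v \<le> b" "nonoverlapping I" "(\<Sum>(u, v)\<in>I. v - u) < \<delta>" for I
    proof -
      define J where "J = {q\<in>I. fst q < snd q}"
      have J: "J \<subseteq> I" "finite J" using I(1) by (auto simp: J_def)
      have nJ: "nonoverlapping J" using I(3) J(1) by (rule pairwise_subset)
      obtain G where G: "finite G" "\<And>u v. (u, v) \<in> G \<Longrightarrow> a \<le> u \<and> u < v \<and> v \<le> b"
        "\<And>\<phi>::real \<Rightarrow> real. (\<Sum>(u, v)\<in>J. \<phi> v - \<phi> u) + (\<Sum>(u, v)\<in>G. \<phi> v - \<phi> u) = \<phi> b - \<phi> a"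
      proof (rule complementary_intervals[OF J(2) _ nJ True])
        show "a \<le> u \<and> u < v \<and> v \<le> b" if "(u, v) \<in> J" for u v using that I(2) by (auto simp: J_def)
      qed blast
      have zero: "fst q = snd q" if "q \<in> I - J" for q using that I(2) by (fastforce simp: J_def)
      have toJ: "(\<Sum>(u, v)\<in>I. \<psi> u v) = (\<Sum>(u, v)\<in>J. \<psi> u v)" if "\<And>u. \<psi> u u = 0" for \<psi> :: "real \<Rightarrow> real \<Rightarrow> real"
        by (rule sum.mono_neutral_right[OF I(1) J(1)]) (use zero that in \<open>force simp: case_prod_unfold\<close>)
      have "(\<Sum>(u, v)\<in>J. norm (integral {a..v} h - integral {a..u} h)) \<le> (\<Sum>(u, v)\<in>J. (\<Phi> v - \<Phi> u) + real k * (v - u))"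
      proof (rule sum_mono, clarify)
        fix u v assume "(u, v) \<in> J"
        then have "a \<le> u \<and> u \<le> v \<and> v \<le> b" using I(2) J(1) by blast
        then show "norm (integral {a..v} h - integral {a..u} h) \<le> (\<Phi> v - \<Phi> u) + real k * (v - u)"
          using single by blast
      qed
      also have "\<dots> = (\<Sum>(u, v)\<in>J. \<Phi> v - \<Phi> u) + real k * (\<Sum>(u, v)\<in>J. v - u)"
        by (simp add: case_prod_unfold sum.distrib sum_distrib_left)
      also have "(\<Sum>(u, v)\<in>J. \<Phi> v - \<Phi> u) \<le> \<Phi> b - \<Phi> a"
      proof -
        have "(\<Sum>(u, v)\<in>G. \<Phi> v - \<Phi> u) \<ge> 0" by (rule sum_nonneg) (use G(2) mono in \<open>auto simp: less_imp_le\<close>)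
        then show ?thesis using G(3)[of \<Phi>] by linarith
      qed
      also have "\<Phi> b - \<Phi> a < \<epsilon> / 2" using k by (simp add: \<Phi>_def r_def)
      also have "real k * (\<Sum>(u, v)\<in>J. v - u) \<le> real k * \<delta>"
        using I(4) toJ[of "\<lambda>u v. v - u"] by (intro mult_left_mono) auto
      finally show ?thesis using \<delta>(2) toJ[of "\<lambda>u v. norm (integral {a..v} h - integral {a..u} h)"] by simp
    qed
    then show "\<exists>\<delta>>0. \<forall>I. interval_family a b I \<longrightarrow> (\<Sum>(u, v)\<in>I. v - u) < \<delta> \<longrightarrow> (\<Sum>(u, v)\<in>I. norm (integral {a..v} h - integral {a..u} h)) < \<epsilon>"
      using \<delta>(1) by blast
  qed
qed

section \<open>Fourier coefficients and absolutely convergent series\<close>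

lemma absolutely_integrable_mult_continuous:
  fixes f g :: "real \<Rightarrow> complex"
  assumes g: "g absolutely_integrable_on {a..b}" and f: "continuous_on {a..b} f"
  shows "(\<lambda>x. g x * f x) absolutely_integrable_on {a..b}"
proof -
  have "(\<lambda>x. f x * g x) absolutely_integrable_on {a..b}"
  proof (rule absolutely_integrable_bounded_measurable_product[where h = "(*)"])
    show "bilinear ((*) :: complex \<Rightarrow> complex \<Rightarrow> complex)" by (rule bilinear_times)
    show "f \<in> borel_measurable (lebesgue_on {a..b})"
      by (rule continuous_imp_measurable_on_sets_lebesgue[OF f]) simp
    show "bounded (f ` {a..b})" by (intro compact_imp_bounded compact_continuous_image f compact_Icc)
  qed (use g in auto)
  then show ?thesis by (simp add: mult.commute)
qed

text \<open>The frequencies \<open>k - N / 2\<close> are those of the functions with \<open>y 1 = (- 1) ^ N * y 0\<close>. Indexing them by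
\<open>k\<close> treats periodic and antiperiodic functions together and puts the two waves of frequency
\<open>\<plusminus> N / 2\<close> at \<open>k = 0\<close> and \<open>k = N\<close>.\<close>

definition freq :: "nat \<Rightarrow> int \<Rightarrow> real"
  where "freq N k = pi * (2 * of_int k - of_nat N)"

definition coef :: "nat \<Rightarrow> (real \<Rightarrow> complex) \<Rightarrow> int \<Rightarrow> complex"
  where "coef N f k = integral {0..1} (\<lambda>x. f x * cis (- freq N k * x))"

definition synth :: "nat \<Rightarrow> (int \<Rightarrow> complex) \<Rightarrow> real \<Rightarrow> complex"
  where "synth N c x = (\<Sum>\<^sub>\<infinity>j. c j * cis (freq N j * x))"

lemma coef_cong:
  assumes "\<And>x. x \<in> {0..1} \<Longrightarrow> f x = g x"
  shows "coef N f k = coef N g k"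
  unfolding coef_def by (rule Henstock_Kurzweil_Integration.integral_cong) (simp add: assms)

lemma cis_freq_diff: "cis (freq N j * x) * cis (- freq N k * x) = cis (- (2 * pi * of_int (k - j)) * x)"
  by (simp add: cis_mult freq_def algebra_simps)

lemma cis_pi_even: "cis (pi * of_nat (2 * n)) = 1"
  using cis_multiple_2pi[of "of_nat n"] by (simp add: mult_ac)

lemma cis_minus_freq_1: "cis (- freq N k) * cis (pi * of_nat N) = 1"
proof -
  have "cis (- freq N k) * cis (pi * of_nat N) = cis (2 * pi * of_int (int N - k))"
    by (simp add: cis_mult freq_def algebra_simps)
  also have "\<dots> = 1" by (rule cis_multiple_2pi) simp
  finally show ?thesis .
qed

lemma fourier_coeff_eq_integral:
  assumes q: "q absolutely_integrable_on {0..1}"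
  shows "fourier_coeff q n = integral {0..1} (\<lambda>x. q x * cis (- (2 * pi * of_int n) * x))"
proof -
  have "(\<lambda>x. q x * cis (- (2 * pi * of_int n) * x)) absolutely_integrable_on {0..1}"
    by (intro absolutely_integrable_mult_continuous q continuous_intros)
  then have "integral {0..1} (\<lambda>x. q x * cis (- (2 * pi * of_int n) * x)) = (LINT x:{0..1}|lebesgue. q x * cis (- (2 * pi * of_int n) * x))"
    by (simp only: set_lebesgue_integral_eq_integral(2))
  moreover have "cis (- (2 * pi * of_int n) * x) = exp (- (\<i> * of_real (2 * pi * of_int n * x)))" for x
    by (simp add: cis_conv_exp)
  ultimately show ?thesis by (simp only: fourier_coeff_def)
qed

lemma fourier_coeff_bound:
  assumes q: "q absolutely_integrable_on {0..1}"
  shows "norm (fourier_coeff q n) \<le> integral {0..1} (\<lambda>x. norm (q x))"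
  unfolding fourier_coeff_eq_integral[OF q]
proof (rule Henstock_Kurzweil_Integration.integral_norm_bound_integral)
  show "(\<lambda>x. q x * cis (- (2 * pi * of_int n) * x)) integrable_on {0..1}"
    by (intro set_lebesgue_integral_eq_integral(1) absolutely_integrable_mult_continuous q continuous_intros)
  show "(\<lambda>x. norm (q x)) integrable_on {0..1}" using q unfolding absolutely_integrable_on_def by blast
qed (simp add: norm_mult)

lemma synth_uniform_limit:
  assumes "(\<lambda>j. norm (c j)) summable_on UNIV"
  shows "uniform_limit S (\<lambda>F x. \<Sum>j\<in>F. c j * cis (freq N j * x)) (synth N c) (finite_subsets_at_top UNIV)"
proof -
  have "uniform_limit S (\<lambda>F x. \<Sum>j\<in>F. c j * cis (freq N j * x)) (\<lambda>x. \<Sum>\<^sub>\<infinity>j. c j * cis (freq N j * x)) (finite_subsets_at_top UNIV)"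
    by (rule Weierstrass_m_test_general[OF _ assms]) (simp add: norm_mult)
  then show ?thesis by (simp add: synth_def[abs_def])
qed

lemma continuous_on_synth:
  assumes "(\<lambda>j. norm (c j)) summable_on UNIV"
  shows "continuous_on S (synth N c)"
proof (rule uniform_limit_theorem[OF _ synth_uniform_limit[OF assms]])
  show "\<forall>\<^sub>F F in finite_subsets_at_top UNIV. continuous_on S (\<lambda>x. \<Sum>j\<in>F. c j * cis (freq N j * x))"
    by (intro always_eventually allI continuous_intros)
qed simp

lemma synth_quasi_periodic: "synth N c 1 = cis (pi * of_nat N) * synth N c 0"
proof -
  have eq: "cis (freq N j) = cis (pi * of_nat N)" for j
  proof -
    have "cis (freq N j) * (cis (- freq N j) * cis (pi * of_nat N)) = cis (pi * of_nat N)"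
      by (simp add: cis_mult)
    then show ?thesis by (simp only: cis_minus_freq_1 mult_1_right)
  qed
  show ?thesis by (simp add: synth_def eq infsum_cmult_left' mult.commute)
qed

text \<open>The partial sums converge uniformly, so an integrable factor does no harm to termwise integration.\<close>

lemma integral_mult_synth:
  assumes c: "(\<lambda>j. norm (c j)) summable_on UNIV" and g: "g absolutely_integrable_on {0..1}"
  shows "((\<lambda>j. c j * integral {0..1} (\<lambda>x. g x * cis (freq N j * x))) has_sum integral {0..1} (\<lambda>x. g x * synth N c x)) UNIV"
  unfolding has_sum_def
proof (rule tendstoI)
  fix e :: real assume "e > 0"
  define M where "M = integral {0..1} (\<lambda>x. norm (g x))"
  have gi: "(\<lambda>x. norm (g x)) integrable_on {0..1}" using g unfolding absolutely_integrable_on_def by blast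
  have "M \<ge> 0" unfolding M_def by (rule Henstock_Kurzweil_Integration.integral_nonneg[OF gi]) simp
  have "e / (M + 1) > 0" using \<open>e > 0\<close> \<open>M \<ge> 0\<close> by simp
  with synth_uniform_limit[OF c, where S = "{0..1}" and N = N]
  have "\<forall>\<^sub>F F in finite_subsets_at_top UNIV. \<forall>x\<in>{0..1}. dist (\<Sum>j\<in>F. c j * cis (freq N j * x)) (synth N c x) < e / (M + 1)"
    by (rule uniform_limitD)
  then show "\<forall>\<^sub>F F in finite_subsets_at_top UNIV.
      dist (\<Sum>j\<in>F. c j * integral {0..1} (\<lambda>x. g x * cis (freq N j * x))) (integral {0..1} (\<lambda>x. g x * synth N c x)) < e"
  proof (eventually_elim)
    case (elim F)
    let ?S = "\<lambda>x. \<Sum>j\<in>F. c j * cis (freq N j * x)"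
    have int: "(\<lambda>x. g x * cis (freq N j * x)) integrable_on {0..1}" for j
      by (intro set_lebesgue_integral_eq_integral(1) absolutely_integrable_mult_continuous g continuous_intros)
    have intS: "(\<lambda>x. g x * ?S x) integrable_on {0..1}"
      by (intro set_lebesgue_integral_eq_integral(1) absolutely_integrable_mult_continuous g continuous_intros)
    have inty: "(\<lambda>x. g x * synth N c x) integrable_on {0..1}"
      by (intro set_lebesgue_integral_eq_integral(1) absolutely_integrable_mult_continuous g continuous_on_synth c)
    have "(\<Sum>j\<in>F. c j * integral {0..1} (\<lambda>x. g x * cis (freq N j * x))) = integral {0..1} (\<lambda>x. g x * ?S x)"
    proof (cases "finite F")
      case True
      have "integral {0..1} (\<lambda>x. g x * ?S x) = integral {0..1} (\<lambda>x. \<Sum>j\<in>F. c j * (g x * cis (freq N j * x)))"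
        by (simp add: sum_distrib_left mult_ac)
      also have "\<dots> = (\<Sum>j\<in>F. integral {0..1} (\<lambda>x. c j * (g x * cis (freq N j * x))))"
        using True int by (intro Henstock_Kurzweil_Integration.integral_sum) (auto intro: integrable_on_mult_right)
      finally show ?thesis by simp
    qed simp
    then have "dist (\<Sum>j\<in>F. c j * integral {0..1} (\<lambda>x. g x * cis (freq N j * x))) (integral {0..1} (\<lambda>x. g x * synth N c x))
      = norm (integral {0..1} (\<lambda>x. g x * ?S x - g x * synth N c x))"
      using intS inty by (simp add: dist_norm Henstock_Kurzweil_Integration.integral_diff)
    also have "\<dots> \<le> integral {0..1} (\<lambda>x. (e / (M + 1)) * norm (g x))"
    proof (rule Henstock_Kurzweil_Integration.integral_norm_bound_integral)
      show "(\<lambda>x. g x * ?S x - g x * synth N c x) integrable_on {0..1}" by (rule integrable_diff[OF intS inty])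
      show "(\<lambda>x. (e / (M + 1)) * norm (g x)) integrable_on {0..1}" using gi by (rule integrable_on_mult_right)
      fix x :: real assume "x \<in> {0..1}"
      then have "norm (?S x - synth N c x) \<le> e / (M + 1)" using elim by (auto simp: dist_norm intro: less_imp_le)
      then have "norm (g x) * norm (?S x - synth N c x) \<le> norm (g x) * (e / (M + 1))" by (intro mult_left_mono) auto
      then show "norm (g x * ?S x - g x * synth N c x) \<le> (e / (M + 1)) * norm (g x)"
        by (simp only: right_diff_distrib[symmetric] norm_mult mult.commute)
    qed
    also have "\<dots> = (e / (M + 1)) * M" by (simp add: M_def)
    also have "\<dots> < e" using \<open>e > 0\<close> \<open>M \<ge> 0\<close> by (simp add: field_simps)
    finally show ?case .
  qed
qed

lemma has_vector_derivative_cis_mult: "((\<lambda>x. cis (\<omega> * x)) has_vector_derivative \<i> * of_real \<omega> * cis (\<omega> * x)) (at x within S)"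
proof -
  have "((\<lambda>z. exp (\<i> * of_real \<omega> * z)) has_field_derivative \<i> * of_real \<omega> * exp (\<i> * of_real \<omega> * of_real x)) (at (of_real x))"
    by (rule derivative_eq_intros refl | simp)+
  from has_vector_derivative_real_field[OF this]
  have "((\<lambda>x. exp (\<i> * of_real \<omega> * of_real x)) has_vector_derivative \<i> * of_real \<omega> * exp (\<i> * of_real \<omega> * of_real x)) (at x within S)"
    by simp
  then show ?thesis by (simp add: cis_conv_exp mult.assoc)
qed

lemma integral_cis_period:
  "integral {0..1} (\<lambda>x. cis (- (2 * pi * of_int m) * x)) = (if m = 0 then 1 else 0)"
proof (cases "m = 0")
  case False
  define \<alpha> where "\<alpha> = - (2 * pi * of_int m)"
  have "\<alpha> \<noteq> 0" using False by (simp add: \<alpha>_def)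
  have "((\<lambda>x. cis (\<alpha> * x) / (\<i> * of_real \<alpha>)) has_vector_derivative cis (\<alpha> * x)) (at x within {0..1})" for x
    using bounded_linear.has_vector_derivative[OF bounded_linear_divide[of "\<i> * of_real \<alpha>"]
        has_vector_derivative_cis_mult[of \<alpha> x "{0..1}"]] \<open>\<alpha> \<noteq> 0\<close> by simp
  then have "((\<lambda>x. cis (\<alpha> * x)) has_integral (cis (\<alpha> * 1) / (\<i> * of_real \<alpha>) - cis (\<alpha> * 0) / (\<i> * of_real \<alpha>))) {0..1}"
    by (intro fundamental_theorem_of_calculus) auto
  moreover have "cis (\<alpha> * 1) = 1"
    using cis_multiple_2pi[of "of_int (- m)"] by (simp add: \<alpha>_def)
  ultimately show ?thesis using False by (simp add: \<alpha>_def integral_unique)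
qed simp

lemma coef_synth:
  assumes c: "(\<lambda>j. norm (c j)) summable_on UNIV"
  shows "coef N (synth N c) k = c k"
proof -
  have cisint: "(\<lambda>x. cis (- freq N k * x)) absolutely_integrable_on {0..1}"
    by (intro absolutely_integrable_continuous_real continuous_intros)
  have "integral {0..1} (\<lambda>x. cis (- freq N k * x) * cis (freq N j * x)) = (if j = k then 1 else 0)" for j
    using integral_cis_period[of "k - j"] cis_freq_diff[of N j _ k] by (simp add: mult.commute)
  then have "((\<lambda>j. c j * (if j = k then 1 else 0)) has_sum integral {0..1} (\<lambda>x. cis (- freq N k * x) * synth N c x)) UNIV"
    using integral_mult_synth[OF c cisint, of N] by simp
  moreover have "((\<lambda>j. c j * (if j = k then 1 else 0)) has_sum c k) UNIV"
    by (rule has_sum_finite_neutralI[of "{k}"]) auto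
  ultimately have "integral {0..1} (\<lambda>x. cis (- freq N k * x) * synth N c x) = c k" by (rule has_sum_unique)
  then show ?thesis by (simp add: coef_def mult.commute)
qed

lemma coef_mult_synth:
  assumes c: "(\<lambda>j. norm (c j)) summable_on UNIV" and q: "q absolutely_integrable_on {0..1}"
  shows "((\<lambda>j. c j * fourier_coeff q (k - j)) has_sum coef N (\<lambda>x. q x * synth N c x) k) UNIV"
proof -
  have qc: "(\<lambda>x. q x * cis (- freq N k * x)) absolutely_integrable_on {0..1}"
    by (intro absolutely_integrable_mult_continuous q continuous_intros)
  have "integral {0..1} (\<lambda>x. q x * cis (- freq N k * x) * cis (freq N j * x)) = fourier_coeff q (k - j)" for j
    unfolding fourier_coeff_eq_integral[OF q] cis_freq_diff[of N j _ k, symmetric] by (simp add: mult_ac)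
  then show ?thesis using integral_mult_synth[OF c qc, of N] by (simp add: coef_def mult_ac)
qed

section \<open>Uniqueness of Fourier coefficients\<close>

text \<open>Trigonometric polynomials of period 1; as a closure under sums, they are easily seen to be closed under products.\<close>

inductive trig_sum :: "(real \<Rightarrow> complex) \<Rightarrow> bool" where
  wave: "trig_sum (\<lambda>x. a * cis (2 * pi * of_int k * x))"
| add: "trig_sum s \<Longrightarrow> trig_sum t \<Longrightarrow> trig_sum (\<lambda>x. s x + t x)"

lemma trig_sum_mult_wave:
  assumes "trig_sum t" shows "trig_sum (\<lambda>x. a * cis (2 * pi * of_int k * x) * t x)"
  using assms
proof induction
  case (wave b m)
  have "(\<lambda>x. a * cis (2 * pi * of_int k * x) * (b * cis (2 * pi * of_int m * x))) = (\<lambda>x. (a * b) * cis (2 * pi * of_int (k + m) * x))"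
  proof
    fix x
    have "cis (2 * pi * of_int k * x) * cis (2 * pi * of_int m * x) = cis (2 * pi * of_int (k + m) * x)"
      by (simp add: cis_mult algebra_simps)
    then show "a * cis (2 * pi * of_int k * x) * (b * cis (2 * pi * of_int m * x)) = (a * b) * cis (2 * pi * of_int (k + m) * x)"
      by (metis mult.assoc mult.left_commute)
  qed
  then show ?case using trig_sum.wave[of "a * b" "k + m"] by (simp only:)
next
  case (add s t)
  then show ?case using trig_sum.add[OF add.IH] by (simp add: distrib_left)
qed

lemma trig_sum_mult:
  assumes "trig_sum s" "trig_sum t" shows "trig_sum (\<lambda>x. s x * t x)"
  using assms(1)
proof induction
  case (wave a k)
  show ?case by (rule trig_sum_mult_wave[OF assms(2)])
next
  case (add s s')
  then show ?case using trig_sum.add[OF add.IH] by (simp add: distrib_right)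
qed

lemma trig_sum_real_polynomial:
  assumes "real_polynomial_function p"
  shows "trig_sum (\<lambda>x. of_real (p (cis (2 * pi * x))))"
  using assms
proof induction
  case (linear f)
  interpret bounded_linear f by fact
  have "trig_sum (\<lambda>x. (of_real (f 1) / 2 + of_real (f \<i>) / (2 * \<i>)) * cis (2 * pi * of_int 1 * x) +
      (of_real (f 1) / 2 - of_real (f \<i>) / (2 * \<i>)) * cis (2 * pi * of_int (- 1) * x))"
    by (intro trig_sum.intros)
  moreover have "of_real (f (cis (2 * pi * x))) = (of_real (f 1) / 2 + of_real (f \<i>) / (2 * \<i>)) * cis (2 * pi * of_int 1 * x) +
      (of_real (f 1) / 2 - of_real (f \<i>) / (2 * \<i>)) * cis (2 * pi * of_int (- 1) * x)" for x
  proof -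
    let ?t = "2 * pi * x"
    have "cis ?t = cos ?t *\<^sub>R 1 + sin ?t *\<^sub>R \<i>" by (simp add: complex_eq_iff)
    then have "f (cis ?t) = cos ?t * f 1 + sin ?t * f \<i>" by (simp only: add scaleR real_scaleR_def)
    then show ?thesis by (simp add: complex_eq_iff Re_divide Im_divide field_simps power2_eq_square)
  qed
  ultimately show ?case by (simp only:)
next
  case (const c)
  then show ?case using trig_sum.wave[of "of_real c" 0] by simp
next
  case (add f g)
  then show ?case using trig_sum.add[OF add.IH] by simp
next
  case (mult f g)
  then show ?case using trig_sum_mult[OF mult.IH] by simp
qed

lemma trig_sum_continuous: "trig_sum t \<Longrightarrow> continuous_on S t"
  by (induction rule: trig_sum.induct) (auto intro!: continuous_intros)

lemma trig_sum_orthogonal: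
  assumes \<phi>: "continuous_on {0..1} \<phi>" and zero: "\<And>k::int. integral {0..1} (\<lambda>x. \<phi> x * cis (2 * pi * of_int k * x)) = 0"
    and "trig_sum t"
  shows "integral {0..1} (\<lambda>x. \<phi> x * t x) = 0"
  using assms(3)
proof induction
  case (wave a k)
  have "integral {0..1} (\<lambda>x. \<phi> x * (a * cis (2 * pi * of_int k * x))) = a * integral {0..1} (\<lambda>x. \<phi> x * cis (2 * pi * of_int k * x))"
    by (simp only: Henstock_Kurzweil_Integration.integral_mult_right[symmetric] mult.left_commute)
  then show ?case by (simp add: zero)
next
  case (add s t)
  have "(\<lambda>x. \<phi> x * s x) integrable_on {0..1}" "(\<lambda>x. \<phi> x * t x) integrable_on {0..1}"
    by (intro integrable_continuous_interval continuous_intros \<phi> trig_sum_continuous add.hyps)+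
  then show ?case using add.IH by (simp add: distrib_left Henstock_Kurzweil_Integration.integral_add)
qed

text \<open>The map from \<open>{0..1}\<close> onto the circle sends compact sets to compact sets, so preimages of closed sets under \<open>h\<close>
are closed.\<close>

lemma continuous_on_circle_lift:
  fixes \<phi> :: "real \<Rightarrow> complex"
  assumes \<phi>: "continuous_on {0..1} \<phi>" "\<phi> 0 = \<phi> 1"
  obtains h where "continuous_on (sphere 0 1) h" "\<And>x. x \<in> {0..1} \<Longrightarrow> h (cis (2 * pi * x)) = \<phi> x"
proof -
  let ?e = "\<lambda>x. cis (2 * pi * x)"
  define h where "h = (\<lambda>z. \<phi> (Arg2pi z / (2 * pi)))"
  have he: "h (?e x) = \<phi> x" if "x \<in> {0..1}" for x
  proof (cases "x = 1")
    case True
    have "Arg2pi 1 = 0" by (rule Arg2pi_unique[of 1]) auto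
    then show ?thesis using True \<phi>(2) by (simp add: h_def)
  next
    case False
    have "Arg2pi (?e x) = 2 * pi * x"
      by (rule Arg2pi_unique[of 1]) (use that False in \<open>auto simp: cis_conv_exp\<close>)
    then show ?thesis by (simp add: h_def)
  qed
  have img: "?e ` {0..1} = sphere 0 1"
  proof (intro equalityI subsetI)
    fix z :: complex assume "z \<in> sphere 0 1"
    then have "norm z = 1" by simp
    then have "z = exp (\<i> * of_real (Arg2pi z))" using Arg2pi_eq[of z] by (metis mult_1 of_real_1)
    moreover have "?e (Arg2pi z / (2 * pi)) = exp (\<i> * of_real (Arg2pi z))" by (simp add: cis_conv_exp)
    ultimately have "z = ?e (Arg2pi z / (2 * pi))" by (simp only:)
    moreover have "Arg2pi z / (2 * pi) \<in> {0..1}" using Arg2pi[of z] by (simp add: less_imp_le)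
    ultimately show "z \<in> ?e ` {0..1}" by blast
  qed auto
  have "continuous_on (sphere 0 1) h"
    unfolding continuous_on_closed_vimage[OF closed_sphere]
  proof (intro allI impI)
    fix B :: "complex set" assume "closed B"
    have "h -` B \<inter> sphere 0 1 = ?e ` (\<phi> -` B \<inter> {0..1})" unfolding img[symmetric] using he by auto
    moreover have "compact (\<phi> -` B \<inter> {0..1})"
    proof -
      have "closed (\<phi> -` B \<inter> {0..1})" using \<phi>(1) \<open>closed B\<close> continuous_on_closed_vimage[of "{0..1}" \<phi>] by auto
      moreover have "bounded (\<phi> -` B \<inter> {0..1})" by (rule bounded_subset[of "{0..1}"]) auto
      ultimately show ?thesis by (simp add: compact_eq_bounded_closed)
    qed
    ultimately show "closed (h -` B \<inter> sphere 0 1)"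
      by (auto intro!: compact_imp_closed compact_continuous_image continuous_intros)
  qed
  then show thesis using he that by blast
qed

text \<open>By the Stone--Weierstrass theorem on the circle, the conjugate of \<open>\<phi>\<close> is a uniform limit of trigonometric
polynomials. As \<open>\<phi>\<close> is orthogonal to these, the integral of \<open>\<phi> * cnj \<phi>\<close> vanishes.\<close>

lemma periodic_zero_coeffs_imp_zero:
  fixes \<phi> :: "real \<Rightarrow> complex"
  assumes \<phi>: "continuous_on {0..1} \<phi>" "\<phi> 0 = \<phi> 1"
    and zero: "\<And>k::int. integral {0..1} (\<lambda>x. \<phi> x * cis (2 * pi * of_int k * x)) = 0"
    and "x \<in> {0..1}"
  shows "\<phi> x = 0"
proof -
  let ?e = "\<lambda>x. cis (2 * pi * x)"
  obtain h where h: "continuous_on (sphere 0 1) h" "\<And>x. x \<in> {0..1} \<Longrightarrow> h (?e x) = \<phi> x"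
    by (rule continuous_on_circle_lift[OF \<phi>]) blast
  define M where "M = integral {0..1} (\<lambda>x. norm (\<phi> x))"
  have normi: "(\<lambda>x. norm (\<phi> x)) integrable_on {0..1}"
    by (intro integrable_continuous_interval continuous_intros \<phi>)
  have "M \<ge> 0" unfolding M_def by (rule Henstock_Kurzweil_Integration.integral_nonneg[OF normi]) simp
  have small: "norm (integral {0..1} (\<lambda>x. \<phi> x * cnj (\<phi> x))) \<le> e * M" if "e > 0" for e
  proof -
    have cnjh: "continuous_on (sphere 0 1) (\<lambda>z. cnj (h z))" by (intro continuous_intros h)
    obtain p where p: "polynomial_function p" "\<And>z. z \<in> sphere 0 1 \<Longrightarrow> norm (cnj (h z) - p z) < e"
      using Stone_Weierstrass_polynomial_function[OF compact_sphere cnjh \<open>e > 0\<close>] by blast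
    have "real_polynomial_function (Re \<circ> p)" "real_polynomial_function (Im \<circ> p)"
      using p(1) bounded_linear_Re bounded_linear_Im by (auto simp: polynomial_function_def)
    then have "trig_sum (\<lambda>x. of_real (Re (p (?e x))))" "trig_sum (\<lambda>x. of_real (Im (p (?e x))))"
      using trig_sum_real_polynomial by (fastforce simp: o_def)+
    moreover from this(2) have "trig_sum (\<lambda>x. \<i> * cis (2 * pi * of_int 0 * x) * of_real (Im (p (?e x))))"
      by (rule trig_sum_mult_wave)
    ultimately have "trig_sum (\<lambda>x. of_real (Re (p (?e x))) + \<i> * cis (2 * pi * of_int 0 * x) * of_real (Im (p (?e x))))"
      by (rule_tac trig_sum.add)
    moreover have "(\<lambda>x. of_real (Re (p (?e x))) + \<i> * cis (2 * pi * of_int 0 * x) * of_real (Im (p (?e x)))) = (\<lambda>x. p (?e x))"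
      by (simp add: complex_eq_iff fun_eq_iff)
    ultimately have tp: "trig_sum (\<lambda>x. p (?e x))" by simp
    have int: "(\<lambda>x. \<phi> x * cnj (\<phi> x)) integrable_on {0..1}" "(\<lambda>x. \<phi> x * p (?e x)) integrable_on {0..1}"
      by (intro integrable_continuous_interval continuous_intros \<phi> trig_sum_continuous tp)+
    have "integral {0..1} (\<lambda>x. \<phi> x * cnj (\<phi> x)) = integral {0..1} (\<lambda>x. \<phi> x * cnj (\<phi> x) - \<phi> x * p (?e x))"
      using int trig_sum_orthogonal[OF \<phi>(1) zero tp] by (simp add: Henstock_Kurzweil_Integration.integral_diff)
    also have "norm \<dots> \<le> integral {0..1} (\<lambda>x. e * norm (\<phi> x))"
    proof (rule Henstock_Kurzweil_Integration.integral_norm_bound_integral)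
      show "(\<lambda>x. \<phi> x * cnj (\<phi> x) - \<phi> x * p (?e x)) integrable_on {0..1}" by (rule integrable_diff[OF int])
      show "(\<lambda>x. e * norm (\<phi> x)) integrable_on {0..1}" using normi by (rule integrable_on_mult_right)
      fix x :: real assume x: "x \<in> {0..1}"
      have "norm (cnj (h (?e x)) - p (?e x)) < e" by (rule p(2)) simp
      then have "norm (cnj (\<phi> x) - p (?e x)) \<le> e" using h(2)[OF x] by simp
      then have "norm (\<phi> x) * norm (cnj (\<phi> x) - p (?e x)) \<le> norm (\<phi> x) * e" by (intro mult_left_mono) auto
      then show "norm (\<phi> x * cnj (\<phi> x) - \<phi> x * p (?e x)) \<le> e * norm (\<phi> x)"
        by (simp only: right_diff_distrib[symmetric] norm_mult mult.commute)
    qed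
    also have "\<dots> = e * M" by (simp add: M_def)
    finally show ?thesis .
  qed
  have "norm (integral {0..1} (\<lambda>x. \<phi> x * cnj (\<phi> x))) \<le> 0"
  proof (rule field_le_epsilon)
    fix e :: real assume "e > 0"
    have "norm (integral {0..1} (\<lambda>x. \<phi> x * cnj (\<phi> x))) \<le> (e / (M + 1)) * M"
      by (rule small) (use \<open>e > 0\<close> \<open>M \<ge> 0\<close> in simp)
    also have "\<dots> \<le> e" using \<open>e > 0\<close> \<open>M \<ge> 0\<close> by (simp add: field_simps)
    finally show "norm (integral {0..1} (\<lambda>x. \<phi> x * cnj (\<phi> x))) \<le> 0 + e" by simp
  qed
  then have z: "integral {0..1} (\<lambda>x. \<phi> x * cnj (\<phi> x)) = 0" by simp
  have eq: "(\<lambda>x. \<phi> x * cnj (\<phi> x)) = (\<lambda>x. of_real ((norm (\<phi> x))\<^sup>2))"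
    by (rule ext) (simp only: complex_norm_square)
  have contsq: "continuous_on {0..1} (\<lambda>x. (norm (\<phi> x))\<^sup>2)" by (intro continuous_intros \<phi>)
  have "((\<lambda>x. (norm (\<phi> x))\<^sup>2) has_integral integral {0..1} (\<lambda>x. (norm (\<phi> x))\<^sup>2)) {0..1}"
    by (intro integrable_integral integrable_continuous_interval contsq)
  then have "((\<lambda>x. complex_of_real ((norm (\<phi> x))\<^sup>2)) has_integral of_real (integral {0..1} (\<lambda>x. (norm (\<phi> x))\<^sup>2))) {0..1}"
    by (rule has_integral_of_real)
  then have "complex_of_real (integral {0..1} (\<lambda>x. (norm (\<phi> x))\<^sup>2)) = 0"
    using z unfolding eq by (simp add: integral_unique)
  then have "integral {0..1} (\<lambda>x. (norm (\<phi> x))\<^sup>2) = 0" by simp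
  then have "\<forall>x\<in>{0..1}. (norm (\<phi> x))\<^sup>2 = 0"
    using integral_eq_0_iff[OF contsq] by simp
  then show ?thesis using \<open>x \<in> {0..1}\<close> by simp
qed

lemma coef_zero_imp_zero:
  assumes f: "continuous_on {0..1} f" "f 1 = cis (pi * of_nat N) * f 0" and zero: "\<And>k. coef N f k = 0" and x: "x \<in> {0..1}"
  shows "f x = 0"
proof -
  let ?\<phi> = "\<lambda>x. f x * cis (pi * of_nat N * x)"
  have "?\<phi> x = 0"
  proof (rule periodic_zero_coeffs_imp_zero[OF _ _ _ x])
    show "continuous_on {0..1} ?\<phi>" by (intro continuous_intros f)
    have "cis (pi * of_nat N) * cis (pi * of_nat N) = cis (2 * pi * of_int (int N))" by (simp add: cis_mult algebra_simps)
    also have "\<dots> = 1" by (rule cis_multiple_2pi) simp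
    finally show "?\<phi> 0 = ?\<phi> 1" using f(2) by (simp add: mult_ac)
    fix k
    have "(\<lambda>x. ?\<phi> x * cis (2 * pi * of_int k * x)) = (\<lambda>x. f x * cis (- freq N (- k) * x))"
    proof
      fix x
      have "cis (pi * of_nat N * x) * cis (2 * pi * of_int k * x) = cis (- freq N (- k) * x)"
        by (simp add: cis_mult freq_def algebra_simps)
      then show "?\<phi> x * cis (2 * pi * of_int k * x) = f x * cis (- freq N (- k) * x)" by (simp only: mult.assoc)
    qed
    then show "integral {0..1} (\<lambda>x. ?\<phi> x * cis (2 * pi * of_int k * x)) = 0"
      using zero[of "- k"] by (simp only: coef_def)
  qed
  then show ?thesis by simp
qed

lemma coef_diff:
  assumes "continuous_on {0..1} f" "continuous_on {0..1} g"
  shows "coef N (\<lambda>x. f x - g x) k = coef N f k - coef N g k"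
proof -
  have "(\<lambda>x. f x * cis (- freq N k * x)) integrable_on {0..1}" "(\<lambda>x. g x * cis (- freq N k * x)) integrable_on {0..1}"
    by (intro integrable_continuous_interval continuous_intros assms)+
  then show ?thesis by (simp add: coef_def left_diff_distrib Henstock_Kurzweil_Integration.integral_diff)
qed

lemma coef_eq_imp_eq:
  assumes f: "continuous_on {0..1} f" "f 1 = cis (pi * of_nat N) * f 0"
    and g: "continuous_on {0..1} g" "g 1 = cis (pi * of_nat N) * g 0"
    and eq: "\<And>k. coef N f k = coef N g k" and x: "x \<in> {0..1}"
  shows "f x = g x"
proof -
  have "f x - g x = 0"
    by (rule coef_zero_imp_zero[where f = "\<lambda>x. f x - g x" and N = N, OF _ _ _ x])
      (use f g eq in \<open>auto intro!: continuous_intros simp: coef_diff algebra_simps\<close>)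
  then show ?thesis by simp
qed

section \<open>Fourier coefficients of derivatives and primitives\<close>

lemma abs_cont_on_C1:
  fixes f :: "real \<Rightarrow> complex"
  assumes d: "\<And>x. x \<in> {a..b} \<Longrightarrow> (f has_vector_derivative f' x) (at x within {a..b})" and f': "continuous_on {a..b} f'"
  shows "abs_cont_on a b f"
proof -
  have "bounded (f' ` {a..b})" by (intro compact_imp_bounded compact_continuous_image f' compact_Icc)
  then obtain B where B: "B > 0" "\<And>x. x \<in> {a..b} \<Longrightarrow> norm (f' x) \<le> B" unfolding bounded_pos by blast
  show ?thesis
  proof (rule Lipschitz_imp_abs_cont_on[of B])
    fix u v assume uv: "a \<le> u" "u \<le> v" "v \<le> b"
    have "norm (f v - f u) \<le> B * norm (v - u)"
    proof (rule differentiable_bound[of "{a..b}" f "\<lambda>x h. h *\<^sub>R f' x"])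
      fix x assume x: "x \<in> {a..b}"
      show "(f has_derivative (\<lambda>h. h *\<^sub>R f' x)) (at x within {a..b})" using d[OF x] by (simp add: has_vector_derivative_def)
      have "onorm (\<lambda>h::real. h *\<^sub>R f' x) \<le> B"
      proof (rule onorm_bound)
        fix h :: real
        show "norm (h *\<^sub>R f' x) \<le> B * norm h"
          using mult_left_mono[OF B(2)[OF x], of "\<bar>h\<bar>"] by (simp add: mult.commute)
      qed (use B(1) in simp)
      then show "onorm (\<lambda>h. h *\<^sub>R f' x) \<le> B" .
    qed (use uv in auto)
    then show "norm (f v - f u) \<le> B * (v - u)" using uv by simp
  qed (use B in simp)
qed

lemma abs_cont_on_cis_mult: "abs_cont_on a b (\<lambda>x. cis (\<omega> * x))"
  by (rule abs_cont_on_C1[OF has_vector_derivative_cis_mult]) (intro continuous_intros)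

text \<open>Integration by parts, as the fundamental theorem for the product of \<open>u\<close> with a wave. The boundary term
vanishes because \<open>u\<close> and the wave are quasi-periodic with the same factor.\<close>

lemma coef_derivative:
  assumes u: "abs_cont_on 0 1 u" and qp: "u 1 = cis (pi * of_nat N) * u 0"
    and g: "g absolutely_integrable_on {0..1}" and Z: "negligible Z"
    and deriv: "\<And>x. x \<in> {0<..<1} - Z \<Longrightarrow> (u has_vector_derivative g x) (at x)"
  shows "coef N g k = \<i> * of_real (freq N k) * coef N u k"
proof -
  let ?\<omega> = "- freq N k"
  let ?e = "\<lambda>x. cis (?\<omega> * x)"
  have "((\<lambda>x. u x * (\<i> * of_real ?\<omega> * ?e x) + g x * ?e x) has_integral (u 1 * ?e 1 - u 0 * ?e 0)) {0..1}"
  proof (rule abs_cont_fundamental_theorem[OF abs_cont_on_mult[OF u abs_cont_on_cis_mult] _ Z])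
    fix x assume "x \<in> {0<..<1} - Z"
    from has_vector_derivative_mult[OF deriv[OF this] has_vector_derivative_cis_mult]
    show "((\<lambda>x. u x * ?e x) has_vector_derivative u x * (\<i> * of_real ?\<omega> * ?e x) + g x * ?e x) (at x)" .
  qed simp
  moreover have "u 1 * ?e 1 - u 0 * ?e 0 = 0"
    using cis_minus_freq_1[of N k] qp by (simp add: mult_ac)
  ultimately have "integral {0..1} (\<lambda>x. u x * (\<i> * of_real ?\<omega> * ?e x) + g x * ?e x) = 0"
    by (simp only: integral_unique)
  moreover have "integral {0..1} (\<lambda>x. u x * (\<i> * of_real ?\<omega> * ?e x) + g x * ?e x) = (\<i> * of_real ?\<omega>) * coef N u k + coef N g k"
  proof -
    have ui: "(\<lambda>x. u x * ?e x) integrable_on {0..1}"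
      by (intro integrable_continuous_interval continuous_intros abs_cont_on_imp_continuous_on u)
    have gi: "(\<lambda>x. g x * ?e x) integrable_on {0..1}"
      by (intro set_lebesgue_integral_eq_integral(1) absolutely_integrable_mult_continuous g continuous_intros)
    have "integral {0..1} (\<lambda>x. u x * (\<i> * of_real ?\<omega> * ?e x) + g x * ?e x) = integral {0..1} (\<lambda>x. (\<i> * of_real ?\<omega>) * (u x * ?e x) + g x * ?e x)"
      by (simp only: mult_ac)
    also have "\<dots> = integral {0..1} (\<lambda>x. (\<i> * of_real ?\<omega>) * (u x * ?e x)) + integral {0..1} (\<lambda>x. g x * ?e x)"
      by (intro Henstock_Kurzweil_Integration.integral_add integrable_on_mult_right ui gi)
    finally show ?thesis by (simp only: Henstock_Kurzweil_Integration.integral_mult_right coef_def)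
  qed
  ultimately have "coef N g k + (\<i> * of_real ?\<omega>) * coef N u k = 0" by (simp only: add.commute)
  then have "coef N g k = - ((\<i> * of_real ?\<omega>) * coef N u k)" by (simp only: eq_neg_iff_add_eq_0)
  then show ?thesis by simp
qed

text \<open>If \<open>N\<close> is odd, the constant of integration is fixed by quasi-periodicity and all frequencies are nonzero, so that
\<open>coef_derivative\<close> determines the coefficients. If \<open>N\<close> is even, the zero frequency at \<open>k = N div 2\<close> occurs: the hypothesis
at that \<open>k\<close> says that \<open>g\<close> has mean zero, which gives periodicity, and the constant is free to adjust the one
coefficient that \<open>coef_derivative\<close> does not see.\<close>

lemma quasi_periodic_primitive:
  assumes g: "g absolutely_integrable_on {0..1}" and d: "\<And>k. \<i> * of_real (freq N k) * d k = coef N g k"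
  obtains \<beta> where "\<beta> + integral {0..1} g = cis (pi * of_nat N) * \<beta>"
    "\<And>k. coef N (\<lambda>x. \<beta> + integral {0..x} g) k = d k"
proof -
  let ?F = "\<lambda>x. integral {0..x} g"
  have gi: "g integrable_on {0..1}" using g by (rule set_lebesgue_integral_eq_integral(1))
  have acF: "abs_cont_on 0 1 ?F" by (rule abs_cont_on_integral[OF g])
  obtain Z where Z: "negligible Z" "\<And>x. x \<in> {0<..<1} - Z \<Longrightarrow> (?F has_vector_derivative g x) (at x)"
    by (rule integral_has_vector_derivative_AE[OF gi]) blast
  have coefs: "\<i> * of_real (freq N k) * coef N (\<lambda>x. \<beta> + ?F x) k = \<i> * of_real (freq N k) * d k"
    if qp: "\<beta> + ?F 1 = cis (pi * of_nat N) * \<beta>" for \<beta> k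
  proof -
    have "coef N g k = \<i> * of_real (freq N k) * coef N (\<lambda>x. \<beta> + ?F x) k"
    proof (rule coef_derivative[OF _ _ g Z(1)])
      show "abs_cont_on 0 1 (\<lambda>x. \<beta> + ?F x)" by (rule abs_cont_on_dominated[OF acF acF, of 1]) auto
      show "((\<lambda>x. \<beta> + ?F x) has_vector_derivative g x) (at x)" if "x \<in> {0<..<1} - Z" for x
        using has_vector_derivative_add[OF has_vector_derivative_const Z(2)[OF that]] by simp
    qed (use qp in simp)
    then show ?thesis using d by simp
  qed
  have freq0: "freq N k = 0 \<longleftrightarrow> 2 * k = int N" for k
  proof -
    have "freq N k = 0 \<longleftrightarrow> real_of_int (2 * k) = real_of_int (int N)" by (simp add: freq_def)
    then show ?thesis by (simp only: of_int_eq_iff)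
  qed
  show thesis
  proof (cases "even N")
    case True
    then obtain n where N: "N = 2 * n" by blast
    have cisN: "cis (pi * of_nat N) = 1" unfolding N by (rule cis_pi_even)
    have fn: "freq N (int n) = 0" using freq0[of "int n"] by (simp add: N)
    have F1: "?F 1 = 0" using d[of "int n"] by (simp add: fn coef_def)
    define \<beta> where "\<beta> = d (int n) - integral {0..1} ?F"
    have qp: "\<beta> + ?F 1 = cis (pi * of_nat N) * \<beta>" by (simp add: F1 cisN)
    show thesis
    proof (rule that[OF qp])
      fix k
      show "coef N (\<lambda>x. \<beta> + ?F x) k = d k"
      proof (cases "k = int n")
        case True
        have "?F integrable_on {0..1}" by (intro integrable_continuous_interval abs_cont_on_imp_continuous_on acF)
        then have "integral {0..1} (\<lambda>x. \<beta> + ?F x) = \<beta> + integral {0..1} ?F"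
          by (subst Henstock_Kurzweil_Integration.integral_add) auto
        then show ?thesis using True by (simp add: coef_def fn \<beta>_def)
      next
        case False
        then have "freq N k \<noteq> 0" using freq0[of k] by (simp add: N)
        then show ?thesis using coefs[OF qp, of k] by simp
      qed
    qed
  next
    case False
    then obtain n where N: "N = 2 * n + 1" by (elim oddE)
    have cisN: "cis (pi * of_nat N) = - 1"
    proof -
      have "pi * of_nat N = 2 * pi * of_nat n + pi" by (simp add: N algebra_simps)
      then have "cis (pi * of_nat N) = cis (2 * pi * of_nat n) * cis pi" by (simp only: cis_mult)
      then show ?thesis using cis_multiple_2pi[of "of_nat n"] by simp
    qed
    have qp: "- ?F 1 / 2 + ?F 1 = cis (pi * of_nat N) * (- ?F 1 / 2)" by (simp add: cisN)
    show thesis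
    proof (rule that[OF qp])
      fix k
      have "2 * k \<noteq> int N" unfolding N by presburger
      then have "freq N k \<noteq> 0" by (simp only: freq0 not_False_eq_True)
      then show "coef N (\<lambda>x. - ?F 1 / 2 + ?F x) k = d k" using coefs[OF qp, of k] by simp
    qed
  qed
qed

section \<open>The recursion for the Fourier coefficients of an eigenfunction\<close>

lemma four_pi_squared_ge_1: "4 * pi\<^sup>2 \<ge> (1::real)"
proof -
  have "1 \<le> pi" using pi_ge_two by linarith
  then have "1 * 1 \<le> pi * pi" by (intro mult_mono) auto
  then show ?thesis by (simp add: power2_eq_square)
qed

text \<open>The difference between the eigenvalue \<open>(pi * N)\<^sup>2\<close> and the square of the \<open>k\<close>-th frequency; see
\<open>detuning_eq_freq\<close> below. Its zeros \<open>0\<close> and \<open>N\<close> are the resonant indices.\<close>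

definition detuning :: "nat \<Rightarrow> int \<Rightarrow> real"
  where "detuning N k = 4 * pi\<^sup>2 * of_int k * (of_nat N - of_int k)"

text \<open>The coefficients of a solution that has none below 0, with \<open>a\<close> and \<open>b\<close> at the two indices that the recursion leaves
free.\<close>

function mode_sol :: "(int \<Rightarrow> complex) \<Rightarrow> nat \<Rightarrow> complex \<Rightarrow> complex \<Rightarrow> nat \<Rightarrow> complex" where
  "mode_sol Q N a b k = (if k = 0 then a else if k = N then b
     else (\<Sum>j<k. mode_sol Q N a b j * Q (int k - int j)) / of_real (detuning N (int k)))"
  by auto
termination by (relation "Wellfounded.measure (\<lambda>(Q, N, a, b, k). k)") auto

declare mode_sol.simps [simp del]

lemma mode_sol_0 [simp]: "mode_sol Q N a b 0 = a"
  by (simp add: mode_sol.simps)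

lemma mode_sol_N [simp]: "N > 0 \<Longrightarrow> mode_sol Q N a b N = b"
  by (simp add: mode_sol.simps[of Q N a b N])

lemma detuning_eq_0_iff: "detuning N k = 0 \<longleftrightarrow> k = 0 \<or> k = int N"
  by (auto simp: detuning_def)

lemma mode_sol_rec:
  assumes "k \<noteq> 0" "k \<noteq> N"
  shows "of_real (detuning N (int k)) * mode_sol Q N a b k = (\<Sum>j<k. mode_sol Q N a b j * Q (int k - int j))"
  using assms by (subst mode_sol.simps) (simp add: detuning_eq_0_iff)

lemma mode_sol_linear:
  "mode_sol Q N a b k = a * mode_sol Q N 1 0 k + b * mode_sol Q N 0 1 k"
proof (induction k rule: less_induct)
  case (less k)
  show ?case
  proof (cases "k = 0 \<or> k = N")
    case True
    then show ?thesis by (cases "k = 0") (simp_all add: mode_sol.simps)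
  next
    case False
    have "(\<Sum>j<k. mode_sol Q N a b j * Q (int k - int j)) =
      a * (\<Sum>j<k. mode_sol Q N 1 0 j * Q (int k - int j)) + b * (\<Sum>j<k. mode_sol Q N 0 1 j * Q (int k - int j))"
      unfolding sum_distrib_left sum.distrib[symmetric]
      by (rule sum.cong[OF refl], subst less.IH) (simp_all add: algebra_simps)
    then show ?thesis using False
      by (simp add: mode_sol.simps[of Q N _ _ k] add_divide_distrib)
  qed
qed

lemma mode_sol_zero_low: "k < N \<Longrightarrow> mode_sol Q N 0 b k = 0"
proof (induction k rule: less_induct)
  case (less k)
  have "(\<Sum>j<k. mode_sol Q N 0 b j * Q (int k - int j)) = 0"
    by (rule sum.neutral) (use less in auto)
  then show ?case using less.prems by (simp add: mode_sol.simps[of Q N 0 b k])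
qed

text \<open>The right-hand side of the equation at the resonant index \<open>N\<close>, whose left-hand side is 0, for the solution
with value 1 at index 0.\<close>

definition resonance :: "(int \<Rightarrow> complex) \<Rightarrow> nat \<Rightarrow> complex"
  where "resonance Q N = (\<Sum>j<N. mode_sol Q N 1 0 j * Q (int N - int j))"

lemma sum_mode_sol_resonance: "(\<Sum>j<N. mode_sol Q N a b j * Q (int N - int j)) = a * resonance Q N"
  unfolding resonance_def sum_distrib_left
  by (rule sum.cong) (auto simp: mode_sol_linear[of Q N a b] mode_sol_zero_low)

section \<open>Two-sided solutions of the coefficient equations\<close>

text \<open>The eigenvalue equation on the side of the Fourier coefficients; \<open>Q\<close> stands for those of the potential.\<close>

definition mode_eqs :: "(int \<Rightarrow> complex) \<Rightarrow> nat \<Rightarrow> (int \<Rightarrow> complex) \<Rightarrow> bool"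
  where "mode_eqs Q N c \<longleftrightarrow> (\<forall>k. ((\<lambda>j. c j * Q (k - j)) has_sum (of_real (detuning N k) * c k)) UNIV)"

lemma small_tail:
  fixes f :: "int \<Rightarrow> real"
  assumes f: "f summable_on UNIV" and nn: "\<And>k. f k \<ge> 0" and "\<epsilon> > 0"
  obtains K :: int where "K \<ge> 1" "infsum f {..-K} \<le> \<epsilon>"
proof -
  have "(f has_sum infsum f UNIV) UNIV" using f by (rule has_sum_infsum)
  then have "\<forall>\<^sub>F F in finite_subsets_at_top UNIV. dist (sum f F) (infsum f UNIV) < \<epsilon>"
    using \<open>\<epsilon> > 0\<close> unfolding has_sum_def by (rule tendstoD)
  then obtain F where F: "finite F" "dist (sum f F) (infsum f UNIV) < \<epsilon>"
    unfolding eventually_finite_subsets_at_top by auto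
  obtain m where m: "\<And>x. x \<in> F \<Longrightarrow> m \<le> x" using bdd_below_finite[OF F(1)] unfolding bdd_below_def by blast
  define K where "K = max 1 (1 - m)"
  have disj: "{..-K} \<inter> F = {}" using m by (force simp: K_def)
  have sub: "f summable_on A" for A using summable_on_subset_banach[OF f, of A] by simp
  have "infsum f {..-K} + sum f F = infsum f ({..-K} \<union> F)"
    using infsum_Un_disjoint[OF sub sub disj] F(1) by simp
  also have "\<dots> \<le> infsum f UNIV" by (rule infsum_mono2[OF sub sub]) (use nn in auto)
  finally have "infsum f {..-K} \<le> \<epsilon>" using F(2) by (simp add: dist_real_def abs_if split: if_splits)
  moreover have "K \<ge> 1" by (simp add: K_def)
  ultimately show thesis using that by blast
qed

lemma summable_on_int_inverse_square: "(\<lambda>k::int. 1 / (of_int k)\<^sup>2 :: real) summable_on UNIV"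
proof -
  let ?f = "\<lambda>k::int. 1 / (of_int k)\<^sup>2 :: real"
  have "(\<lambda>n::nat. 1 / (of_nat n)\<^sup>2 :: real) summable_on UNIV"
  proof (rule norm_summable_imp_summable_on)
    show "summable (\<lambda>n. norm (1 / (of_nat n)\<^sup>2 :: real))"
      using inverse_power_summable[of 2, where ?'a = real] by (simp add: inverse_eq_divide)
  qed
  then have n: "(?f \<circ> int) summable_on UNIV" by (simp add: o_def)
  then have p: "?f summable_on (range int)" by (subst summable_on_reindex) auto
  have "(?f \<circ> (\<lambda>n. - int n)) summable_on UNIV" using n by (simp add: o_def)
  then have m: "?f summable_on (range (\<lambda>n. - int n))" by (subst summable_on_reindex) (auto simp: inj_on_def)
  have "?f summable_on (range int \<union> range (\<lambda>n. - int n))" using p m by (rule summable_on_union)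
  moreover have "range int \<union> range (\<lambda>n. - int n) = UNIV"
  proof -
    have "k \<in> range int \<union> range (\<lambda>n. - int n)" for k
      by (cases k rule: int_cases2) auto
    then show ?thesis by blast
  qed
  ultimately show ?thesis by simp
qed

text \<open>Let \<open>T\<close> be the sum of the \<open>norm (c k)\<close> over \<open>k \<le> -K\<close>. For such \<open>k\<close> the equation bounds
\<open>norm (c k)\<close> by \<open>B * T / k\<^sup>2\<close>, because only indices below \<open>k\<close> enter it. Summation gives \<open>T \<le> T / 2\<close> once \<open>K\<close> is large.
With nothing below, the equations propagate zero up to index \<open>-1\<close>; the detuning at 0 vanishes, which stops the argument there.\<close>

lemma mode_eqs_negative_zero:
  assumes c: "(\<lambda>k. norm (c k)) summable_on UNIV" and Q: "\<And>m. norm (Q m) \<le> B" "\<And>m. m \<le> 0 \<Longrightarrow> Q m = 0"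
    and eqs: "mode_eqs Q N c" and "k < 0"
  shows "c k = 0"
proof -
  have sub: "(\<lambda>k. norm (c k)) summable_on A" for A using summable_on_subset_banach[OF c, of A] by simp
  have "B \<ge> 0" using Q(1)[of 0] norm_ge_zero by (rule order_trans[rotated])
  have bound: "norm (c k) \<le> (B * (1 / (of_int k)\<^sup>2)) * infsum (\<lambda>j. norm (c j)) {..-K}" if k: "k \<le> -K" "K \<ge> 1" for k K
  proof -
    let ?T = "infsum (\<lambda>j. norm (c j)) {..-K}"
    have "((\<lambda>j. c j * Q (k - j)) has_sum (of_real (detuning N k) * c k)) UNIV" using eqs by (simp add: mode_eqs_def)
    then have "((\<lambda>j. c j * Q (k - j)) has_sum (of_real (detuning N k) * c k)) {..-K}"
      by (subst has_sum_cong_neutral[where T = UNIV]) (use k Q(2) in auto)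
    moreover have "((\<lambda>j. norm (c j) * B) has_sum (?T * B)) {..-K}"
      by (intro has_sum_cmult_left has_sum_infsum sub)
    ultimately have "norm (of_real (detuning N k) * c k) \<le> ?T * B"
      by (rule norm_infsum_le) (simp add: norm_mult mult_left_mono Q(1))
    then have *: "\<bar>detuning N k\<bar> * norm (c k) \<le> ?T * B" by (simp add: norm_mult)
    have "(of_int k)\<^sup>2 \<le> \<bar>detuning N k\<bar>"
    proof -
      have "(real_of_int k)\<^sup>2 = \<bar>real_of_int k\<bar> * \<bar>real_of_int k\<bar>" by (simp add: power2_eq_square)
      also have "\<dots> \<le> \<bar>real_of_int k\<bar> * \<bar>real N - real_of_int k\<bar>"
        using k by (intro mult_left_mono) (simp_all add: abs_if)
      also have "\<dots> \<le> (4 * pi\<^sup>2) * (\<bar>real_of_int k\<bar> * \<bar>real N - real_of_int k\<bar>)"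
        using mult_right_mono[OF four_pi_squared_ge_1, of "\<bar>real_of_int k\<bar> * \<bar>real N - real_of_int k\<bar>"] by simp
      finally show ?thesis by (simp add: detuning_def abs_mult mult.assoc)
    qed
    then have "(of_int k)\<^sup>2 * norm (c k) \<le> \<bar>detuning N k\<bar> * norm (c k)" by (intro mult_right_mono) auto
    with * have "(of_int k)\<^sup>2 * norm (c k) \<le> ?T * B" by linarith
    then show ?thesis using k by (simp add: field_simps)
  qed
  have ss: "(\<lambda>k. B * (1 / (of_int k)\<^sup>2)) summable_on A" for A
    by (rule summable_on_cmult_right) (use summable_on_subset_banach[OF summable_on_int_inverse_square, of A] in simp)
  obtain K where K: "K \<ge> 1" "infsum (\<lambda>k::int. B * (1 / (of_int k)\<^sup>2)) {..-K} \<le> 1 / 2"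
    by (rule small_tail[OF ss, of "1 / 2"]) (use \<open>B \<ge> 0\<close> in auto)
  define T where "T = infsum (\<lambda>j. norm (c j)) {..-K}"
  have "T \<ge> 0" unfolding T_def by (rule infsum_nonneg) simp
  have "T \<le> infsum (\<lambda>k. (B * (1 / (of_int k)\<^sup>2)) * T) {..-K}"
    unfolding T_def
  proof (rule infsum_mono[OF sub])
    show "(\<lambda>k. B * (1 / (of_int k)\<^sup>2) * infsum (\<lambda>j. norm (c j)) {..-K}) summable_on {..-K}"
      by (intro summable_on_cmult_left ss)
  qed (use bound K in auto)
  also have "\<dots> = infsum (\<lambda>k::int. B * (1 / (of_int k)\<^sup>2)) {..-K} * T"
    by (rule infsum_cmult_left) (use ss in auto)
  also have "\<dots> \<le> (1 / 2) * T" using K(2) \<open>T \<ge> 0\<close> by (rule mult_right_mono)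
  finally have "T = 0" using \<open>T \<ge> 0\<close> by linarith
  have low: "c k = 0" if "k \<le> -K" for k using bound[OF that K(1)] \<open>T = 0\<close> by (simp add: T_def)
  have "\<forall>k < 0. k \<le> -K + int n \<longrightarrow> c k = 0" for n
  proof (induction n)
    case 0
    then show ?case using low by simp
  next
    case (Suc n)
    show ?case
    proof (intro allI impI)
      fix k :: int assume k: "k < 0" "k \<le> - K + int (Suc n)"
      have "c j * Q (k - j) = 0" for j
        using Suc.IH Q(2)[of "k - j"] k by (cases "j < k") auto
      moreover have "((\<lambda>j. c j * Q (k - j)) has_sum (of_real (detuning N k) * c k)) UNIV"
        using eqs by (simp add: mode_eqs_def)
      moreover have "(\<lambda>j. c j * Q (k - j)) = (\<lambda>j. 0)" using calculation(1) by (intro ext)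
      ultimately have "((\<lambda>j::int. 0) has_sum (of_real (detuning N k) * c k)) UNIV" by (simp only:)
      then have "of_real (detuning N k) * c k = 0" using has_sum_unique[OF _ has_sum_0] by blast
      then show "c k = 0" using k(1) by (auto simp: detuning_eq_0_iff)
    qed
  qed
  from this[of "nat K"] show ?thesis using \<open>k < 0\<close> K(1) by simp
qed

lemma has_sum_one_sided_convolution:
  fixes c Q :: "int \<Rightarrow> complex"
  assumes "\<And>k. k < 0 \<Longrightarrow> c k = 0" "\<And>m. m \<le> 0 \<Longrightarrow> Q m = 0"
  shows "((\<lambda>j. c j * Q (k - j)) has_sum (\<Sum>j<nat k. c (int j) * Q (k - int j))) UNIV"
proof (rule has_sum_finite_neutralI[of "int ` {..<nat k}"])
  fix j assume j: "j \<in> UNIV - int ` {..<nat k}"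
  have "j < 0 \<or> k - j \<le> 0"
  proof (rule ccontr)
    assume "\<not> ?thesis"
    then have "j = int (nat j)" "nat j < nat k" by auto
    then have "j \<in> int ` {..<nat k}" by blast
    then show False using j by blast
  qed
  then show "c j * Q (k - j) = 0" using assms by auto
qed (auto simp: sum.reindex)

lemma mode_eqs_imp_mode_sol:
  assumes eqs: "mode_eqs Q N c" and neg: "\<And>k. k < 0 \<Longrightarrow> c k = 0" and Q: "\<And>m. m \<le> 0 \<Longrightarrow> Q m = 0"
  shows "c (int n) = mode_sol Q N (c 0) (c (int N)) n" and "c 0 * resonance Q N = 0"
proof -
  have rec: "of_real (detuning N (int n)) * c (int n) = (\<Sum>j<n. c (int j) * Q (int n - int j))" for n
  proof -
    have "((\<lambda>j. c j * Q (int n - j)) has_sum (of_real (detuning N (int n)) * c (int n))) UNIV"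
      using eqs by (simp add: mode_eqs_def)
    then show ?thesis
      using has_sum_one_sided_convolution[of c Q "int n", OF neg Q] has_sum_unique by (simp only: nat_int) blast
  qed
  show eq: "c (int n) = mode_sol Q N (c 0) (c (int N)) n" for n
  proof (induction n rule: less_induct)
    case (less n)
    show ?case
    proof (cases "n = 0 \<or> n = N")
      case True
      then show ?thesis by (cases "n = 0") (auto simp: mode_sol.simps)
    next
      case False
      have "of_real (detuning N (int n)) * c (int n) = of_real (detuning N (int n)) * mode_sol Q N (c 0) (c (int N)) n"
        using rec[of n] mode_sol_rec[of n N Q] False less.IH by simp
      then show ?thesis using False by (simp add: detuning_eq_0_iff)
    qed
  qed
  have "0 = (\<Sum>j<N. c (int j) * Q (int N - int j))" using rec[of N] by (simp add: detuning_def)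
  also have "\<dots> = (\<Sum>j<N. mode_sol Q N (c 0) (c (int N)) j * Q (int N - int j))" by (simp only: eq[symmetric])
  also have "\<dots> = c 0 * resonance Q N" by (rule sum_mode_sol_resonance)
  finally show "c 0 * resonance Q N = 0" by simp
qed

definition two_sided :: "(nat \<Rightarrow> complex) \<Rightarrow> int \<Rightarrow> complex"
  where "two_sided s k = (if k < 0 then 0 else s (nat k))"

lemma mode_eqs_mode_sol:
  assumes "N > 0" and Q: "\<And>m. m \<le> 0 \<Longrightarrow> Q m = 0" and "a * resonance Q N = 0"
  shows "mode_eqs Q N (two_sided (mode_sol Q N a b))"
  unfolding mode_eqs_def
proof
  fix k
  let ?c = "two_sided (mode_sol Q N a b)"
  have "((\<lambda>j. ?c j * Q (k - j)) has_sum (\<Sum>j<nat k. ?c (int j) * Q (k - int j))) UNIV"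
    by (rule has_sum_one_sided_convolution) (use Q in \<open>auto simp: two_sided_def\<close>)
  moreover have "(\<Sum>j<nat k. ?c (int j) * Q (k - int j)) = of_real (detuning N k) * ?c k"
  proof (cases "k \<le> 0")
    case True
    then show ?thesis by (auto simp: two_sided_def detuning_def)
  next
    case False
    then have k: "k = int (nat k)" "nat k \<noteq> 0" by auto
    have "(\<Sum>j<nat k. ?c (int j) * Q (k - int j)) = (\<Sum>j<nat k. mode_sol Q N a b j * Q (int (nat k) - int j))"
      using k by (simp add: two_sided_def)
    also have "\<dots> = of_real (detuning N (int (nat k))) * mode_sol Q N a b (nat k)"
    proof (cases "nat k = N")
      case True
      then show ?thesis using sum_mode_sol_resonance[of Q N a b] assms(3) by (simp add: detuning_def)
    next
      case neq: False
      show ?thesis by (rule mode_sol_rec[symmetric]) (use k neq in auto)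
    qed
    also have "\<dots> = of_real (detuning N k) * ?c k" using False by (simp add: two_sided_def)
    finally show ?thesis .
  qed
  ultimately show "((\<lambda>j. ?c j * Q (k - j)) has_sum (of_real (detuning N k) * ?c k)) UNIV" by simp
qed

text \<open>The recursion multiplies the partial sums of the norms, beyond index \<open>N\<close>, by at most \<open>1 + B / m\<^sup>2\<close> at step \<open>m\<close>,
and the product of these factors is bounded by the exponential of a convergent series.\<close>

lemma mode_sol_summable:
  assumes Q: "\<And>m. norm (Q m) \<le> B"
  shows "summable (\<lambda>k. norm (mode_sol Q N a b k))"
proof -
  define s where "s = (\<lambda>k. norm (mode_sol Q N a b k))"
  define P where "P = (\<lambda>m. \<Sum>j<N + 1 + m. s j)"
  have "B \<ge> 0" using Q[of 0] norm_ge_zero by (rule order_trans[rotated])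
  have s0: "s k \<ge> 0" for k by (simp add: s_def)
  have P0: "P m \<ge> 0" for m unfolding P_def by (rule sum_nonneg) (rule s0)
  have step: "s (N + 1 + m) \<le> B * (1 / (real (Suc m))\<^sup>2) * P m" for m
  proof -
    let ?k = "N + 1 + m"
    have "of_real (detuning N (int ?k)) * mode_sol Q N a b ?k = (\<Sum>j<?k. mode_sol Q N a b j * Q (int ?k - int j))"
      by (rule mode_sol_rec) auto
    also have "norm \<dots> \<le> (\<Sum>j<?k. s j * B)"
      by (rule sum_norm_le) (simp add: s_def norm_mult mult_left_mono Q)
    finally have "norm (of_real (detuning N (int ?k)) * mode_sol Q N a b ?k) \<le> (\<Sum>j<?k. s j * B)" .
    then have *: "\<bar>detuning N (int ?k)\<bar> * s ?k \<le> P m * B"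
      by (simp only: norm_mult norm_of_real s_def P_def sum_distrib_right)
    have "(real (Suc m))\<^sup>2 \<le> \<bar>detuning N (int ?k)\<bar>"
    proof -
      have "(real (Suc m))\<^sup>2 \<le> real ?k * real (Suc m)"
        unfolding power2_eq_square by (intro mult_right_mono) auto
      also have "\<dots> \<le> (4 * pi\<^sup>2) * (real ?k * real (Suc m))"
        using mult_right_mono[OF four_pi_squared_ge_1, of "real ?k * real (Suc m)"] by simp
      also have "\<dots> = \<bar>detuning N (int ?k)\<bar>" by (simp add: detuning_def abs_mult mult.assoc)
      finally show ?thesis .
    qed
    then have "(real (Suc m))\<^sup>2 * s ?k \<le> \<bar>detuning N (int ?k)\<bar> * s ?k" by (intro mult_right_mono s0)
    with * have "(real (Suc m))\<^sup>2 * s ?k \<le> P m * B" by linarith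
    moreover have "(real (Suc m))\<^sup>2 > 0" by simp
    ultimately have "s ?k \<le> P m * B / (real (Suc m))\<^sup>2" by (simp only: pos_le_divide_eq mult.commute)
    then show ?thesis by (simp add: mult.commute)
  qed
  let ?r = "\<lambda>m. B * (1 / (real (Suc m))\<^sup>2)"
  have rsum: "summable ?r"
  proof (rule summable_mult)
    have "summable (\<lambda>m. 1 / (real m)\<^sup>2)"
      using inverse_power_summable[of 2, where ?'a = real] by (simp add: inverse_eq_divide)
    then show "summable (\<lambda>m. 1 / (real (Suc m))\<^sup>2)" by (rule summable_Suc_iff[THEN iffD2])
  qed
  have grow: "P m \<le> P 0 * exp (\<Sum>i<m. ?r i)" for m
  proof (induction m)
    case (Suc m)
    have "P (Suc m) = P m + s (N + 1 + m)" by (simp add: P_def)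
    also have "\<dots> \<le> P m + ?r m * P m" using step[of m] by simp
    also have "\<dots> = P m * (1 + ?r m)" by (simp add: algebra_simps)
    also have "\<dots> \<le> P m * exp (?r m)" by (intro mult_left_mono exp_ge_add_one_self P0)
    also have "\<dots> \<le> P 0 * exp (\<Sum>i<m. ?r i) * exp (?r m)" by (intro mult_right_mono Suc.IH) simp
    also have "\<dots> = P 0 * exp (\<Sum>i<Suc m. ?r i)" by (simp add: exp_add mult.assoc)
    finally show ?case .
  qed simp
  have "summable s"
  proof (rule summableI_nonneg_bounded)
    fix n
    have "(\<Sum>j<n. s j) \<le> P n" unfolding P_def by (rule sum_mono2) (auto simp: s0)
    also have "\<dots> \<le> P 0 * exp (\<Sum>i<n. ?r i)" by (rule grow)
    also have "\<dots> \<le> P 0 * exp (suminf ?r)"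
    proof (intro mult_left_mono P0)
      have "(\<Sum>i<n. ?r i) \<le> suminf ?r" by (rule sum_le_suminf[OF rsum]) (simp_all add: \<open>B \<ge> 0\<close>)
      then show "exp (\<Sum>i<n. ?r i) \<le> exp (suminf ?r)" by (simp only: exp_le_cancel_iff)
    qed
    finally show "(\<Sum>j<n. s j) \<le> P 0 * exp (suminf ?r)" .
  qed (rule s0)
  then show ?thesis by (simp add: s_def)
qed

lemma two_sided_summable_on:
  assumes "summable (\<lambda>k. norm (s k))"
  shows "(\<lambda>k. norm (two_sided s k)) summable_on UNIV"
proof -
  have "(\<lambda>k. norm (s k)) summable_on UNIV"
    by (rule norm_summable_imp_summable_on) (use assms in simp)
  then have "((\<lambda>k. norm (two_sided s k)) \<circ> int) summable_on UNIV" by (simp add: o_def two_sided_def)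
  then have "(\<lambda>k. norm (two_sided s k)) summable_on (range int)" by (subst summable_on_reindex) auto
  then show ?thesis
  proof (rule summable_on_cong_neutral[THEN iffD1, rotated -1])
    fix k :: int assume "k \<in> UNIV - range int"
    then have "k < 0" by (metis DiffD2 nonneg_int_cases not_le rangeI)
    then show "norm (two_sided s k) = 0" by (simp add: two_sided_def)
  qed auto
qed

section \<open>The resonance coefficient as a sum over compositions\<close>

text \<open>All tuples of \<open>tuples p j\<close>, for every length \<open>j\<close> at once.\<close>

definition compositions_below :: "nat \<Rightarrow> nat list set"
  where "compositions_below p = {ns. (\<forall>m\<in>set ns. 1 \<le> m) \<and> sum_list ns < p}"

text \<open>The contribution of one tuple to the bracket in \<open>D\<close>, obtained by applying the recursion repeatedly: each entry
\<open>m\<close> steps from index \<open>p\<close> down to \<open>p - m\<close> and divides by the detuning met there. The explicit product is in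
\<open>path_term_explicit\<close>.\<close>

fun path_term :: "(int \<Rightarrow> complex) \<Rightarrow> nat \<Rightarrow> nat \<Rightarrow> nat list \<Rightarrow> complex" where
  "path_term Q N p [] = Q (int p)"
| "path_term Q N p (m # ms) = Q (int m) / of_real (detuning N (int (p - m))) * path_term Q N (p - m) ms"

text \<open>The summand for a tuple of length \<open>j\<close> in the bracket of \<open>D\<close>.\<close>

abbreviation tuple_term :: "(int \<Rightarrow> complex) \<Rightarrow> nat \<Rightarrow> nat \<Rightarrow> nat \<Rightarrow> nat list \<Rightarrow> complex"
  where "tuple_term Q N p j ns \<equiv> (\<Prod>i<j. Q (int (ns ! i))) * Q (int p - int (sum_list ns)) /
    of_real (\<Prod>s = 1..j. 4 * pi\<^sup>2 * (real p - real (sum_list (take s ns))) * (real N - real p + real (sum_list (take s ns))))"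

lemma length_le_sum_list: "\<forall>m\<in>set ns. (1::nat) \<le> m \<Longrightarrow> length ns \<le> sum_list ns"
  by (induction ns) auto

lemma finite_compositions_below: "finite (compositions_below p)"
proof (rule finite_subset)
  show "compositions_below p \<subseteq> {ns. set ns \<subseteq> {..p} \<and> length ns \<le> p}"
  proof
    fix ns assume ns: "ns \<in> compositions_below p"
    then have "length ns \<le> sum_list ns" "sum_list ns < p"
      by (auto simp: compositions_below_def intro: length_le_sum_list)
    moreover have "m \<le> sum_list ns" if "m \<in> set ns" for m using that by (intro member_le_sum_list) auto
    ultimately show "ns \<in> {ns. set ns \<subseteq> {..p} \<and> length ns \<le> p}" by fastforce
  qed
  show "finite {ns. set ns \<subseteq> {..p} \<and> length ns \<le> p}" by (rule finite_lists_length_le) simp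
qed

lemma compositions_below_unfold:
  assumes "p > 0"
  shows "compositions_below p = insert [] (\<Union>m\<in>{1..<p}. (#) m ` compositions_below (p - m))"
proof (intro equalityI subsetI)
  fix ns assume ns: "ns \<in> compositions_below p"
  show "ns \<in> insert [] (\<Union>m\<in>{1..<p}. (#) m ` compositions_below (p - m))"
  proof (cases ns)
    case (Cons m ms)
    then have "m \<in> {1..<p}" "ms \<in> compositions_below (p - m)" using ns by (auto simp: compositions_below_def)
    then show ?thesis using Cons by blast
  qed simp
next
  fix ns assume "ns \<in> insert [] (\<Union>m\<in>{1..<p}. (#) m ` compositions_below (p - m))"
  then show "ns \<in> compositions_below p" using assms by (auto simp: compositions_below_def)
qed

lemma sum_path_term_unfold:
  assumes "p > 0"
  shows "(\<Sum>ns\<in>compositions_below p. path_term Q N p ns) = Q (int p) +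
    (\<Sum>m=1..<p. Q (int m) / of_real (detuning N (int (p - m))) * (\<Sum>ns\<in>compositions_below (p - m). path_term Q N (p - m) ns))"
proof -
  have "(\<Sum>ns\<in>compositions_below p. path_term Q N p ns) =
    path_term Q N p [] + (\<Sum>ns\<in>(\<Union>m\<in>{1..<p}. (#) m ` compositions_below (p - m)). path_term Q N p ns)"
    unfolding compositions_below_unfold[OF assms]
    by (rule sum.insert) (auto intro: finite_compositions_below)
  also have "(\<Sum>ns\<in>(\<Union>m\<in>{1..<p}. (#) m ` compositions_below (p - m)). path_term Q N p ns) =
    (\<Sum>m=1..<p. \<Sum>ns\<in>(#) m ` compositions_below (p - m). path_term Q N p ns)"
    by (rule sum.UNION_disjoint) (auto intro: finite_compositions_below)
  also have "\<dots> = (\<Sum>m=1..<p. \<Sum>ns\<in>compositions_below (p - m). path_term Q N p (m # ns))"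
    by (rule sum.cong[OF refl], subst sum.reindex) (auto simp: inj_on_def)
  finally show ?thesis by (simp add: sum_distrib_left)
qed

text \<open>Both sides satisfy the same recursion in \<open>p\<close>: on the right, the sum is split according to the first entry of the tuple, and
on the left this entry is the index of the potential in the convolution.\<close>

lemma convolution_eq_sum_path_term:
  assumes "0 < p" "p < N"
  shows "(\<Sum>j<p. mode_sol Q N 1 0 j * Q (int p - int j)) = (\<Sum>ns\<in>compositions_below p. path_term Q N p ns)"
  using assms
proof (induction p rule: less_induct)
  case (less p)
  let ?\<alpha> = "mode_sol Q N 1 0"
  have "(\<Sum>j<p. ?\<alpha> j * Q (int p - int j)) = Q (int p) + (\<Sum>j=1..<p. ?\<alpha> j * Q (int p - int j))"
    using less.prems by (simp add: lessThan_atLeast0 sum.atLeast_Suc_lessThan)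
  also have "(\<Sum>j=1..<p. ?\<alpha> j * Q (int p - int j)) = (\<Sum>m=1..<p. ?\<alpha> (p - m) * Q (int m))"
    by (rule sum.reindex_bij_witness[of _ "\<lambda>m. p - m" "\<lambda>m. p - m"]) (auto simp: of_nat_diff)
  also have "\<dots> = (\<Sum>m=1..<p. Q (int m) / of_real (detuning N (int (p - m))) * (\<Sum>ns\<in>compositions_below (p - m). path_term Q N (p - m) ns))"
  proof (rule sum.cong[OF refl])
    fix m assume m: "m \<in> {1..<p}"
    have "?\<alpha> (p - m) = (\<Sum>j<p - m. ?\<alpha> j * Q (int (p - m) - int j)) / of_real (detuning N (int (p - m)))"
      using m less.prems by (subst mode_sol.simps) auto
    also have "(\<Sum>j<p - m. ?\<alpha> j * Q (int (p - m) - int j)) = (\<Sum>ns\<in>compositions_below (p - m). path_term Q N (p - m) ns)"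
      by (rule less.IH) (use m less.prems in auto)
    finally show "?\<alpha> (p - m) * Q (int m) = Q (int m) / of_real (detuning N (int (p - m))) * (\<Sum>ns\<in>compositions_below (p - m). path_term Q N (p - m) ns)"
      by simp
  qed
  finally show ?case using sum_path_term_unfold[OF less.prems(1), of Q N] by simp
qed

lemma path_term_explicit:
  assumes "ns \<in> compositions_below p"
  shows "path_term Q N p ns = tuple_term Q N p (length ns) ns"
  using assms
proof (induction ns arbitrary: p)
  case (Cons m ms)
  have m: "m < p" "ms \<in> compositions_below (p - m)" using Cons.prems by (auto simp: compositions_below_def)
  have det: "detuning N (int (p - m)) = 4 * pi\<^sup>2 * (real p - real m) * (real N - real p + real m)"
    using m(1) by (simp add: detuning_def of_nat_diff)
  have den: "(\<Prod>s = 1..length (m # ms). 4 * pi\<^sup>2 * (real p - real (sum_list (take s (m # ms)))) * (real N - real p + real (sum_list (take s (m # ms)))))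
    = detuning N (int (p - m)) * (\<Prod>s = 1..length ms. 4 * pi\<^sup>2 * (real (p - m) - real (sum_list (take s ms))) * (real N - real (p - m) + real (sum_list (take s ms))))"
  proof -
    have split: "(\<Prod>s = 1..Suc (length ms). g s) = g 1 * (\<Prod>s = 1..length ms. g (Suc s))" for g :: "nat \<Rightarrow> real"
      by (simp add: prod.atLeast_Suc_atMost prod.atLeast_Suc_atMost_Suc_shift del: prod.cl_ivl_Suc)
    have first: "4 * pi\<^sup>2 * (real p - real (sum_list (take 1 (m # ms)))) * (real N - real p + real (sum_list (take 1 (m # ms)))) = detuning N (int (p - m))"
      unfolding det by simp
    have rest: "real p - real (sum_list (take (Suc s) (m # ms))) = real (p - m) - real (sum_list (take s ms))"
      "real N - real p + real (sum_list (take (Suc s) (m # ms))) = real N - real (p - m) + real (sum_list (take s ms))" for s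
      using m(1) by (simp_all add: of_nat_diff)
    have "length (m # ms) = Suc (length ms)" by simp
    then show ?thesis by (simp only: split first rest)
  qed
  have num: "(\<Prod>i<length (m # ms). Q (int ((m # ms) ! i))) = Q (int m) * (\<Prod>i<length ms. Q (int (ms ! i)))"
    by (simp add: prod.lessThan_Suc_shift del: prod.lessThan_Suc)
  have rem: "int p - int (sum_list (m # ms)) = int (p - m) - int (sum_list ms)" using m(1) by (simp add: of_nat_diff)
  show ?case
    unfolding path_term.simps Cons.IH[OF m(2)] den num rem of_real_mult times_divide_times_eq
    by (simp only: mult.assoc)
qed simp

lemma sum_compositions_below_by_length:
  fixes h :: "nat list \<Rightarrow> complex"
  assumes "p > 0"
  shows "(\<Sum>ns\<in>compositions_below p. h ns) = h [] + (\<Sum>j = 1..p - 1. \<Sum>ns\<in>tuples p j. h ns)"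
proof -
  have fin: "finite (tuples p j)" for j
    by (rule finite_subset[OF _ finite_compositions_below[of p]]) (auto simp: tuples_def compositions_below_def)
  have eq: "compositions_below p = (\<Union>j\<in>{0..p - 1}. tuples p j)"
  proof (intro equalityI subsetI)
    fix ns assume ns: "ns \<in> compositions_below p"
    then have "length ns \<le> sum_list ns" by (intro length_le_sum_list) (simp add: compositions_below_def)
    then have "length ns \<in> {0..p - 1}" using ns by (auto simp: compositions_below_def)
    moreover have "ns \<in> tuples p (length ns)" using ns by (auto simp: tuples_def compositions_below_def)
    ultimately show "ns \<in> (\<Union>j\<in>{0..p - 1}. tuples p j)" by blast
  qed (auto simp: tuples_def compositions_below_def)
  have "(\<Sum>ns\<in>compositions_below p. h ns) = (\<Sum>j = 0..p - 1. \<Sum>ns\<in>tuples p j. h ns)"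
    unfolding eq
  proof (rule sum.UNION_disjoint)
    show "\<forall>i\<in>{0..p - 1}. \<forall>j\<in>{0..p - 1}. i \<noteq> j \<longrightarrow> tuples p i \<inter> tuples p j = {}"
      by (auto simp: tuples_def)
  qed (use fin in blast)+
  also have "\<dots> = (\<Sum>ns\<in>tuples p 0. h ns) + (\<Sum>j = 1..p - 1. \<Sum>ns\<in>tuples p j. h ns)"
    by (simp add: sum.atLeast_Suc_atMost)
  also have "tuples p 0 = {[]}" using assms by (auto simp: tuples_def)
  finally show ?thesis by simp
qed

text \<open>By \<open>mode_sol_rec\<close>, the bracket in \<open>D\<close> is the \<open>p\<close>-th coefficient of the solution times its detuning, and that detuning
cancels against the factor in front of the bracket.\<close>

theorem D_eq_resonance:
  assumes "N > 0"
  shows "D q N = resonance (fourier_coeff q) N"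
proof -
  let ?Q = "fourier_coeff q" and ?\<alpha> = "mode_sol (fourier_coeff q) N 1 0"
  have inner: "?Q (int p) + (\<Sum>j = 1..p - 1. \<Sum>ns\<in>tuples p j.
           tuple_term ?Q N p j ns)
      = of_real (detuning N (int p)) * ?\<alpha> p" if p: "p \<in> {1..N - 1}" for p
  proof -
    have "of_real (detuning N (int p)) * ?\<alpha> p = (\<Sum>j<p. ?\<alpha> j * ?Q (int p - int j))"
      by (rule mode_sol_rec) (use p in auto)
    also have "\<dots> = (\<Sum>ns\<in>compositions_below p. path_term ?Q N p ns)"
      by (rule convolution_eq_sum_path_term) (use p in auto)
    also have "\<dots> = ?Q (int p) + (\<Sum>j = 1..p - 1. \<Sum>ns\<in>tuples p j. path_term ?Q N p ns)"
      using p by (subst sum_compositions_below_by_length) auto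
    also have "(\<Sum>j = 1..p - 1. \<Sum>ns\<in>tuples p j. path_term ?Q N p ns) = (\<Sum>j = 1..p - 1. \<Sum>ns\<in>tuples p j.
           tuple_term ?Q N p j ns)"
    proof (intro sum.cong refl)
      fix j ns assume "ns \<in> tuples p j"
      then have "ns \<in> compositions_below p" "length ns = j" by (auto simp: tuples_def compositions_below_def)
      then show "path_term ?Q N p ns = tuple_term ?Q N p j ns"
        using path_term_explicit[of ns p ?Q N] by simp
    qed
    finally show ?thesis by simp
  qed
  have "D q N = ?Q (int N) + (\<Sum>p = 1..N - 1. ?Q (int N - int p) / of_real (4 * pi\<^sup>2 * real p * (real N - real p)) * (of_real (detuning N (int p)) * ?\<alpha> p))"
    unfolding D_def by (intro arg_cong2[of _ _ _ _ "(+)"] refl sum.cong) (simp only: inner)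
  also have "\<dots> = ?Q (int N) + (\<Sum>p = 1..N - 1. ?\<alpha> p * ?Q (int N - int p))"
  proof (intro arg_cong2[of _ _ _ _ "(+)"] refl sum.cong)
    fix p assume p: "p \<in> {1..N - 1}"
    have det: "4 * pi\<^sup>2 * real p * (real N - real p) = detuning N (int p)" by (simp add: detuning_def)
    have "detuning N (int p) \<noteq> 0" using p by (auto simp: detuning_eq_0_iff)
    then show "?Q (int N - int p) / of_real (4 * pi\<^sup>2 * real p * (real N - real p)) * (of_real (detuning N (int p)) * ?\<alpha> p) = ?\<alpha> p * ?Q (int N - int p)"
      unfolding det by simp
  qed
  also have "\<dots> = resonance ?Q N"
  proof -
    have "{1..N - 1} = {1..<N}" using assms by auto
    then show ?thesis using assms by (simp add: resonance_def lessThan_atLeast0 sum.atLeast_Suc_lessThan)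
  qed
  finally show ?thesis .
qed

section \<open>Eigenfunctions and their Fourier coefficients\<close>

lemma detuning_eq_freq: "detuning N k = (pi * of_nat N)\<^sup>2 - (freq N k)\<^sup>2"
  by (simp add: detuning_def freq_def power2_eq_square algebra_simps)

lemma i_freq_squared: "\<i> * of_real \<omega> * (\<i> * of_real \<omega> * z) = - (of_real (\<omega>\<^sup>2) * z)"
proof -
  have "\<i> * of_real \<omega> * (\<i> * of_real \<omega> * z) = (\<i> * \<i>) * (of_real \<omega> * of_real \<omega> * z)" by (simp only: mult_ac)
  then show ?thesis by (simp add: power2_eq_square)
qed

text \<open>The detuning grows like \<open>k * (k - N)\<close>, and \<open>1 / (a * b) \<le> (1 / a)\<^sup>2 + (1 / b)\<^sup>2\<close> separates the two factors. The
resonant indices, where the hypothesis bounds nothing, are two single terms.\<close>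

lemma abs_summable_of_detuning_bound:
  assumes bound: "\<And>k. \<bar>detuning N k\<bar> * norm (c k) \<le> M"
  shows "(\<lambda>k. norm (c k)) summable_on UNIV"
proof -
  let ?s = "\<lambda>k::int. 1 / (of_int k)\<^sup>2 :: real"
  let ?f = "\<lambda>k::int. (if k = 0 \<or> k = int N then norm (c k) else 0) :: real"
  have "M \<ge> 0" using bound[of 0] by (simp add: detuning_def)
  have shift: "(\<lambda>k. ?s (k - int N)) summable_on UNIV"
  proof (subst summable_on_reindex_bij_betw[where f = ?s])
    show "bij_betw (\<lambda>k. k - int N) UNIV UNIV"
      by (rule bij_betw_byWitness[where f' = "\<lambda>k. k + int N"]) auto
  qed (rule summable_on_int_inverse_square)
  have fin: "?f summable_on UNIV"
    by (rule has_sum_imp_summable[OF has_sum_finite_neutralI[of "{0, int N}"]]) auto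
  show ?thesis
  proof (rule summable_on_comparison_test)
    show "(\<lambda>k. M * (?s k + ?s (k - int N)) + ?f k) summable_on UNIV"
      by (intro summable_on_add summable_on_cmult_right shift fin summable_on_int_inverse_square)
    fix k :: int
    show "norm (c k) \<le> M * (?s k + ?s (k - int N)) + ?f k"
    proof (cases "k = 0 \<or> k = int N")
      case True
      then show ?thesis using \<open>M \<ge> 0\<close> by simp
    next
      case False
      define a b where "a = \<bar>real_of_int k\<bar>" and "b = \<bar>real_of_int (k - int N)\<bar>"
      have ab: "a > 0" "b > 0" using False by (auto simp: a_def b_def)
      have "a * b * norm (c k) \<le> \<bar>detuning N k\<bar> * norm (c k)"
      proof (rule mult_right_mono)
        have "a * b \<le> (4 * pi\<^sup>2) * (a * b)" using mult_right_mono[OF four_pi_squared_ge_1, of "a * b"] ab by simp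
        also have "\<dots> = \<bar>detuning N k\<bar>"
          by (simp add: detuning_def a_def b_def abs_mult mult.assoc abs_minus_commute)
        finally show "a * b \<le> \<bar>detuning N k\<bar>" .
      qed simp
      with bound[of k] have "a * b * norm (c k) \<le> M" by linarith
      then have "norm (c k) \<le> M / (a * b)" using ab by (simp add: field_simps)
      also have "\<dots> = M * (1 / a * (1 / b))" by simp
      also have "\<dots> \<le> M * ((1 / a)\<^sup>2 + (1 / b)\<^sup>2)"
      proof (rule mult_left_mono[OF _ \<open>M \<ge> 0\<close>])
        have "2 * (1 / a * (1 / b)) \<le> (1 / a)\<^sup>2 + (1 / b)\<^sup>2" using sum_squares_bound[of "1 / a" "1 / b"] by (simp add: mult.assoc)
        moreover have "0 \<le> 1 / a * (1 / b)" using ab by simp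
        ultimately show "1 / a * (1 / b) \<le> (1 / a)\<^sup>2 + (1 / b)\<^sup>2" by linarith
      qed
      also have "\<dots> = M * (?s k + ?s (k - int N))" by (simp add: a_def b_def power_divide)
      finally show ?thesis using False by simp
    qed
  qed simp
qed

lemma coef_shifted_product:
  assumes q: "q absolutely_integrable_on {0..1}" and y: "continuous_on {0..1} y"
  shows "(\<lambda>x. (q x - \<mu>) * y x) absolutely_integrable_on {0..1}"
    and "coef N (\<lambda>x. (q x - \<mu>) * y x) k = coef N (\<lambda>x. q x * y x) k - \<mu> * coef N y k"
proof -
  have qy: "(\<lambda>x. q x * y x) absolutely_integrable_on {0..1}"
    by (rule absolutely_integrable_mult_continuous[OF q y])
  have my: "(\<lambda>x. \<mu> * y x) absolutely_integrable_on {0..1}"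
    by (intro absolutely_integrable_continuous_real continuous_intros y)
  show "(\<lambda>x. (q x - \<mu>) * y x) absolutely_integrable_on {0..1}"
    using set_integral_diff(1)[OF qy my] by (simp add: left_diff_distrib)
  have 1: "(\<lambda>x. q x * y x * cis (- freq N k * x)) integrable_on {0..1}"
    by (intro set_lebesgue_integral_eq_integral(1) absolutely_integrable_mult_continuous qy continuous_intros)
  have 2: "(\<lambda>x. \<mu> * (y x * cis (- freq N k * x))) integrable_on {0..1}"
    by (intro integrable_continuous_interval continuous_intros y)
  have "coef N (\<lambda>x. (q x - \<mu>) * y x) k = integral {0..1} (\<lambda>x. q x * y x * cis (- freq N k * x) - \<mu> * (y x * cis (- freq N k * x)))"
    unfolding coef_def by (simp only: left_diff_distrib mult.assoc)
  also have "\<dots> = integral {0..1} (\<lambda>x. q x * y x * cis (- freq N k * x)) - integral {0..1} (\<lambda>x. \<mu> * (y x * cis (- freq N k * x)))"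
    by (rule Henstock_Kurzweil_Integration.integral_diff[OF 1 2])
  finally show "coef N (\<lambda>x. (q x - \<mu>) * y x) k = coef N (\<lambda>x. q x * y x) k - \<mu> * coef N y k"
    by (simp only: coef_def Henstock_Kurzweil_Integration.integral_mult_right)
qed

lemma AE_lebesgue_on_negligible:
  assumes "AE x in lebesgue_on {0..1::real}. P x"
  obtains Z where "negligible Z" "\<And>x. x \<in> {0..1} - Z \<Longrightarrow> P x"
proof -
  have "AE x in lebesgue. x \<in> {0..1} \<longrightarrow> P x"
    using assms by (subst (asm) AE_restrict_space_iff) auto
  then obtain Z where "Z \<in> null_sets lebesgue" "{x \<in> space lebesgue. \<not> (x \<in> {0..1} \<longrightarrow> P x)} \<subseteq> Z"
    by (auto simp: eventually_ae_filter)
  then show thesis using that[of Z] by (auto simp: negligible_iff_null_sets)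
qed

lemma negligible_AE_lebesgue_on:
  assumes "negligible Z" "\<And>x. x \<in> {0..1} - Z \<Longrightarrow> P x"
  shows "AE x in lebesgue_on {0..1::real}. P x"
proof -
  have "Z \<in> null_sets lebesgue" using assms(1) by (simp add: negligible_iff_null_sets)
  then have "AE x in lebesgue. x \<in> {0..1} \<longrightarrow> P x" by (rule AE_I') (use assms(2) in auto)
  then show ?thesis by (subst AE_restrict_space_iff) auto
qed

text \<open>Two integrations by parts turn the equation into one for the coefficients. The Fourier coefficients of \<open>q * y\<close> are
bounded, which makes the coefficients of \<open>y\<close> summable; hence \<open>y\<close> is the sum of its Fourier series, and the coefficients
of \<open>q * y\<close> are a convolution.\<close>

lemma eigenfunction_Fourier:
  assumes q: "q absolutely_integrable_on {0..1}" and t: "exp (\<i> * of_real t) = cis (pi * of_nat N)"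
    and y: "y \<in> L_eigenspace t q (of_real ((pi * of_nat N)\<^sup>2))"
  shows "(\<lambda>k. norm (coef N y k)) summable_on UNIV"
    and "\<And>x. x \<in> {0..1} \<Longrightarrow> y x = synth N (coef N y) x"
    and "mode_eqs (fourier_coeff q) N (coef N y)"
proof -
  let ?\<mu> = "complex_of_real ((pi * of_nat N)\<^sup>2)"
  have diff: "y differentiable_on {0..1}" and ac: "abs_cont_on 0 1 (D01 y)"
    and bc: "y 1 = cis (pi * of_nat N) * y 0" "D01 y 1 = cis (pi * of_nat N) * D01 y 0"
    and AE: "AE x in lebesgue_on {0..1}. L_expr q y x = ?\<mu> * y x"
    using y t by (auto simp: L_eigenspace_def L_domain_def)
  have y': "(y has_vector_derivative D01 y x) (at x within {0..1})" if "x \<in> {0..1}" for x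
    unfolding D01_def using diff that by (simp add: differentiable_on_def vector_derivative_works)
  have cont': "continuous_on {0..1} (D01 y)" using ac by (rule abs_cont_on_imp_continuous_on)
  have acy: "abs_cont_on 0 1 y" by (rule abs_cont_on_C1[OF y' cont'])
  have conty: "continuous_on {0..1} y" using acy by (rule abs_cont_on_imp_continuous_on)
  obtain Z1 where Z1: "negligible Z1" "\<And>x. x \<in> {0<..<1} - Z1 \<Longrightarrow> \<exists>d. (D01 y has_vector_derivative d) (at x)"
    by (rule abs_cont_differentiable_AE[OF ac]) blast
  obtain Z2 where Z2: "negligible Z2" "\<And>x. x \<in> {0..1} - Z2 \<Longrightarrow> L_expr q y x = ?\<mu> * y x"
    by (rule AE_lebesgue_on_negligible[OF AE]) blast
  let ?g = "\<lambda>x. (q x - ?\<mu>) * y x"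
  have y'': "(D01 y has_vector_derivative ?g x) (at x)" if x: "x \<in> {0<..<1} - (Z1 \<union> Z2)" for x
  proof -
    obtain d where d: "(D01 y has_vector_derivative d) (at x)" using Z1(2)[of x] x by blast
    have "D01 (D01 y) x = d" unfolding D01_def[of "D01 y"]
      by (rule vector_derivative_at_within_ivl[OF d]) (use x in auto)
    moreover have "L_expr q y x = ?\<mu> * y x" by (rule Z2(2)) (use x in auto)
    ultimately have "d = ?g x" by (simp add: L_expr_def algebra_simps)
    then show ?thesis using d by simp
  qed
  have gint: "?g absolutely_integrable_on {0..1}" by (rule coef_shifted_product(1)[OF q conty])
  have c2: "coef N ?g k = \<i> * of_real (freq N k) * coef N (D01 y) k" for k
    by (rule coef_derivative[OF ac bc(2) gint negligible_Un[OF Z1(1) Z2(1)] y''])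
  have c1: "coef N (D01 y) k = \<i> * of_real (freq N k) * coef N y k" for k
  proof (rule coef_derivative[OF acy bc(1) absolutely_integrable_continuous_real[OF cont'] negligible_empty])
    fix x :: real assume "x \<in> {0<..<1} - {}"
    then show "(y has_vector_derivative D01 y x) (at x)" using y'[of x] at_within_Icc_at[of 0 x 1] by simp
  qed
  have cq: "coef N (\<lambda>x. q x * y x) k = of_real (detuning N k) * coef N y k" for k
  proof -
    have "coef N ?g k = - (of_real ((freq N k)\<^sup>2) * coef N y k)"
      unfolding c2 c1 by (rule i_freq_squared)
    then have "coef N (\<lambda>x. q x * y x) k = ?\<mu> * coef N y k - of_real ((freq N k)\<^sup>2) * coef N y k"
      unfolding coef_shifted_product(2)[OF q conty] by (simp add: diff_eq_eq)
    then show ?thesis unfolding detuning_eq_freq of_real_diff left_diff_distrib .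
  qed
  show summ: "(\<lambda>k. norm (coef N y k)) summable_on UNIV"
  proof (rule abs_summable_of_detuning_bound)
    fix k
    have qy: "(\<lambda>x. q x * y x) absolutely_integrable_on {0..1}" by (rule absolutely_integrable_mult_continuous[OF q conty])
    have "norm (coef N (\<lambda>x. q x * y x) k) \<le> integral {0..1} (\<lambda>x. norm (q x * y x))"
      unfolding coef_def
    proof (rule Henstock_Kurzweil_Integration.integral_norm_bound_integral)
      show "(\<lambda>x. q x * y x * cis (- freq N k * x)) integrable_on {0..1}"
        by (intro set_lebesgue_integral_eq_integral(1) absolutely_integrable_mult_continuous[where g = "\<lambda>x. q x * y x"] qy continuous_intros)
      show "(\<lambda>x. norm (q x * y x)) integrable_on {0..1}" using qy unfolding absolutely_integrable_on_def by blast
    qed (simp add: norm_mult)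
    then show "\<bar>detuning N k\<bar> * norm (coef N y k) \<le> integral {0..1} (\<lambda>x. norm (q x * y x))"
      unfolding cq by (simp only: norm_mult norm_of_real)
  qed
  show ys: "y x = synth N (coef N y) x" if "x \<in> {0..1}" for x
    by (rule coef_eq_imp_eq[OF conty bc(1) continuous_on_synth[OF summ] synth_quasi_periodic _ that])
      (simp only: coef_synth[OF summ])
  show "mode_eqs (fourier_coeff q) N (coef N y)"
    unfolding mode_eqs_def
  proof
    fix k
    have "coef N (\<lambda>x. q x * synth N (coef N y) x) k = coef N (\<lambda>x. q x * y x) k"
      by (rule coef_cong) (simp only: ys)
    then show "((\<lambda>j. coef N y j * fourier_coeff q (k - j)) has_sum of_real (detuning N k) * coef N y k) UNIV"
      using coef_mult_synth[OF summ q, of k N] cq[of k] by simp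
  qed
qed

text \<open>Elements of the domain of the operator are zero off the unit interval.\<close>

definition restrict01 :: "(real \<Rightarrow> complex) \<Rightarrow> real \<Rightarrow> complex"
  where "restrict01 f = (\<lambda>x. if x \<in> {0..1} then f x else 0)"

text \<open>The series itself cannot be differentiated twice term by term. Instead the candidate \<open>g\<close> for its second derivative
is integrated twice; the result \<open>Y\<close> has the same Fourier coefficients as the series, hence equals it on the unit
interval, and the smoothness of \<open>Y\<close> is evident from its construction.\<close>

lemma synth_eigenfunction:
  assumes q: "q absolutely_integrable_on {0..1}" and t: "exp (\<i> * of_real t) = cis (pi * of_nat N)"
    and c: "(\<lambda>k. norm (c k)) summable_on UNIV" and eqs: "mode_eqs (fourier_coeff q) N c"
  shows "restrict01 (synth N c) \<in> L_eigenspace t q (of_real ((pi * of_nat N)\<^sup>2))"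
proof -
  let ?\<mu> = "complex_of_real ((pi * of_nat N)\<^sup>2)"
  let ?s = "synth N c"
  let ?y = "restrict01 ?s"
  have conts: "continuous_on {0..1} ?s" by (rule continuous_on_synth[OF c])
  define g where "g = (\<lambda>x. (q x - ?\<mu>) * ?s x)"
  have gint: "g absolutely_integrable_on {0..1}" unfolding g_def by (rule coef_shifted_product(1)[OF q conts])
  have cg: "coef N g k = \<i> * of_real (freq N k) * (\<i> * of_real (freq N k) * c k)" for k
  proof -
    have "coef N (\<lambda>x. q x * ?s x) k = of_real (detuning N k) * c k"
      using coef_mult_synth[OF c q, of k N] eqs unfolding mode_eqs_def by (metis has_sum_unique)
    then have "coef N g k = of_real (detuning N k) * c k - ?\<mu> * c k"
      unfolding g_def coef_shifted_product(2)[OF q conts] coef_synth[OF c] by simp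
    also have "\<dots> = - (of_real ((freq N k)\<^sup>2) * c k)" by (simp add: detuning_eq_freq algebra_simps)
    finally show ?thesis by (simp only: i_freq_squared)
  qed
  obtain \<beta> where \<beta>: "\<beta> + integral {0..1} g = cis (pi * of_nat N) * \<beta>"
    "\<And>k. coef N (\<lambda>x. \<beta> + integral {0..x} g) k = \<i> * of_real (freq N k) * c k"
    by (rule quasi_periodic_primitive[OF gint cg[symmetric]]) blast
  define u where "u = (\<lambda>x. \<beta> + integral {0..x} g)"
  have acu: "abs_cont_on 0 1 u"
    by (rule abs_cont_on_dominated[OF abs_cont_on_integral[OF gint] abs_cont_on_integral[OF gint], of 1]) (auto simp: u_def)
  have contu: "continuous_on {0..1} u" using acu by (rule abs_cont_on_imp_continuous_on)
  have uint: "u absolutely_integrable_on {0..1}" by (rule absolutely_integrable_continuous_real[OF contu])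
  have cu: "\<i> * of_real (freq N k) * c k = coef N u k" for k using \<beta>(2) by (simp add: u_def)
  obtain \<gamma> where \<gamma>: "\<gamma> + integral {0..1} u = cis (pi * of_nat N) * \<gamma>"
    "\<And>k. coef N (\<lambda>x. \<gamma> + integral {0..x} u) k = c k"
    by (rule quasi_periodic_primitive[OF uint cu]) blast
  define Y where "Y = (\<lambda>x. \<gamma> + integral {0..x} u)"
  have dY: "(Y has_vector_derivative u x) (at x within {0..1})" if "x \<in> {0..1}" for x
    using has_vector_derivative_add[OF has_vector_derivative_const integral_has_vector_derivative[OF contu that]]
    by (simp add: Y_def)
  have contY: "continuous_on {0..1} Y"
    using dY has_vector_derivative_continuous continuous_on_eq_continuous_within by blast
  have Ys: "Y x = ?s x" if "x \<in> {0..1}" for x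
  proof (rule coef_eq_imp_eq[OF contY _ conts synth_quasi_periodic _ that])
    show "Y 1 = cis (pi * of_nat N) * Y 0" using \<gamma>(1) by (simp add: Y_def)
    show "coef N Y k = coef N ?s k" for k unfolding coef_synth[OF c] Y_def by (rule \<gamma>(2))
  qed
  have dy: "(?y has_vector_derivative u x) (at x within {0..1})" if "x \<in> {0..1}" for x
    by (rule has_vector_derivative_transform[OF that _ dY[OF that]]) (simp add: Ys restrict01_def)
  have Dy: "D01 ?y x = u x" if "x \<in> {0..1}" for x
    unfolding D01_def by (rule vector_derivative_within_closed_interval[OF _ that dy[OF that]]) simp
  obtain Z where Z: "negligible Z" "\<And>x. x \<in> {0<..<1} - Z \<Longrightarrow> ((\<lambda>x. integral {0..x} g) has_vector_derivative g x) (at x)"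
    by (rule integral_has_vector_derivative_AE[OF set_lebesgue_integral_eq_integral(1)[OF gint]]) blast
  have Ly: "L_expr q ?y x = ?\<mu> * ?y x" if x: "x \<in> {0..1} - (Z \<union> {0, 1})" for x
  proof -
    have x': "x \<in> {0<..<1} - Z" using x by auto
    have "(u has_vector_derivative g x) (at x)"
      using has_vector_derivative_add[OF has_vector_derivative_const Z(2)[OF x']] by (simp add: u_def)
    then have "(u has_vector_derivative g x) (at x within {0..1})" by (rule has_vector_derivative_at_within)
    then have "(D01 ?y has_vector_derivative g x) (at x within {0..1})"
      by (rule has_vector_derivative_transform[rotated 2]) (use x Dy in auto)
    then have "D01 (D01 ?y) x = g x"
      unfolding D01_def[of "D01 ?y"] by (intro vector_derivative_within_closed_interval) (use x in auto)
    then show ?thesis using x by (simp add: L_expr_def g_def restrict01_def algebra_simps)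
  qed
  have negZ: "negligible (Z \<union> {0, 1})" using Z(1) by simp
  have AE: "AE x in lebesgue_on {0..1}. L_expr q ?y x = ?\<mu> * ?y x"
    by (rule negligible_AE_lebesgue_on[OF negZ Ly])
  have Ls: "L_expr q ?y x = ?\<mu> * ?s x" if "x \<in> {0..1} - (Z \<union> {0, 1})" for x
    using Ly[OF that] that by (simp add: restrict01_def)
  have "L_expr q ?y absolutely_integrable_on {0..1}"
  proof (rule absolutely_integrable_spike[OF _ negZ Ls])
    show "(\<lambda>x. ?\<mu> * ?s x) absolutely_integrable_on {0..1}"
      by (intro absolutely_integrable_continuous_real continuous_intros conts)
  qed
  then have meas: "L_expr q ?y \<in> borel_measurable (lebesgue_on {0..1})"
    by (simp add: absolutely_integrable_measurable)
  have "(\<lambda>x. (norm (L_expr q ?y x))\<^sup>2) absolutely_integrable_on {0..1}"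
  proof (rule absolutely_integrable_spike[OF _ negZ])
    show "(\<lambda>x. (norm (?\<mu> * ?s x))\<^sup>2) absolutely_integrable_on {0..1}"
      by (intro absolutely_integrable_continuous_real continuous_intros conts)
    show "(norm (L_expr q ?y x))\<^sup>2 = (norm (?\<mu> * ?s x))\<^sup>2" if "x \<in> {0..1} - (Z \<union> {0, 1})" for x
      by (simp only: Ls[OF that])
  qed
  then have "integrable (lebesgue_on {0..1}) (\<lambda>x. (norm (L_expr q ?y x))\<^sup>2)"
    by (rule absolutely_integrable_imp_integrable) simp
  with meas have L2: "in_L2 (L_expr q ?y)" by (simp add: in_L2_def)
  have acD: "abs_cont_on 0 1 (D01 ?y)"
    by (rule abs_cont_on_dominated[OF acu acu, of 1]) (auto simp: Dy)
  have dif: "?y differentiable_on {0..1}"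
    unfolding differentiable_on_def using dy has_vector_derivative_def differentiable_def by blast
  have "?y 1 = exp (\<i> * of_real t) * ?y 0"
    using synth_quasi_periodic[of N c] by (simp add: restrict01_def t)
  moreover have "D01 ?y 1 = exp (\<i> * of_real t) * D01 ?y 0"
    using \<beta>(1) by (simp add: Dy t u_def)
  ultimately show ?thesis
    using L2 acD dif AE by (auto simp: L_eigenspace_def L_domain_def restrict01_def)
qed

lemma synth_add: 
  assumes "(\<lambda>k. norm (c k)) summable_on UNIV" "(\<lambda>k. norm (d k)) summable_on UNIV"
  shows "synth N (\<lambda>k. a * c k + b * d k) x = a * synth N c x + b * synth N d x"
proof -
  have s: "(\<lambda>k. e k * cis (freq N k * x)) summable_on UNIV" if "(\<lambda>k. norm (e k)) summable_on UNIV" for e :: "int \<Rightarrow> complex"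
    by (rule abs_summable_summable) (use that in \<open>simp add: norm_mult\<close>)
  have "synth N (\<lambda>k. a * c k + b * d k) x = (\<Sum>\<^sub>\<infinity>k. a * (c k * cis (freq N k * x)) + b * (d k * cis (freq N k * x)))"
    by (simp add: synth_def algebra_simps)
  also have "\<dots> = (\<Sum>\<^sub>\<infinity>k. a * (c k * cis (freq N k * x))) + (\<Sum>\<^sub>\<infinity>k. b * (d k * cis (freq N k * x)))"
    by (intro infsum_add summable_on_cmult_right s assms)
  finally show ?thesis by (simp add: synth_def infsum_cmult_right')
qed

section \<open>The multiplicity criterion\<close>

text \<open>Let \<open>c1\<close> and \<open>c2\<close> be the solutions of the recursion with values \<open>(1, 0)\<close> and \<open>(0, 1)\<close> at the indices
\<open>(0, N)\<close>. Every eigenfunction is a combination of the corresponding series \<open>v1\<close> and \<open>v2\<close>. If the resonance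
coefficient is not zero, \<open>v1\<close> cannot occur; otherwise both are eigenfunctions.\<close>

theorem geometric_multiplicity_eq_2_iff:
  assumes q: "q absolutely_integrable_on {0..1}" and Q: "\<And>n::int. n \<le> 0 \<Longrightarrow> fourier_coeff q n = 0"
    and "N > 0" and t: "exp (\<i> * of_real t) = cis (pi * of_nat N)"
  shows "geometric_multiplicity t q (of_real ((pi * of_nat N)\<^sup>2)) = 2 \<longleftrightarrow> D q N = 0"
proof -
  let ?Q = "fourier_coeff q"
  let ?V = "L_eigenspace t q (of_real ((pi * of_nat N)\<^sup>2))"
  define c1 where "c1 = two_sided (mode_sol ?Q N 1 0)"
  define c2 where "c2 = two_sided (mode_sol ?Q N 0 1)"
  define v1 where "v1 = restrict01 (synth N c1)"
  define v2 where "v2 = restrict01 (synth N c2)"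
  have summ: "(\<lambda>k. norm (two_sided (mode_sol ?Q N a b) k)) summable_on UNIV" for a b
    by (rule two_sided_summable_on[OF mode_sol_summable[OF fourier_coeff_bound[OF q]]])
  have s1: "(\<lambda>k. norm (c1 k)) summable_on UNIV" and s2: "(\<lambda>k. norm (c2 k)) summable_on UNIV"
    by (simp_all only: c1_def c2_def summ)
  have rep: "coef N y 0 * resonance ?Q N = 0 \<and> y = cfun_scale (coef N y 0) v1 + cfun_scale (coef N y (int N)) v2"
    if y: "y \<in> ?V" for y
  proof -
    let ?c = "coef N y"
    have cs: "(\<lambda>k. norm (?c k)) summable_on UNIV" by (rule eigenfunction_Fourier(1)[OF q t y])
    have eqs: "mode_eqs ?Q N ?c" by (rule eigenfunction_Fourier(3)[OF q t y])
    have neg: "?c k = 0" if "k < 0" for k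
      by (rule mode_eqs_negative_zero[OF cs fourier_coeff_bound[OF q] Q eqs that])
    have "?c k = ?c 0 * c1 k + ?c (int N) * c2 k" for k
    proof (cases "k < 0")
      case True
      then show ?thesis by (simp add: neg c1_def c2_def two_sided_def)
    next
      case False
      have "?c (int (nat k)) = mode_sol ?Q N (?c 0) (?c (int N)) (nat k)"
        by (rule mode_eqs_imp_mode_sol(1)[OF eqs neg Q])
      then show ?thesis using False mode_sol_linear[of ?Q N "?c 0" "?c (int N)" "nat k"]
        by (simp add: c1_def c2_def two_sided_def)
    qed
    then have ceq: "?c = (\<lambda>k. ?c 0 * c1 k + ?c (int N) * c2 k)" by (rule ext)
    have "y x = (cfun_scale (?c 0) v1 + cfun_scale (?c (int N)) v2) x" for x
    proof (cases "x \<in> {0..1}")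
      case True
      have "y x = synth N ?c x" by (rule eigenfunction_Fourier(2)[OF q t y True])
      also have "\<dots> = ?c 0 * synth N c1 x + ?c (int N) * synth N c2 x"
        by (subst ceq) (rule synth_add[OF s1 s2])
      finally show ?thesis using True by (simp add: cfun_scale_def v1_def v2_def restrict01_def)
    next
      case False
      then have "y x = 0" using y by (auto simp: L_eigenspace_def L_domain_def)
      moreover have "v1 x = 0" "v2 x = 0" using False by (simp_all only: v1_def v2_def restrict01_def if_False)
      ultimately show ?thesis by (simp add: cfun_scale_def)
    qed
    then show ?thesis using mode_eqs_imp_mode_sol(2)[OF eqs neg Q] by blast
  qed
  have res: "D q N = resonance ?Q N" by (rule D_eq_resonance[OF \<open>N > 0\<close>])
  show ?thesis
  proof (cases "resonance ?Q N = 0")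
    case False
    have "?V \<subseteq> cfun.span {v2}"
    proof
      fix y assume y: "y \<in> ?V"
      have "y = cfun_scale (coef N y (int N)) v2" using rep[OF y] False by (simp add: cfun_scale_def fun_eq_iff)
      then show "y \<in> cfun.span {v2}" by (metis cfun.span_base cfun.span_scale singletonI)
    qed
    then have "cfun.dim ?V \<le> 1" using cfun.dim_le_card[of ?V "{v2}"] by simp
    then show ?thesis using False by (simp add: geometric_multiplicity_def res)
  next
    case True
    have V1: "v1 \<in> ?V" unfolding v1_def c1_def
      by (rule synth_eigenfunction[OF q t summ mode_eqs_mode_sol[OF \<open>N > 0\<close> Q]]) (simp_all add: True)
    have V2: "v2 \<in> ?V" unfolding v2_def c2_def
      by (rule synth_eigenfunction[OF q t summ mode_eqs_mode_sol[OF \<open>N > 0\<close> Q]]) (simp_all add: True)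
    have coef_restrict: "coef N (restrict01 f) k = coef N f k" for f k
      by (rule coef_cong) (simp add: restrict01_def)
    have coefs: "coef N v1 0 = 1" "coef N v2 0 = 0" "coef N v2 (int N) = 1"
      unfolding v1_def v2_def coef_restrict coef_synth[OF s1] coef_synth[OF s2]
      using \<open>N > 0\<close> by (simp_all add: c1_def c2_def two_sided_def)
    have coef_scale: "coef N (cfun_scale a f) k = a * coef N f k" for a f k
      by (simp add: coef_def cfun_scale_def mult.assoc)
    have "v2 \<noteq> 0" using coefs(3) by (auto simp: coef_def)
    have "v1 \<notin> cfun.span {v2}"
    proof
      assume "v1 \<in> cfun.span {v2}"
      then obtain a where "v1 = cfun_scale a v2" by (auto simp: cfun.span_singleton)
      then show False using coefs coef_scale by simp
    qed
    moreover from this have "v1 \<noteq> v2" using cfun.span_base[of v2 "{v2}"] by auto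
    ultimately have indep: "cfun.independent {v1, v2}"
      using \<open>v2 \<noteq> 0\<close> by (simp add: cfun.independent_insert)
    have span: "?V \<subseteq> cfun.span {v1, v2}"
    proof
      fix y assume y: "y \<in> ?V"
      have "cfun_scale (coef N y 0) v1 + cfun_scale (coef N y (int N)) v2 \<in> cfun.span {v1, v2}"
        by (intro cfun.span_add cfun.span_scale cfun.span_base) auto
      then show "y \<in> cfun.span {v1, v2}" using rep[OF y] by simp
    qed
    have "cfun.dim ?V = 2"
      by (rule cfun.dim_unique[OF _ span indep]) (use V1 V2 \<open>v1 \<noteq> v2\<close> in auto)
    then show ?thesis using True by (simp add: geometric_multiplicity_def res)
  qed
qed

theorem theorem10:
  fixes q :: "real \<Rightarrow> complex"
  assumes "q absolutely_integrable_on {0..1}"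
    and "\<And>x. q (x + 1) = q x"
    and "\<And>n::int. n \<le> 0 \<Longrightarrow> fourier_coeff q n = 0"
  shows "(\<forall>n::nat. n \<ge> 1 \<longrightarrow>
            (geometric_multiplicity 0 q (of_real ((2 * pi * real n)\<^sup>2)) = 2
               \<longleftrightarrow> D q (2 * n) = 0)) \<and>
         (\<forall>n::nat.
            (geometric_multiplicity pi q (of_real ((2 * pi * real n + pi)\<^sup>2)) = 2
               \<longleftrightarrow> D q (2 * n + 1) = 0))"
proof (intro conjI allI impI)
  fix n :: nat assume "n \<ge> 1"
  have eq: "2 * pi * real n = pi * of_nat (2 * n)" by simp
  show "geometric_multiplicity 0 q (of_real ((2 * pi * real n)\<^sup>2)) = 2 \<longleftrightarrow> D q (2 * n) = 0"
    unfolding eq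
  proof (rule geometric_multiplicity_eq_2_iff[OF assms(1,3)])
    show "exp (\<i> * of_real 0) = cis (pi * of_nat (2 * n))" unfolding cis_pi_even by simp
  qed (use \<open>n \<ge> 1\<close> in auto)
next
  fix n :: nat
  have eq: "2 * pi * real n + pi = pi * of_nat (2 * n + 1)" by (simp add: algebra_simps)
  show "geometric_multiplicity pi q (of_real ((2 * pi * real n + pi)\<^sup>2)) = 2 \<longleftrightarrow> D q (2 * n + 1) = 0"
    unfolding eq
  proof (rule geometric_multiplicity_eq_2_iff[OF assms(1,3)])
    have "pi * of_nat (2 * n + 1) = pi * of_nat (2 * n) + pi" by (simp add: algebra_simps)
    then have "cis (pi * of_nat (2 * n + 1)) = cis (pi * of_nat (2 * n)) * cis pi" by (simp only: cis_mult)
    then show "exp (\<i> * of_real pi) = cis (pi * of_nat (2 * n + 1))" unfolding cis_pi_even by (simp add: cis_conv_exp)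
  qed auto
qed

end
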